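(* For $n\ge1$, let $s_n(\Gamma_3(3))$ be the number of subgroups of index $n$ in $\Gamma_3(3)$. These numbers obey the following congruences modulo $8$: (i) $s_n(\Gamma_3(3))\equiv1\pmod 8$ if, and only if, $n=1,2,10$, or if $n$ is of the form $2^\sigma-3$ for some $\sigma\ge4$; (ii) $s_n(\Gamma_3(3))\equiv2\pmod 8$ if, and only if, $n=7,9,17,18,27,42$, or if $n$ is of one of the forms $3\cdot2^\sigma-3$, $3\cdot2^\sigma-6$, for some $\sigma\ge5$; (iii) $s_n(\Gamma_3(3))\equiv4\pmod 8$ if, and only if, $n=3,12,22,23,36,38,39,43,46,49,50,51,53,54,63$, or if $n$ is of one of the forms $2^\sigma+6$, $2^\sigma+7$, $2^\sigma+11$, $2^\sigma+14$, $2^\sigma+17$, $2^\sigma+18$, $2^\sigma+19$, $2^\sigma+21$, for some $\sigma\ge6$; $2^\sigma+2^\tau-2$, $2^\sigma+2^\tau+1$, $2^\sigma+2^\tau+2$, $2^\sigma+2^\tau+3$, $2^\sigma+2^\tau+5$, $2^\sigma+2^\tau+10$, $2^\sigma+2^\tau+13$, for some $\sigma,\tau$ with $\sigma\ge6$ and $5\le\tau\le\sigma-1$; $2^\sigma+2^\tau+2^\nu-6$, $2^\sigma+2^\tau+2^\nu-3$, for some $\sigma,\tau,\nu$ with $\sigma\ge7$, $6\le\nu\le\sigma-1$, and $5\le\tau\le\nu-1$; (iv) $s_n(\Gamma_3(3))\equiv5\pmod 8$ if, and only if, $n=5$, or if $n$ is of the form $2^\sigma-6$ for some $\sigma\ge5$;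 (v) $s_n(\Gamma_3(3))\equiv6\pmod 8$ if, and only if, $n=6,11$, or if $n$ is of one of the forms $2^\sigma-2$, $2^\sigma+3$, $2^\sigma+4$, for some $\sigma\ge4$; $2^\sigma+1$, $2^\sigma+2$, $2^\sigma+13$, for some $\sigma\ge5$; $2^\sigma+10$, for some $\sigma\ge6$; $2^\sigma+2^\tau-6$, $2^\sigma+2^\tau-3$, for some $\sigma,\tau$ with $\sigma\ge7$ and $5\le\tau\le\sigma-2$; (vi) in the cases not covered by items (i)–(v), $s_n(\Gamma_3(3))$ is divisible by $8$; in particular, $s_n(\Gamma_3(3))\not\equiv3,7\pmod 8$ for all $n$.
   Context: $\Gamma_3(3)=\langle x,y\mid x^{6}=y^{9}=1,\ x^2=y^3\rangle=C_6\underset{C_3}{\ast}C_9$. The parameters $\sigma,\tau,\nu$ are integers.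
   Formalization: In (v) the printed form 2^σ+4 (σ≥4) is replaced by 2^σ+5 (σ≥4): as printed, n=36=2^5+4 would have residue 6 by (v) but residue 4 by (iii), so the printed statement is inconsistent. *)

theory Defs
  imports "HOL-Algebra.Coset" "HOL-Number_Theory.Cong"
begin

(* The letter (g, True) stands for the generator g, and (g, False) for its formal inverse. *)
type_synonym 'g word = "('g \<times> bool) list"

text \<open>
  A defining relation \<open>u = v\<close> is given as the pair \<open>(u, v)\<close>. The relation below is the least
  congruence on words that contains \<open>R\<close> and cancels adjacent inverse letters.
\<close>

inductive pres_eq :: "('g word \<times> 'g word) set \<Rightarrow> 'g word \<Rightarrow> 'g word \<Rightarrow> bool"
  for R :: "('g word \<times> 'g word) set" where
  pres_rel: "(u, v) \<in> R \<Longrightarrow> pres_eq R (a @ u @ b) (a @ v @ b)"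
| pres_cancel: "pres_eq R (a @ [(g, e), (g, \<not> e)] @ b) (a @ b)"
| pres_refl: "pres_eq R u u"
| pres_sym: "pres_eq R u v \<Longrightarrow> pres_eq R v u"
| pres_trans: "pres_eq R u v \<Longrightarrow> pres_eq R v w \<Longrightarrow> pres_eq R u w"

definition pres_cong :: "('g word \<times> 'g word) set \<Rightarrow> ('g word \<times> 'g word) set" where
  "pres_cong R = {(u, v). pres_eq R u v}"

(* All elements of the type 'g are generators. *)
definition presented_group :: "('g word \<times> 'g word) set \<Rightarrow> 'g word set monoid" where
  "presented_group R =
    \<lparr> carrier = UNIV // pres_cong R,
      monoid.mult = (\<lambda>A B. \<Union>u\<in>A. \<Union>v\<in>B. pres_cong R `` {u @ v}),
      one = pres_cong R `` {[]} \<rparr>"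

lemma equiv_pres_cong: "equiv UNIV (pres_cong R)"
  unfolding equiv_def refl_on_def sym_def trans_def pres_cong_def
  by (auto intro: pres_refl pres_sym pres_trans)

lemma pres_eq_context: "pres_eq R u v \<Longrightarrow> pres_eq R (a @ u @ b) (a @ v @ b)"
proof (induction rule: pres_eq.induct)
  case (pres_rel u v c d)
  then show ?case using pres_eq.pres_rel[of u v R "a @ c" "d @ b"] by simp
next
  case (pres_cancel c g e d)
  then show ?case using pres_eq.pres_cancel[of R "a @ c" g e "d @ b"] by simp
qed (auto intro: pres_eq.pres_refl pres_eq.pres_sym pres_eq.pres_trans)

lemma pres_eq_append: "pres_eq R u u' \<Longrightarrow> pres_eq R v v' \<Longrightarrow> pres_eq R (u @ v) (u' @ v')"
  using pres_eq_context[of R u u' "[]" v] pres_eq_context[of R v v' u' "[]"]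
  by (auto intro: pres_trans)

lemma presented_group_mult:
  "(pres_cong R `` {u}) \<otimes>\<^bsub>presented_group R\<^esub> (pres_cong R `` {v}) = pres_cong R `` {u @ v}"
proof -
  have "congruent2 (pres_cong R) (pres_cong R) (\<lambda>u v. pres_cong R `` {u @ v})"
    by (rule congruent2I'[OF equiv_class_eq[OF equiv_pres_cong]])
       (simp add: pres_cong_def pres_eq_append)
  then show ?thesis
    by (simp add: presented_group_def UN_equiv_class2[OF equiv_pres_cong equiv_pres_cong])
qed

definition word_inv :: "'g word \<Rightarrow> 'g word" where
  "word_inv w = rev (map (\<lambda>(g, e). (g, \<not> e)) w)"

lemma pres_eq_word_inv: "pres_eq R (word_inv w @ w) []"
proof (induction w)
  case Nil
  then show ?case by (simp add: word_inv_def pres_refl)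
next
  case (Cons l w)
  obtain g e where l: "l = (g, e)" by (cases l)
  have "pres_eq R (word_inv (l # w) @ l # w) (word_inv w @ w)"
    using pres_cancel[of R "word_inv w" g "\<not> e" w] by (simp add: word_inv_def l)
  with Cons show ?case by (blast intro: pres_trans)
qed

lemma group_presented_group: "group (presented_group R)"
proof (rule groupI)
  have car: "carrier (presented_group R) = UNIV // pres_cong R"
    and one: "\<one>\<^bsub>presented_group R\<^esub> = pres_cong R `` {[]}"
    by (simp_all add: presented_group_def)
  show "\<one>\<^bsub>presented_group R\<^esub> \<in> carrier (presented_group R)"
    by (simp add: car one quotientI)
  fix A assume "A \<in> carrier (presented_group R)"
  then obtain u where A: "A = pres_cong R `` {u}" by (auto simp: car elim: quotientE)
  show "\<one>\<^bsub>presented_group R\<^esub> \<otimes>\<^bsub>presented_group R\<^esub> A = A"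
    by (simp add: A one presented_group_mult)
  have "pres_cong R `` {word_inv u} \<otimes>\<^bsub>presented_group R\<^esub> A = \<one>\<^bsub>presented_group R\<^esub>"
    unfolding A one presented_group_mult
    by (rule equiv_class_eq[OF equiv_pres_cong]) (simp add: pres_cong_def pres_eq_word_inv)
  then show "\<exists>B\<in>carrier (presented_group R). B \<otimes>\<^bsub>presented_group R\<^esub> A = \<one>\<^bsub>presented_group R\<^esub>"
    by (auto simp: car intro!: bexI quotientI)
  fix B assume "B \<in> carrier (presented_group R)"
  then obtain v where B: "B = pres_cong R `` {v}" by (auto simp: car elim: quotientE)
  show "A \<otimes>\<^bsub>presented_group R\<^esub> B \<in> carrier (presented_group R)"
    by (simp add: A B car presented_group_mult quotientI)
  fix C assume "C \<in> carrier (presented_group R)"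
  then obtain w where C: "C = pres_cong R `` {w}" by (auto simp: car elim: quotientE)
  show "A \<otimes>\<^bsub>presented_group R\<^esub> B \<otimes>\<^bsub>presented_group R\<^esub> C =
      A \<otimes>\<^bsub>presented_group R\<^esub> (B \<otimes>\<^bsub>presented_group R\<^esub> C)"
    by (simp add: A B C presented_group_mult)
qed

datatype gen = Gen_x | Gen_y

abbreviation gen_pow :: "gen \<Rightarrow> nat \<Rightarrow> gen word" where
  "gen_pow g k \<equiv> replicate k (g, True)"

(* This is the amalgam of C_6 = <x> and C_9 = <y> over the subgroups <x^2> and <y^3> of order 3. *)
definition Gamma33 :: "gen word set monoid" where
  "Gamma33 = presented_group
    {(gen_pow Gen_x 6, []), (gen_pow Gen_y 9, []), (gen_pow Gen_x 2, gen_pow Gen_y 3)}"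

(* For n > 0, the condition on card also forces the index to be finite. *)
definition num_subgroups :: "('a, 'b) monoid_scheme \<Rightarrow> nat \<Rightarrow> nat" where
  "num_subgroups G n = card {H. subgroup H G \<and> card (rcosets\<^bsub>G\<^esub> H) = n}"

text \<open>
  The indices are compared in \<open>int\<close>, so that the subtractions do not truncate. In each case the
  lower bounds on the exponents make it harmless that these range over \<open>nat\<close>.
\<close>

definition index_class1 :: "nat \<Rightarrow> bool" where
  "index_class1 n \<longleftrightarrow> n \<in> {1, 2, 10} \<or> (\<exists>\<sigma>\<ge>4. int n = 2 ^ \<sigma> - 3)"

definition index_class2 :: "nat \<Rightarrow> bool" where
  "index_class2 n \<longleftrightarrow> n \<in> {7, 9, 17, 18, 27, 42}
    \<or> (\<exists>\<sigma>\<ge>5. int n = 3 * 2 ^ \<sigma> - 3 \<or> int n = 3 * 2 ^ \<sigma> - 6)"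

definition index_class4 :: "nat \<Rightarrow> bool" where
  "index_class4 n \<longleftrightarrow>
    n \<in> {3, 12, 22, 23, 36, 38, 39, 43, 46, 49, 50, 51, 53, 54, 63}
    \<or> (\<exists>\<sigma>\<ge>6. \<exists>d\<in>{6, 7, 11, 14, 17, 18, 19, 21}. int n = 2 ^ \<sigma> + d)
    \<or> (\<exists>\<sigma> \<tau>. \<sigma> \<ge> 6 \<and> 5 \<le> \<tau> \<and> \<tau> \<le> \<sigma> - 1 \<and>
        (\<exists>d\<in>{- 2, 1, 2, 3, 5, 10, 13}. int n = 2 ^ \<sigma> + 2 ^ \<tau> + d))
    \<or> (\<exists>\<sigma> \<tau> \<nu>. \<sigma> \<ge> 7 \<and> 6 \<le> \<nu> \<and> \<nu> \<le> \<sigma> - 1 \<and> 5 \<le> \<tau> \<and> \<tau> \<le> \<nu> - 1 \<and>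
        (\<exists>d\<in>{- 6, - 3}. int n = 2 ^ \<sigma> + 2 ^ \<tau> + 2 ^ \<nu> + d))"

definition index_class5 :: "nat \<Rightarrow> bool" where
  "index_class5 n \<longleftrightarrow> n = 5 \<or> (\<exists>\<sigma>\<ge>5. int n = 2 ^ \<sigma> - 6)"

(* The offset 5 in the first family is a correction: the source prints 2^sigma + 4 there. With
   that form, n = 36 = 2^5 + 4 would belong both to this class and to index_class4. *)
definition index_class6 :: "nat \<Rightarrow> bool" where
  "index_class6 n \<longleftrightarrow> n \<in> {6, 11}
    \<or> (\<exists>\<sigma>\<ge>4. \<exists>d\<in>{- 2, 3, 5}. int n = 2 ^ \<sigma> + d)
    \<or> (\<exists>\<sigma>\<ge>5. \<exists>d\<in>{1, 2, 13}. int n = 2 ^ \<sigma> + d)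
    \<or> (\<exists>\<sigma>\<ge>6. int n = 2 ^ \<sigma> + 10)
    \<or> (\<exists>\<sigma> \<tau>. \<sigma> \<ge> 7 \<and> 5 \<le> \<tau> \<and> \<tau> \<le> \<sigma> - 2 \<and>
        (\<exists>d\<in>{- 6, - 3}. int n = 2 ^ \<sigma> + 2 ^ \<tau> + d))"

end

theory Submission
  imports Defs "HOL-Combinatorics.Cycles" "HOL-Computational_Algebra.Formal_Power_Series"
begin

text \<open>
  Subgroups of index \<open>n\<close> correspond to transitive actions on \<open>n\<close> points, up to \<open>(n - 1)!\<close>
  relabellings. The element \<open>c = x^2 = y^3\<close> is central, so in a transitive action it is trivial or
  has only 3-cycles. The actions of the first kind are pairs of permutations with
  \<open>x^2 = y^3 = 1\<close>; those of the second kind are counted over the conjugacy class of \<open>c\<close>. In both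
  cases the exponential generating function \<open>H\<close> of all actions satisfies a linear differential
  equation of order two, hence the generating function \<open>H'/H\<close> of the subgroup numbers satisfies a
  Riccati equation, which determines it modulo 8.

  For the second kind the solution modulo 8 is a polynomial. For the first kind it is a combination
  of 1 and the series \<open>\<alpha>\<close>, \<open>\<beta>\<close>, \<open>\<gamma>\<close> in \<open>X^32\<close> whose exponents, divided by 32, have one,
  two or three binary digits 1 (or, in \<open>\<gamma>\<close>, are of the form \<open>3 * 2 ^ i\<close>), with Laurent
  polynomials as coefficients. The products of \<open>\<alpha>\<close> and \<open>\<beta>\<close> reduce to linear terms by functional equations relating \<open>F(X)\<close> and \<open>F(X^2)\<close>, and the derivatives of series in \<open>X^32\<close>
  vanish modulo 8, so that checking the Riccati equation amounts to four polynomial identities.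
\<close>

subsection \<open>Orbit decomposition of pairs of permutations\<close>

text \<open>The coefficients of \<open>H\<close> are counts divided by factorials (one of them is
  15/4), so neither \<open>H\<close> nor its differential equation can be reduced modulo 8. Only
  \<open>H'/H\<close> is integral. Therefore all work up to the Riccati equation is over the reals,
  where \<open>H\<close> can be cancelled, and the result is pulled back to integer series. The
  Riccati equation fixes its solution modulo 8 without any division: the unknown occurs linearly
  with a coefficient of constant term 1, while its derivative and its square carry a factor
  \<open>X^2\<close>. Hence it suffices to exhibit one series that solves the equation modulo 8, and
  this series can be read off from the classification that is to be proved. The derivatives only ask
  for series in \<open>X^8\<close>. The exponent 32 comes from the families: their smallest power is
  \<open>2^5\<close> or is covered by exceptions, and their offsets, shifted by 6, lie between 0 and
  27. The orbit recurrence is proved for an arbitrary local condition since it serves twice: for the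
  actions of the group, and, with the second permutation forced to be the identity, for counting
  permutations by cycle lengths.\<close>

definition rst :: "('a \<Rightarrow> 'a) \<Rightarrow> 'a set \<Rightarrow> 'a \<Rightarrow> 'a" where
  "rst f S = (\<lambda>s. if s \<in> S then f s else s)"

lemma rst_permutes:
  assumes "f permutes T" "finite S" "f ` S \<subseteq> S"
  shows "rst f S permutes S"
proof (rule bij_imp_permutes)
  have "inj_on f S" using assms(1) by (meson inj_on_subset permutes_inj subset_UNIV)
  then have "bij_betw f S S"
    using assms(2,3) by (simp add: bij_betw_def endo_inj_surj)
  then show "bij_betw (rst f S) S S" by (rule bij_betw_cong[THEN iffD1, rotated]) (simp add: rst_def)
qed (simp add: rst_def)

lemma permutes_image_Diff:
  assumes "f permutes T" "finite S" "f ` S \<subseteq> S" "S \<subseteq> T"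
  shows "f ` (T - S) \<subseteq> T - S"
proof -
  have inj: "inj f" using assms(1) by (rule permutes_inj)
  then have "f ` S = S"
    using assms(2,3) by (meson endo_inj_surj inj_on_subset subset_UNIV)
  then show ?thesis
    using image_set_diff[OF inj, of T S] permutes_image[OF assms(1)] by simp
qed

lemma rst_comp_rst:
  assumes "f permutes T" "finite S" "f ` S \<subseteq> S" "S \<subseteq> T"
  shows "rst f S \<circ> rst f (T - S) = f"
proof
  fix s
  have "f ` (T - S) \<subseteq> T - S" using assms by (rule permutes_image_Diff)
  then show "(rst f S \<circ> rst f (T - S)) s = f s"
    using assms permutes_not_in[OF assms(1)] by (auto simp: rst_def image_subset_iff)
qed

text \<open>The supports are disjoint, so the factors do not interfere. This is the counterpart of
  \<open>rst_comp_rst\<close>: glueing and then cutting returns the pieces.\<close>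

lemma comp_on_left:
  assumes "f permutes S" "g permutes R" "S \<inter> R = {}"
  shows "s \<in> S \<Longrightarrow> (f \<circ> g) s = f s" "s \<in> R \<Longrightarrow> (f \<circ> g) s = g s"
    "rst (f \<circ> g) S = f" "rst (f \<circ> g) R = g"
proof -
  have 1: "(f \<circ> g) s = f s" if "s \<in> S" for s
  proof -
    have "s \<notin> R" using that assms(3) by blast
    then show ?thesis using permutes_not_in[OF assms(2)] by simp
  qed
  have 2: "(f \<circ> g) s = g s" if "s \<in> R" for s
  proof -
    have "g s \<notin> S" using that assms(3) permutes_in_image[OF assms(2), of s] by blast
    then show ?thesis using permutes_not_in[OF assms(1)] by simp
  qed
  show "s \<in> S \<Longrightarrow> (f \<circ> g) s = f s" "s \<in> R \<Longrightarrow> (f \<circ> g) s = g s" using 1 2 by blast+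
  show "rst (f \<circ> g) S = f"
    using 1 permutes_not_in[OF assms(1)] by (force simp: rst_def)
  show "rst (f \<circ> g) R = g"
    using 2 permutes_not_in[OF assms(2)] by (force simp: rst_def)
qed

section \<open>Closed sets, orbits and local conditions\<close>

definition closed_under :: "('a \<Rightarrow> 'a) \<Rightarrow> ('a \<Rightarrow> 'a) \<Rightarrow> 'a set \<Rightarrow> bool" where
  "closed_under x y S \<longleftrightarrow> x ` S \<subseteq> S \<and> y ` S \<subseteq> S"

text \<open>Transitivity seen from the base point \<open>p\<close>: the smallest closed set around
  \<open>p\<close> is its orbit. Closed sets speak of forward images only; on a finite set a
  permutation that maps a subset into itself maps it onto itself, so inverses come for free.\<close>

definition connected_from :: "'a \<Rightarrow> 'a set \<Rightarrow> ('a \<Rightarrow> 'a) \<Rightarrow> ('a \<Rightarrow> 'a) \<Rightarrow> bool" where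
  "connected_from p T x y \<longleftrightarrow> (\<forall>S\<subseteq>T. p \<in> S \<longrightarrow> closed_under x y S \<longrightarrow> S = T)"

definition acts :: "((nat \<Rightarrow> nat) \<Rightarrow> (nat \<Rightarrow> nat) \<Rightarrow> nat \<Rightarrow> bool) \<Rightarrow> nat set
    \<Rightarrow> ((nat \<Rightarrow> nat) \<times> (nat \<Rightarrow> nat)) set" where
  "acts Q T = {(x, y). x permutes T \<and> y permutes T \<and> (\<forall>t\<in>T. Q x y t)}"

definition conn_acts :: "((nat \<Rightarrow> nat) \<Rightarrow> (nat \<Rightarrow> nat) \<Rightarrow> nat \<Rightarrow> bool) \<Rightarrow> nat \<Rightarrow> nat set
    \<Rightarrow> ((nat \<Rightarrow> nat) \<times> (nat \<Rightarrow> nat)) set" where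
  "conn_acts Q p T = {(x, y) \<in> acts Q T. connected_from p T x y}"

lemma finite_acts: "finite T \<Longrightarrow> finite (acts Q T)"
  by (rule finite_subset[of _ "{x. x permutes T} \<times> {y. y permutes T}"])
     (auto simp: acts_def finite_permutations)

lemma finite_conn_acts: "finite T \<Longrightarrow> finite (conn_acts Q p T)"
  by (rule finite_subset[OF _ finite_acts[of T Q]]) (auto simp: conn_acts_def)

text \<open>\<open>Q\<close> may look only at what is reachable from \<open>t\<close>, and only up
  to renaming points. The first makes it pass to orbits (\<open>agree\<close>), the second makes
  counts depend on the size of the set alone (\<open>relabel\<close>).\<close>

locale local_property =
  fixes Q :: "(nat \<Rightarrow> nat) \<Rightarrow> (nat \<Rightarrow> nat) \<Rightarrow> nat \<Rightarrow> bool"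
  assumes transfer: "\<lbrakk>inj_on b S; closed_under x y S; \<And>s. s \<in> S \<Longrightarrow> x' (b s) = b (x s);
    \<And>s. s \<in> S \<Longrightarrow> y' (b s) = b (y s); t \<in> S\<rbrakk> \<Longrightarrow> Q x' y' (b t) = Q x y t"
begin

lemma agree:
  assumes "closed_under x y S" "\<And>s. s \<in> S \<Longrightarrow> x' s = x s" "\<And>s. s \<in> S \<Longrightarrow> y' s = y s" "t \<in> S"
  shows "Q x' y' t = Q x y t"
  using transfer[of "\<lambda>s. s" S x y x' y' t] assms by simp

lemma relabel:
  assumes b: "bij_betw b T T'"
  shows "card (acts Q T) = card (acts Q T')"
    and "p \<in> T \<Longrightarrow> card (conn_acts Q p T) = card (conn_acts Q (b p) T')"
proof -
  \<comment> \<open>\<open>c\<close> is conjugation by \<open>b\<close>, in the form in which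
    \<open>bij_betw_permutations\<close> gives it as a bijection between the permutations of
    \<open>T\<close> and those of \<open>T'\<close>.\<close>
  define c where "c = (\<lambda>\<pi> x. if x \<in> T' then b (\<pi> (inv_into T b x)) else x)"
  have bij_c: "bij_betw c {\<pi>. \<pi> permutes T} {\<pi>. \<pi> permutes T'}"
    unfolding c_def by (rule bij_betw_permutations[OF b])
  have cb: "c x (b s) = b (x s)" if "s \<in> T" for x s
    using that b bij_betw_inv_into_left[OF b that] bij_betwE[OF b] by (auto simp: c_def)
  have inj: "inj_on b T" using b by (rule bij_betw_imp_inj_on)
  have im: "b ` T = T'" using b by (rule bij_betw_imp_surj_on)
  have cl: "closed_under x y T" if "x permutes T" "y permutes T" for x y
    using that by (simp add: closed_under_def permutes_image)
  have Q: "(\<forall>t\<in>T'. Q (c x) (c y) t) = (\<forall>t\<in>T. Q x y t)" if "x permutes T" "y permutes T" for x y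
    unfolding im[symmetric] ball_simps
    using transfer[OF inj cl[OF that] cb cb] by (auto simp: im)
  have clS: "closed_under (c x) (c y) (b ` S) = closed_under x y S"
    if "S \<subseteq> T" "x permutes T" "y permutes T" for x y S
  proof -
    have "c z ` b ` S = b ` z ` S" for z
      unfolding image_image using cb that(1) by (intro image_cong) auto
    moreover have "b ` z ` S \<subseteq> b ` S \<longleftrightarrow> z ` S \<subseteq> S" if "z permutes T" for z
    proof -
      have "b (z s) \<in> b ` S \<longleftrightarrow> z s \<in> S" if "s \<in> S" for s
        using that \<open>S \<subseteq> T\<close> \<open>z permutes T\<close>
        by (intro inj_on_image_mem_iff[OF inj]) (auto simp: permutes_in_image)
      then show ?thesis by (simp add: image_subset_iff)
    qed
    ultimately show ?thesis using that by (simp add: closed_under_def)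
  qed
  have conn: "connected_from (b p) T' (c x) (c y) = connected_from p T x y"
    if "p \<in> T" "x permutes T" "y permutes T" for x y
  proof -
    have "connected_from (b p) T' (c x) (c y) \<longleftrightarrow>
      (\<forall>S\<subseteq>T. b p \<in> b ` S \<longrightarrow> closed_under (c x) (c y) (b ` S) \<longrightarrow> b ` S = b ` T)"
      unfolding connected_from_def im[symmetric] all_subset_image ..
    also have "\<dots> \<longleftrightarrow> connected_from p T x y"
    proof -
      have "b p \<in> b ` S \<longleftrightarrow> p \<in> S" "b ` S = b ` T \<longleftrightarrow> S = T" if "S \<subseteq> T" for S
        using that \<open>p \<in> T\<close> inj by (auto simp: inj_on_image_mem_iff inj_on_image_eq_iff)
      with clS[OF _ that(2,3)] show ?thesis by (simp add: connected_from_def)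
    qed
    finally show ?thesis .
  qed
  let ?P = "{\<pi>. \<pi> permutes T} \<times> {\<pi>. \<pi> permutes T}"
  have cc: "bij_betw (map_prod c c) ?P ({\<pi>. \<pi> permutes T'} \<times> {\<pi>. \<pi> permutes T'})"
    using bij_c by (intro bij_betw_map_prod)
  have inj_cc: "inj_on (map_prod c c) ?P" and im_cc: "map_prod c c ` ?P = {\<pi>. \<pi> permutes T'} \<times> {\<pi>. \<pi> permutes T'}"
    using cc by (auto simp: bij_betw_def)
  have img: "{z \<in> f ` U. R z} = f ` {z \<in> U. R (f z)}" for f :: "'z \<Rightarrow> 'z" and U R by blast
  have A: "acts Q T' = map_prod c c ` acts Q T"
  proof -
    have "acts Q T' = {z \<in> map_prod c c ` ?P. \<forall>t\<in>T'. Q (fst z) (snd z) t}"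
      unfolding im_cc by (auto simp: acts_def)
    also have "\<dots> = map_prod c c ` {z \<in> ?P. \<forall>t\<in>T'. Q (c (fst z)) (c (snd z)) t}"
      unfolding img by simp
    also have "{z \<in> ?P. \<forall>t\<in>T'. Q (c (fst z)) (c (snd z)) t} = acts Q T"
    proof (rule Set.set_eqI)
      fix z :: "(nat \<Rightarrow> nat) \<times> (nat \<Rightarrow> nat)"
      show "z \<in> {z \<in> ?P. \<forall>t\<in>T'. Q (c (fst z)) (c (snd z)) t} \<longleftrightarrow> z \<in> acts Q T"
        by (cases z) (simp add: acts_def Q cong: conj_cong)
    qed
    finally show ?thesis .
  qed
  have sub: "acts Q T \<subseteq> ?P" by (auto simp: acts_def)
  show "card (acts Q T) = card (acts Q T')"
    unfolding A using inj_cc sub by (metis card_image inj_on_subset)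
  assume p: "p \<in> T"
  have "conn_acts Q (b p) T' = {z \<in> map_prod c c ` acts Q T. connected_from (b p) T' (fst z) (snd z)}"
    unfolding conn_acts_def A[symmetric] by auto
  also have "\<dots> = map_prod c c ` {z \<in> acts Q T. connected_from (b p) T' (c (fst z)) (c (snd z))}"
    unfolding img by simp
  also have "{z \<in> acts Q T. connected_from (b p) T' (c (fst z)) (c (snd z))} = conn_acts Q p T"
  proof (rule Set.set_eqI)
    fix z :: "(nat \<Rightarrow> nat) \<times> (nat \<Rightarrow> nat)"
    show "z \<in> {z \<in> acts Q T. connected_from (b p) T' (c (fst z)) (c (snd z))} \<longleftrightarrow> z \<in> conn_acts Q p T"
      using conn[OF p] by (cases z) (simp add: conn_acts_def acts_def cong: conj_cong)
  qed
  finally have "conn_acts Q (b p) T' = map_prod c c ` conn_acts Q p T" .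
  moreover have "conn_acts Q p T \<subseteq> ?P" using sub by (auto simp: conn_acts_def)
  ultimately show "card (conn_acts Q p T) = card (conn_acts Q (b p) T')"
    using inj_cc by (metis card_image inj_on_subset)
qed

lemma card_acts_eq:
  assumes "finite T" shows "card (acts Q T) = card (acts Q {..<card T})"
  using ex_bij_betw_finite_nat[OF assms] relabel(1) by (auto simp: atLeast0LessThan)

lemma card_conn_acts_eq:
  assumes "finite T" "p \<in> T" shows "card (conn_acts Q p T) = card (conn_acts Q 0 {..<card T})"
proof -
  obtain b where b: "bij_betw b T {0..<card T}" using ex_bij_betw_finite_nat[OF assms(1)] by blast
  have "b p \<in> {..<card T}" "0 \<in> {..<card T}"
    using bij_betwE[OF b] assms by (auto simp: card_gt_0_iff)
  \<comment> \<open>The numbering \<open>b\<close> need not send \<open>p\<close> to 0; swapping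
    \<open>b p\<close> and 0 repairs this.\<close>
  then have "bij_betw (transpose (b p) 0) {..<card T} {..<card T}"
    by (intro permutes_imp_bij permutes_swap_id)
  with b have "bij_betw (transpose (b p) 0 \<circ> b) T {..<card T}"
    unfolding atLeast0LessThan by (rule bij_betw_trans)
  from relabel(2)[OF this assms(2)] show ?thesis by simp
qed

lemma finite_permutes_closed: "finite T \<Longrightarrow> x permutes T \<Longrightarrow> S \<subseteq> T \<Longrightarrow> x ` S \<subseteq> S \<Longrightarrow> x ` (T - S) \<subseteq> T - S"
  by (meson finite_subset permutes_image_Diff)

text \<open>An action on \<open>T\<close> is determined by the orbit \<open>A\<close> of \<open>p\<close> and its restrictions to \<open>A\<close> and \<open>T - A\<close>.\<close>

lemma card_acts_orbit:
  assumes T: "finite T" and p: "p \<in> T"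
  shows "card (acts Q T) = (\<Sum>A | A \<subseteq> T \<and> p \<in> A. card (conn_acts Q p A) * card (acts Q (T - A)))"
proof -
  define X where "X = (SIGMA A:{A. A \<subseteq> T \<and> p \<in> A}. conn_acts Q p A \<times> acts Q (T - A))"
  define glue where "glue = (\<lambda>(A :: nat set, (x1 :: nat \<Rightarrow> nat, y1 :: nat \<Rightarrow> nat), (x2 :: nat \<Rightarrow> nat, y2 :: nat \<Rightarrow> nat)). (x1 \<circ> x2, y1 \<circ> y2))"
  \<comment> \<open>The orbit of \<open>p\<close>, as the intersection of all closed sets around it.
    It recovers the set \<open>A\<close> that \<open>glue\<close> forgets.\<close>
  define orb where "orb = (\<lambda>(x :: nat \<Rightarrow> nat, y). \<Inter>{S. S \<subseteq> T \<and> p \<in> S \<and> closed_under x y S})"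
  define cut where "cut = (\<lambda>z. let A = orb z in
    (A, (rst (fst z) A, rst (snd z) A), (rst (fst z) (T - A), rst (snd z) (T - A))))"
  have glue: "glue u \<in> acts Q T \<and> cut (glue u) = u" if "u \<in> X" for u
  proof -
    obtain A x1 y1 x2 y2 where u: "u = (A, (x1, y1), (x2, y2))" by (metis prod.collapse)
    have A: "A \<subseteq> T" "p \<in> A" and 1: "(x1, y1) \<in> acts Q A" "connected_from p A x1 y1"
      and 2: "(x2, y2) \<in> acts Q (T - A)"
      using that by (auto simp: X_def u conn_acts_def)
    note perm = 1(1)[unfolded acts_def, simplified] 2[unfolded acts_def, simplified]
    have disj: "A \<inter> (T - A) = {}" by blast
    have perm12: "x1 \<circ> x2 permutes T" "y1 \<circ> y2 permutes T"
      using perm A by (auto intro!: permutes_compose intro: permutes_subset)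
    note cx = comp_on_left[of x1 A x2 "T - A", OF _ _ disj]
      and cy = comp_on_left[of y1 A y2 "T - A", OF _ _ disj]
    have clA: "closed_under x1 y1 A" "closed_under x2 y2 (T - A)"
      using perm by (simp_all add: closed_under_def permutes_image)
    have "Q (x1 \<circ> x2) (y1 \<circ> y2) t" if "t \<in> T" for t
    proof (cases "t \<in> A")
      case True
      then show ?thesis using agree[OF clA(1), of "x1 \<circ> x2" "y1 \<circ> y2" t] cx cy perm by simp
    next
      case False
      then show ?thesis using that agree[OF clA(2), of "x1 \<circ> x2" "y1 \<circ> y2" t] cx cy perm by simp
    qed
    with perm12 have act: "glue u \<in> acts Q T" by (simp add: u glue_def acts_def)
    have cl: "closed_under (x1 \<circ> x2) (y1 \<circ> y2) S \<longleftrightarrow> closed_under x1 y1 S" if "S \<subseteq> A" for S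
      using that cx(1) cy(1) perm by (force simp: closed_under_def image_subset_iff)
    have "orb (x1 \<circ> x2, y1 \<circ> y2) = A"
    proof
      show "orb (x1 \<circ> x2, y1 \<circ> y2) \<subseteq> A"
        unfolding orb_def using A clA(1) cl[of A] by auto
      have "A \<subseteq> S" if S: "S \<subseteq> T" "p \<in> S" "closed_under (x1 \<circ> x2) (y1 \<circ> y2) S" for S
      proof -
        \<comment> \<open>A closed set around \<open>p\<close> meets \<open>A\<close> in a set
          closed under the left factors, and connectedness makes this all of
          \<open>A\<close>.\<close>
        have "closed_under (x1 \<circ> x2) (y1 \<circ> y2) (S \<inter> A)"
          using S clA(1) cl[of A] by (auto simp: closed_under_def)
        then have "closed_under x1 y1 (S \<inter> A)" using cl[of "S \<inter> A"] by blast
        with 1(2) A S have "S \<inter> A = A" unfolding connected_from_def by (meson IntI inf_le2)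
        then show ?thesis by blast
      qed
      then show "A \<subseteq> orb (x1 \<circ> x2, y1 \<circ> y2)" unfolding orb_def by auto
    qed
    then have "cut (glue u) = u"
      using cx(3,4) cy(3,4) perm by (simp add: cut_def glue_def u)
    with act show ?thesis ..
  qed
  have cut: "cut z \<in> X \<and> glue (cut z) = z" if "z \<in> acts Q T" for z
  proof -
    obtain x y where z: "z = (x, y)" by fastforce
    define A where "A = orb z"
    have xy: "x permutes T" "y permutes T" "\<And>t. t \<in> T \<Longrightarrow> Q x y t"
      using that by (auto simp: z acts_def)
    have T_cl: "closed_under x y T" using xy by (simp add: closed_under_def permutes_image)
    have A: "A \<subseteq> T" "p \<in> A" "closed_under x y A"
      using T_cl p unfolding A_def orb_def z closed_under_def by blast+
    have fA: "finite A" "finite (T - A)" using A T by (auto intro: finite_subset)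
    have clx: "x ` A \<subseteq> A" "y ` A \<subseteq> A" using A by (auto simp: closed_under_def)
    note clx' = finite_permutes_closed[OF T xy(1) A(1) clx(1)] finite_permutes_closed[OF T xy(2) A(1) clx(2)]
    have TA: "closed_under x y (T - A)" using clx' by (simp add: closed_under_def)
    have Q1: "Q (rst x A) (rst y A) t" if "t \<in> A" for t
      using agree[OF A(3), of "rst x A" "rst y A" t] that xy(3) A(1) by (auto simp: rst_def)
    have Q2: "Q (rst x (T - A)) (rst y (T - A)) t" if "t \<in> T - A" for t
      using agree[OF TA, of "rst x (T - A)" "rst y (T - A)" t] that xy(3) by (auto simp: rst_def)
    have "connected_from p A (rst x A) (rst y A)"
      unfolding connected_from_def
    proof (intro allI impI)
      fix S assume S: "S \<subseteq> A" "p \<in> S" "closed_under (rst x A) (rst y A) S"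
      have "closed_under x y S" using S by (force simp: closed_under_def rst_def)
      with S A have "A \<subseteq> S" unfolding A_def z orb_def by auto
      with S show "S = A" by blast
    qed
    with Q1 Q2 have "cut z \<in> X"
      using A rst_permutes[OF xy(1) fA(1) clx(1)] rst_permutes[OF xy(2) fA(1) clx(2)]
        rst_permutes[OF xy(1) fA(2) clx'(1)] rst_permutes[OF xy(2) fA(2) clx'(2)]
      unfolding cut_def Let_def A_def[symmetric] X_def
      by (simp add: z conn_acts_def acts_def)
    moreover have "glue (cut z) = z"
      unfolding cut_def Let_def A_def[symmetric] glue_def
      using rst_comp_rst[OF xy(1) fA(1) clx(1) A(1)] rst_comp_rst[OF xy(2) fA(1) clx(2) A(1)]
      by (simp add: z)
    ultimately show ?thesis ..
  qed
  have "bij_betw cut (acts Q T) X"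
    by (rule bij_betw_byWitness[of _ glue]) (use glue cut in auto)
  then have "card (acts Q T) = card X" by (rule bij_betw_same_card)
  also have "\<dots> = (\<Sum>A | A \<subseteq> T \<and> p \<in> A. card (conn_acts Q p A \<times> acts Q (T - A)))"
    unfolding X_def using T by (intro card_SigmaI) (auto intro!: finite_cartesian_product finite_acts finite_conn_acts intro: finite_subset)
  finally show ?thesis by (simp add: card_cartesian_product)
qed

end

lemma sum_subsets_containing:
  assumes T: "finite T" and p: "p \<in> T"
  shows "(\<Sum>A | A \<subseteq> T \<and> p \<in> A. f (card A)) = (\<Sum>k = 1..card T. (card T - 1 choose (k - 1)) * f k)"
    (is "_ = (\<Sum>k \<in> ?K. _)")
proof -
  have fin: "finite {A. A \<subseteq> T \<and> p \<in> A}" using T by simp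
  have img: "card ` {A. A \<subseteq> T \<and> p \<in> A} \<subseteq> ?K"
    using T by (auto intro!: card_mono simp: Suc_le_eq card_gt_0_iff dest: finite_subset[OF _ T])
  have "(\<Sum>A | A \<subseteq> T \<and> p \<in> A. f (card A))
      = (\<Sum>k\<in>?K. \<Sum>A\<in>{A \<in> {A. A \<subseteq> T \<and> p \<in> A}. card A = k}. f (card A))"
    by (rule sum.group[OF fin _ img, symmetric]) simp
  also have "\<dots> = (\<Sum>k\<in>?K. (card T - 1 choose (k - 1)) * f k)"
  proof (rule sum.cong[OF refl])
    fix k assume k: "k \<in> ?K"
    have "bij_betw (insert p) {B. B \<subseteq> T - {p} \<and> card B = k - 1} {A \<in> {A. A \<subseteq> T \<and> p \<in> A}. card A = k}"
    proof (rule bij_betw_byWitness[of _ "\<lambda>A. A - {p}"], goal_cases)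
      case 3
      have "card (insert p B) = k" if "B \<subseteq> T - {p}" "card B = k - 1" for B
        using that T k by (subst card_insert_disjoint) (auto intro: finite_subset)
      with p show ?case by auto
    next
      case 4
      show ?case using T by (auto simp: card_Diff_singleton finite_subset)
    qed auto
    then have "card {A \<in> {A. A \<subseteq> T \<and> p \<in> A}. card A = k} = card T - 1 choose (k - 1)"
      using n_subsets[of "T - {p}" "k - 1"] T p by (simp add: bij_betw_same_card)
    then show "(\<Sum>A\<in>{A \<in> {A. A \<subseteq> T \<and> p \<in> A}. card A = k}. f (card A)) = (card T - 1 choose (k - 1)) * f k"
      by simp
  qed
  finally show ?thesis .
qed

context local_property
begin

text \<open>The exponential formula in coefficients: if \<open>H\<close> and \<open>C\<close> are
  the exponential generating functions of all actions and of the transitive ones, this is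
  \<open>H' = C' * H\<close>.\<close>

theorem acts_recurrence:
  assumes "n \<ge> 1"
  shows "card (acts Q {..<n}) =
    (\<Sum>k = 1..n. (n - 1 choose (k - 1)) * (card (conn_acts Q 0 {..<k}) * card (acts Q {..<n - k})))"
proof -
  have "card (acts Q {..<n}) = (\<Sum>A | A \<subseteq> {..<n} \<and> 0 \<in> A. card (conn_acts Q 0 A) * card (acts Q ({..<n} - A)))"
    using assms by (intro card_acts_orbit) auto
  also have "\<dots> = (\<Sum>A | A \<subseteq> {..<n} \<and> 0 \<in> A. card (conn_acts Q 0 {..<card A}) * card (acts Q {..<n - card A}))"
  proof (rule sum.cong[OF refl])
    fix A assume A: "A \<in> {A. A \<subseteq> {..<n} \<and> 0 \<in> A}"
    then have "finite A" by (auto intro: finite_subset)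
    with A show "card (conn_acts Q 0 A) * card (acts Q ({..<n} - A)) =
        card (conn_acts Q 0 {..<card A}) * card (acts Q {..<n - card A})"
      using card_conn_acts_eq[of A 0] card_acts_eq[of "{..<n} - A"] by (simp add: card_Diff_subset)
  qed
  also have "\<dots> = (\<Sum>k = 1..n. (n - 1 choose (k - 1)) * (card (conn_acts Q 0 {..<k}) * card (acts Q {..<n - k})))"
    using sum_subsets_containing[of "{..<n}" 0 "\<lambda>k. card (conn_acts Q 0 {..<k}) * card (acts Q {..<n - k})"] assms
    by (simp add: lessThan_empty_iff)
  finally show ?thesis .
qed

end

subsection \<open>Subgroups as point stabilisers\<close>

text \<open>
  In a transitive action the central element \<open>x^2 = y^3\<close> acts either trivially or without fixed
  points, according to \<open>e\<close>.
\<close>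

definition gamma_rel :: "bool \<Rightarrow> (nat \<Rightarrow> nat) \<Rightarrow> (nat \<Rightarrow> nat) \<Rightarrow> nat \<Rightarrow> bool" where
  "gamma_rel e x y t \<longleftrightarrow> x (x t) = y (y (y t)) \<and> (y ^^ 9) t = t \<and> (y (y (y t)) = t) = e"

text \<open>The relation \<open>x^6 = 1\<close> is implied:
  \<open>x^6 = (x^2)^3 = (y^3)^3 = y^9\<close>.\<close>

definition gamma_act :: "('a \<Rightarrow> 'a) \<Rightarrow> ('a \<Rightarrow> 'a) \<Rightarrow> bool" where
  "gamma_act x y \<longleftrightarrow> bij x \<and> bij y \<and> (\<forall>t. x (x t) = y (y (y t))) \<and> (\<forall>t. (y ^^ 9) t = t)"

definition run_letter :: "('a \<Rightarrow> 'a) \<Rightarrow> ('a \<Rightarrow> 'a) \<Rightarrow> gen \<times> bool \<Rightarrow> 'a \<Rightarrow> 'a" where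
  "run_letter x y l = (let f = (case fst l of Gen_x \<Rightarrow> x | Gen_y \<Rightarrow> y) in if snd l then f else inv_into UNIV f)"

text \<open>Words act from the right: the leftmost letter is applied first, as for right cosets.\<close>

definition run :: "('a \<Rightarrow> 'a) \<Rightarrow> ('a \<Rightarrow> 'a) \<Rightarrow> gen word \<Rightarrow> 'a \<Rightarrow> 'a" where
  "run x y w = fold (run_letter x y) w"

lemma run_append [simp]: "run x y (u @ v) t = run x y v (run x y u t)"
  by (simp add: run_def)

lemma run_Nil [simp]: "run x y [] t = t"
  by (simp add: run_def)

lemma run_Cons: "run x y (l # w) t = run x y w (run_letter x y l t)"
  by (simp add: run_def)

lemma run_single [simp]: "run x y [l] t = run_letter x y l t"
  by (simp add: run_def)

lemma run_letter_simps [simp]: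
  "run_letter x y (Gen_x, True) = x" "run_letter x y (Gen_y, True) = y"
  "run_letter x y (Gen_x, False) = inv_into UNIV x" "run_letter x y (Gen_y, False) = inv_into UNIV y"
  by (auto simp: run_letter_def)

lemma run_gen_pow [simp]:
  "run x y (gen_pow Gen_x k) t = (x ^^ k) t" "run x y (gen_pow Gen_y k) t = (y ^^ k) t"
  by (induction k arbitrary: t) (auto simp: run_Cons funpow_swap1)

lemma run_cancel:
  assumes "bij x" "bij y" shows "run_letter x y (g, \<not> e) (run_letter x y (g, e) t) = t"
  using assms by (cases g; cases e) (simp_all add: bij_is_inj bij_is_surj surj_f_inv_f)

section \<open>The presented group and its action by words\<close>

abbreviation gamma_rels :: "(gen word \<times> gen word) set" where
  "gamma_rels \<equiv> {(gen_pow Gen_x 6, []), (gen_pow Gen_y 9, []), (gen_pow Gen_x 2, gen_pow Gen_y 3)}"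

abbreviation cls :: "gen word \<Rightarrow> gen word set" where
  "cls w \<equiv> pres_cong gamma_rels `` {w}"

lemma cls_eq_iff: "cls u = cls v \<longleftrightarrow> pres_eq gamma_rels u v"
proof -
  have "cls u = cls v \<longleftrightarrow> (u, v) \<in> pres_cong gamma_rels"
    by (rule eq_equiv_class_iff[OF equiv_pres_cong]) auto
  then show ?thesis by (simp add: pres_cong_def)
qed

lemma run_pres_eq:
  assumes "pres_eq gamma_rels u v" "gamma_act x y" shows "run x y u t = run x y v t"
  using assms(1)
proof (induction arbitrary: t rule: pres_eq.induct)
  case (pres_rel u v a b)
  have xx: "x (x t) = y (y (y t))" and y9: "(y ^^ 9) t = t" for t
    using assms(2) by (auto simp: gamma_act_def)
  have x2: "x ^^ 2 = y ^^ 3" by (simp add: eval_nat_numeral xx fun_eq_iff)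
  have "(x ^^ 6) t = t" for t
  proof -
    have "x ^^ 6 = (x ^^ 2) ^^ 3" by (simp add: funpow_mult)
    also have "\<dots> = y ^^ 9" by (simp add: x2 funpow_mult)
    finally show ?thesis using y9 by simp
  qed
  then show ?case using pres_rel y9 x2 by auto
next
  case (pres_cancel a g e b)
  then show ?case using assms(2) by (simp add: run_Cons run_cancel gamma_act_def)
qed simp_all

lemma pres_eq_word_inv_right: "pres_eq R (w @ word_inv w) []"
proof -
  have "word_inv (word_inv w) = w"
    by (simp add: word_inv_def rev_map comp_def case_prod_unfold)
  then show ?thesis using pres_eq_word_inv[of R "word_inv w"] by simp
qed

lemma run_word_inv:
  assumes "gamma_act x y"
  shows "run x y w (run x y (word_inv w) t) = t" "run x y (word_inv w) (run x y w t) = t"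
  using run_pres_eq[OF pres_eq_word_inv assms] run_pres_eq[OF pres_eq_word_inv_right assms] by simp_all

lemma carrier_Gamma33: "carrier Gamma33 = range cls"
  by (auto simp: Gamma33_def presented_group_def quotient_def)

lemma one_Gamma33: "\<one>\<^bsub>Gamma33\<^esub> = cls []"
  by (simp add: Gamma33_def presented_group_def)

lemma mult_Gamma33: "cls u \<otimes>\<^bsub>Gamma33\<^esub> cls v = cls (u @ v)"
  by (simp add: Gamma33_def presented_group_mult)

lemma group_Gamma33: "group Gamma33"
  by (simp add: Gamma33_def group_presented_group)

lemma inv_Gamma33: "m_inv Gamma33 (cls w) = cls (word_inv w)"
  by (rule group.inv_equality[OF group_Gamma33])
     (auto simp: mult_Gamma33 one_Gamma33 cls_eq_iff pres_eq_word_inv carrier_Gamma33)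

definition stab :: "(nat \<Rightarrow> nat) \<times> (nat \<Rightarrow> nat) \<Rightarrow> gen word set set" where
  "stab z = cls ` {w. run (fst z) (snd z) w 0 = 0}"

lemma cls_in_stab:
  assumes "gamma_act x y" shows "cls w \<in> stab (x, y) \<longleftrightarrow> run x y w 0 = 0"
  using run_pres_eq[OF _ assms] by (force simp: stab_def cls_eq_iff)

lemma stab_eq_iff:
  assumes "gamma_act x y" "gamma_act x' y'"
  shows "stab (x, y) = stab (x', y') \<longleftrightarrow> (\<forall>w. run x y w 0 = 0 \<longleftrightarrow> run x' y' w 0 = 0)"
proof
  show "\<forall>w. run x y w 0 = 0 \<longleftrightarrow> run x' y' w 0 = 0" if "stab (x, y) = stab (x', y')"
    unfolding cls_in_stab[OF assms(1), symmetric] cls_in_stab[OF assms(2), symmetric] that by simp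
qed (simp add: stab_def)

lemma subgroup_stab:
  assumes "gamma_act x y" shows "subgroup (stab (x, y)) Gamma33"
proof (rule group.subgroupI[OF group_Gamma33])
  show "stab (x, y) \<subseteq> carrier Gamma33" by (auto simp: stab_def carrier_Gamma33)
  show "stab (x, y) \<noteq> {}" using cls_in_stab[OF assms, of "[]"] by auto
  fix a assume a: "a \<in> stab (x, y)"
  then obtain u where u: "a = cls u" "run x y u 0 = 0" by (auto simp: stab_def)
  then show "m_inv Gamma33 a \<in> stab (x, y)"
    using run_word_inv(2)[OF assms, of u 0] by (simp add: inv_Gamma33 cls_in_stab[OF assms])
  fix b assume "b \<in> stab (x, y)"
  then obtain v where v: "b = cls v" "run x y v 0 = 0" by (auto simp: stab_def)
  show "a \<otimes>\<^bsub>Gamma33\<^esub> b \<in> stab (x, y)"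
    using u v by (simp add: mult_Gamma33 cls_in_stab[OF assms])
qed

lemma inv_into_permutes_closed:
  assumes "f permutes T" "finite S" "f ` S \<subseteq> S" "t \<in> S" shows "inv_into UNIV f t \<in> S"
proof -
  have "inj f" using assms(1) by (rule permutes_inj)
  then have "f ` S = S" using assms(2,3) by (meson endo_inj_surj inj_on_subset subset_UNIV)
  then obtain s where "s \<in> S" "t = f s" using assms(4) by blast
  then show ?thesis using \<open>inj f\<close> by simp
qed

lemma run_closed:
  assumes "x permutes T" "y permutes T" "finite S" "closed_under x y S" "t \<in> S"
  shows "run x y w t \<in> S"
  using assms(5)
proof (induction w arbitrary: t)
  case (Cons l w)
  have "run_letter x y l t \<in> S"
    using assms(4) Cons.prems inv_into_permutes_closed[OF assms(1,3) _ Cons.prems]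
      inv_into_permutes_closed[OF assms(2,3) _ Cons.prems]
    by (cases l; cases "fst l"; cases "snd l") (auto simp: closed_under_def)
  then show ?case using Cons.IH by (simp add: run_Cons)
qed simp

text \<open>The points reached from 0 by words form the smallest closed set around 0; inverse
  letters do not lead out of a finite closed set by \<open>run_closed\<close>.\<close>

lemma connected_from_run:
  fixes n :: nat
  assumes "x permutes {..<n}" "y permutes {..<n}" "n \<ge> 1"
  shows "connected_from 0 {..<n} x y \<longleftrightarrow> (\<forall>t<n. \<exists>w. run x y w 0 = t)"
proof
  assume c: "connected_from 0 {..<n} x y"
  have cl: "closed_under x y {..<n}" using assms by (simp add: closed_under_def permutes_image)
  have "range (\<lambda>w. run x y w 0) \<subseteq> {..<n}"
    using run_closed[OF assms(1,2) finite_lessThan cl] assms(3) by auto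
  moreover have "0 \<in> range (\<lambda>w. run x y w 0)" using run_Nil[of x y 0] by (metis rangeI)
  moreover have "closed_under x y (range (\<lambda>w. run x y w 0))"
  proof -
    have "x (run x y w 0) = run x y (w @ [(Gen_x, True)]) 0" "y (run x y w 0) = run x y (w @ [(Gen_y, True)]) 0" for w
      by simp_all
    then show ?thesis unfolding closed_under_def by (auto simp del: run_append)
  qed
  ultimately have "range (\<lambda>w. run x y w 0) = {..<n}" using c unfolding connected_from_def by blast
  then show "\<forall>t<n. \<exists>w. run x y w 0 = t" by (auto simp: set_eq_iff image_iff) metis
next
  assume w: "\<forall>t<n. \<exists>w. run x y w 0 = t"
  show "connected_from 0 {..<n} x y"
    unfolding connected_from_def
  proof (intro allI impI)
    fix S assume S: "S \<subseteq> {..<n}" "0 \<in> S" "closed_under x y S"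
    then have "run x y w 0 \<in> S" for w
      using assms by (intro run_closed) (auto intro: finite_subset)
    with w S(1) show "S = {..<n}" by fastforce
  qed
qed

section \<open>Transitive actions and right cosets\<close>

definition trans_acts :: "nat \<Rightarrow> ((nat \<Rightarrow> nat) \<times> (nat \<Rightarrow> nat)) set" where
  "trans_acts n = {(x, y). x permutes {..<n} \<and> y permutes {..<n} \<and> gamma_act x y \<and> connected_from 0 {..<n} x y}"

text \<open>Orbit and stabiliser: the right coset of \<open>w\<close> consists of the elements that
  move 0 to the same point as \<open>w\<close> does. \<open>C t\<close> is the coset that belongs to
  the point \<open>t\<close>.\<close>

lemma card_rcosets_stab:
  assumes "(x, y) \<in> trans_acts n" "n \<ge> 1"
  shows "card (rcosets\<^bsub>Gamma33\<^esub> (stab (x, y))) = n"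
proof -
  define C where "C = (\<lambda>t. cls ` {v. run x y v 0 = t})"
  have act: "gamma_act x y" and perm: "x permutes {..<n}" "y permutes {..<n}"
    and w: "\<forall>t<n. \<exists>w. run x y w 0 = t"
    using assms connected_from_run[of x n y] by (auto simp: trans_acts_def)
  have "stab (x, y) #>\<^bsub>Gamma33\<^esub> cls w = C (run x y w 0)" for w
  proof (intro subset_antisym subsetI)
    fix a assume "a \<in> stab (x, y) #>\<^bsub>Gamma33\<^esub> cls w"
    then obtain v where "run x y v 0 = 0" "a = cls (v @ w)"
      by (auto simp: r_coset_def stab_def mult_Gamma33)
    then show "a \<in> C (run x y w 0)" by (auto simp: C_def)
  next
    fix a assume "a \<in> C (run x y w 0)"
    then obtain v where v: "run x y v 0 = run x y w 0" "a = cls v" by (auto simp: C_def)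
    have "run x y (v @ word_inv w) 0 = 0" using v run_word_inv[OF act] by simp
    then have "cls (v @ word_inv w) \<in> stab (x, y)" using cls_in_stab[OF act] by blast
    moreover have "cls v = cls (v @ word_inv w) \<otimes>\<^bsub>Gamma33\<^esub> cls w"
      using pres_eq_append[OF pres_refl pres_eq_word_inv, of gamma_rels v w]
      by (simp add: mult_Gamma33 cls_eq_iff pres_sym)
    ultimately show "a \<in> stab (x, y) #>\<^bsub>Gamma33\<^esub> cls w" unfolding r_coset_def v by blast
  qed
  then have "rcosets\<^bsub>Gamma33\<^esub> (stab (x, y)) = C ` range (\<lambda>w. run x y w 0)"
    by (auto simp: RCOSETS_def carrier_Gamma33)
  moreover have "range (\<lambda>w. run x y w 0) = {..<n}"
  proof -
    have "run x y w 0 \<in> {..<n}" for w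
      by (rule run_closed[OF perm]) (use perm assms in \<open>auto simp: closed_under_def permutes_image\<close>)
    with w show ?thesis by fastforce
  qed
  moreover have "inj_on C {..<n}"
  proof (rule inj_onI)
    fix s t assume "s \<in> {..<n}" "t \<in> {..<n}" and eq: "C s = C t"
    then obtain u where u: "run x y u 0 = s" using w by auto
    then have "cls u \<in> C t" using eq by (auto simp: C_def)
    then obtain v where "run x y v 0 = t" "cls u = cls v" by (auto simp: C_def)
    then show "s = t" using u run_pres_eq[OF _ act, of u v 0] by (simp add: cls_eq_iff)
  qed
  ultimately show ?thesis by (simp add: card_image)
qed

text \<open>Right multiplication permutes the right cosets of \<open>H\<close>, and \<open>H\<close>
  is the stabiliser of the coset \<open>H\<close> itself. Numbering the cosets so that
  \<open>H\<close> becomes 0 turns this into an action on \<open>{..<n}\<close>.\<close>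

lemma ex_trans_act:
  assumes H: "subgroup H Gamma33" and n: "card (rcosets\<^bsub>Gamma33\<^esub> H) = n" "n \<ge> 1"
  shows "\<exists>z\<in>trans_acts n. stab z = H"
proof -
  interpret G: group Gamma33 by (rule group_Gamma33)
  define RC where "RC = rcosets\<^bsub>Gamma33\<^esub> H"
  \<comment> \<open>An infinite set has \<open>card\<close> 0, so \<open>n \<ge> 1\<close> leaves
    only finitely many cosets.\<close>
  have fin: "finite RC" using n by (metis RC_def card.infinite not_one_le_zero)
  have Hsub: "H \<subseteq> carrier Gamma33" using H by (rule subgroup.subset)
  have cls: "cls w \<in> carrier Gamma33" for w by (auto simp: carrier_Gamma33)
  have HRC: "H \<in> RC" using G.rcosetsI[OF Hsub G.one_closed] G.coset_mult_one[OF Hsub] by (simp add: RC_def)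
  obtain b where b0: "bij_betw b RC {..<n}"
    using ex_bij_betw_finite_nat[OF fin] n by (auto simp: RC_def atLeast0LessThan)
  define \<beta> where "\<beta> = transpose (b H) 0 \<circ> b"
  have "b H < n" using HRC b0 by (auto dest: bij_betwE)
  then have "transpose (b H) 0 permutes {..<n}" using n by (intro permutes_swap_id) auto
  then have \<beta>: "bij_betw \<beta> RC {..<n}"
    unfolding \<beta>_def using b0 by (intro bij_betw_trans[OF b0] permutes_imp_bij)
  have \<beta>H: "\<beta> H = 0" by (simp add: \<beta>_def)
  \<comment> \<open>Right multiplication read through the numbering; points from \<open>n\<close> on
    are fixed, as \<open>permutes\<close> demands.\<close>
  define \<rho> where "\<rho> = (\<lambda>w t. if t < n then \<beta> (inv_into RC \<beta> t #>\<^bsub>Gamma33\<^esub> cls w) else t)"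
  have RCcar: "M \<subseteq> carrier Gamma33" if "M \<in> RC" for M
    using that G.rcosets_part_G[OF H] by (auto simp: RC_def)
  have RCmul: "M #>\<^bsub>Gamma33\<^esub> cls w \<in> RC" if "M \<in> RC" for M w
    using that Hsub cls by (auto simp: RC_def RCOSETS_def G.coset_mult_assoc)
  have inv: "inv_into RC \<beta> t \<in> RC" "\<beta> (inv_into RC \<beta> t) = t" if "t < n" for t
    using that \<beta> by (auto simp: bij_betw_inv_into_right bij_betw_def inv_into_into)
  have \<beta>inv: "inv_into RC \<beta> (\<beta> M) = M" if "M \<in> RC" for M
    using that \<beta> by (simp add: bij_betw_inv_into_left)
  have \<beta>lt: "\<beta> M < n" if "M \<in> RC" for M using that \<beta> by (auto dest: bij_betwE)
  have \<rho>_app: "\<rho> (u @ v) t = \<rho> v (\<rho> u t)" for u v t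
    using inv[of t] RCmul[of "inv_into RC \<beta> t" u] RCcar[of "inv_into RC \<beta> t"]
    by (auto simp: \<rho>_def \<beta>lt \<beta>inv G.coset_mult_assoc cls mult_Gamma33)
  have \<rho>_Nil: "\<rho> [] t = t" for t
    using inv[of t] RCcar[of "inv_into RC \<beta> t"]
    by (auto simp: \<rho>_def one_Gamma33[symmetric])
  have \<rho>_cong: "\<rho> u t = \<rho> v t" if "pres_eq gamma_rels u v" for u v t
    using that cls_eq_iff[of u v] by (simp add: \<rho>_def)
  define x y where "x = \<rho> [(Gen_x, True)]" and "y = \<rho> [(Gen_y, True)]"
  have can: "\<rho> [(g, \<not> e)] (\<rho> [(g, e)] t) = t" for g e t
    using \<rho>_cong[OF pres_cancel[of gamma_rels "[]" g e "[]"]] \<rho>_app[of "[(g, e)]" "[(g, \<not> e)]"] \<rho>_Nil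
    by simp
  have \<rho>_perm: "\<rho> [(g, e)] permutes {..<n}" for g e
  proof (rule bij_imp_permutes)
    have lt: "\<rho> [(g, e)] t < n" if "t < n" for g e t
      using that inv[of t] by (simp add: \<rho>_def \<beta>lt RCmul)
    show "bij_betw (\<rho> [(g, e)]) {..<n} {..<n}"
      using can[of g e] can[of g "\<not> e"] lt
      by (intro bij_betw_byWitness[of _ "\<rho> [(g, \<not> e)]"]) auto
  qed (simp add: \<rho>_def)
  have letter: "run_letter x y l = \<rho> [l]" for l
  proof -
    have "inv_into UNIV (\<rho> [(g, True)]) = \<rho> [(g, False)]" for g
      using can[of g True] can[of g False] by (intro inv_equality) auto
    then show ?thesis by (cases l; cases "fst l"; cases "snd l") (auto simp: x_def y_def)
  qed
  have run: "run x y w t = \<rho> w t" for w t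
  proof (induction w arbitrary: t)
    case (Cons l w)
    then show ?case using \<rho>_app[of "[l]" w t] by (simp add: run_Cons letter)
  qed (simp add: \<rho>_Nil)
  have rel: "pres_eq gamma_rels u v" if "(u, v) \<in> gamma_rels" for u v
    using pres_rel[OF that, of "[]" "[]"] by simp
  have act: "gamma_act x y"
    unfolding gamma_act_def
  proof (intro conjI allI)
    show "bij x" "bij y" using \<rho>_perm unfolding x_def y_def by (auto intro: permutes_bij)
    fix t
    have "run x y (gen_pow Gen_x 2) t = run x y (gen_pow Gen_y 3) t"
      unfolding run by (intro \<rho>_cong rel) simp
    then show "x (x t) = y (y (y t))" unfolding run_gen_pow by (simp add: eval_nat_numeral)
    have "run x y (gen_pow Gen_y 9) t = run x y [] t"
      unfolding run by (intro \<rho>_cong rel) simp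
    then show "(y ^^ 9) t = t" unfolding run_gen_pow by simp
  qed
  have run0: "run x y w 0 = \<beta> (H #>\<^bsub>Gamma33\<^esub> cls w)" for w
    using n \<beta>H \<beta>inv[OF HRC] by (simp add: run \<rho>_def)
  have "\<exists>w. run x y w 0 = t" if t: "t < n" for t
  proof -
    obtain g where "g \<in> carrier Gamma33" "inv_into RC \<beta> t = H #>\<^bsub>Gamma33\<^esub> g"
      using inv(1)[OF t] by (auto simp: RC_def RCOSETS_def)
    then show ?thesis using inv(2)[OF t] run0 by (auto simp: carrier_Gamma33)
  qed
  then have "(x, y) \<in> trans_acts n"
    using act \<rho>_perm connected_from_run[of x n y] n by (simp add: trans_acts_def x_def y_def)
  moreover have "stab (x, y) = H"
  proof -
    have "run x y w 0 = 0 \<longleftrightarrow> cls w \<in> H" for w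
    proof -
      have "run x y w 0 = 0 \<longleftrightarrow> H #>\<^bsub>Gamma33\<^esub> cls w = H"
        using \<beta>H \<beta>inv[OF RCmul[OF HRC, of w]] \<beta>inv[OF HRC] by (metis run0)
      also have "\<dots> \<longleftrightarrow> cls w \<in> H"
        using G.coset_join1[OF _ cls H] G.coset_join2[OF cls H] Hsub by blast
      finally show ?thesis .
    qed
    then show ?thesis using Hsub by (auto simp: stab_def carrier_Gamma33)
  qed
  ultimately show ?thesis by blast
qed

section \<open>Relabellings that fix the base point\<close>

definition conj_pair :: "('a \<Rightarrow> 'a) \<Rightarrow> ('a \<Rightarrow> 'a) \<times> ('a \<Rightarrow> 'a) \<Rightarrow> ('a \<Rightarrow> 'a) \<times> ('a \<Rightarrow> 'a)" where
  "conj_pair p z = (p \<circ> fst z \<circ> inv_into UNIV p, p \<circ> snd z \<circ> inv_into UNIV p)"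

lemma run_conj:
  assumes "bij p" "bij x" "bij y"
  shows "run (p \<circ> x \<circ> inv_into UNIV p) (p \<circ> y \<circ> inv_into UNIV p) w (p t) = p (run x y w t)"
proof (induction w arbitrary: t)
  case (Cons l w)
  have "inv_into UNIV (p \<circ> f \<circ> inv_into UNIV p) = p \<circ> inv_into UNIV f \<circ> inv_into UNIV p"
    if "bij f" for f :: "'a \<Rightarrow> 'a"
    using that assms(1) by (intro inv_equality) (simp_all add: bij_is_inj bij_is_surj surj_f_inv_f)
  then have "run_letter (p \<circ> x \<circ> inv_into UNIV p) (p \<circ> y \<circ> inv_into UNIV p) l (p t) = p (run_letter x y l t)"
    using assms by (cases l; cases "fst l"; cases "snd l") (auto simp: bij_is_inj)
  then show ?case by (simp only: run_Cons Cons.IH)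
qed simp

lemma gamma_act_conj:
  fixes p :: "'a \<Rightarrow> 'a"
  assumes "bij p" "gamma_act x y"
  shows "gamma_act (p \<circ> x \<circ> inv_into UNIV p) (p \<circ> y \<circ> inv_into UNIV p)"
proof -
  have inv: "inv_into UNIV p (p t) = t" "p (inv_into UNIV p t) = t" for t
    using assms(1) by (simp_all add: bij_is_inj bij_is_surj surj_f_inv_f)
  have pow: "((p \<circ> y \<circ> inv_into UNIV p) ^^ k) t = p ((y ^^ k) (inv_into UNIV p t))" for k t
    by (induction k) (simp_all add: inv)
  show ?thesis
    using assms unfolding gamma_act_def pow by (auto simp: inv intro!: bij_comp bij_imp_bij_inv)
qed

lemma conj_trans_act:
  assumes z: "z \<in> trans_acts n" and p: "p permutes {1..<n}" and n: "n \<ge> 1"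
  shows "conj_pair p z \<in> trans_acts n" "stab (conj_pair p z) = stab z"
proof -
  obtain x y where xy: "z = (x, y)" by fastforce
  have act: "gamma_act x y" and perm: "x permutes {..<n}" "y permutes {..<n}" and bij: "bij x" "bij y"
    and w: "\<forall>t<n. \<exists>w. run x y w 0 = t"
    using z connected_from_run[of x n y] n by (auto simp: trans_acts_def xy gamma_act_def)
  have pn: "p permutes {..<n}" using p by (rule permutes_subset) auto
  have bp: "bij p" using p by (rule permutes_bij)
  \<comment> \<open>Permutations of \<open>{1..<n}\<close> fix the base point; this is why
    conjugation by them preserves the stabiliser of 0.\<close>
  have p0: "p 0 = 0" using permutes_not_in[OF p, of 0] by simp
  note run = run_conj[OF bp bij]
  have run0: "run (p \<circ> x \<circ> inv_into UNIV p) (p \<circ> y \<circ> inv_into UNIV p) w 0 = p (run x y w 0)" for w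
    using run[of w 0] by (simp add: p0)
  have act': "gamma_act (p \<circ> x \<circ> inv_into UNIV p) (p \<circ> y \<circ> inv_into UNIV p)"
    using bp act by (rule gamma_act_conj)
  have perm': "p \<circ> f \<circ> inv_into UNIV p permutes {..<n}" if "f permutes {..<n}" for f
    using that pn by (intro permutes_compose[OF permutes_inv[OF pn]] permutes_compose)
  have "\<exists>w. run (p \<circ> x \<circ> inv_into UNIV p) (p \<circ> y \<circ> inv_into UNIV p) w 0 = t" if "t < n" for t
  proof -
    have "inv_into UNIV p t < n" using permutes_in_image[OF permutes_inv[OF pn], of t] that by simp
    then obtain w where "run x y w 0 = inv_into UNIV p t" using w by blast
    then show ?thesis using run0[of w] bp by (auto simp: bij_is_surj surj_f_inv_f)
  qed
  then show "conj_pair p z \<in> trans_acts n"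
    using act' perm'[OF perm(1)] perm'[OF perm(2)] n
    by (simp add: xy conj_pair_def trans_acts_def connected_from_run)
  have "p s = 0 \<longleftrightarrow> s = 0" for s using bp p0 by (metis bij_pointE)
  then show "stab (conj_pair p z) = stab z"
    by (simp add: xy conj_pair_def stab_eq_iff[OF act' act] run0)
qed

text \<open>Two words \<open>u\<close>, \<open>v\<close> lead from 0 to the same point exactly if
  \<open>u\<close> followed by the inverse of \<open>v\<close> lies in the stabiliser. With equal
  stabilisers, sending the point reached by a word in one action to the point reached by it in the
  other is therefore well defined and injective, and it intertwines the generators.\<close>

lemma same_stab_imp_conj:
  assumes z: "z \<in> trans_acts n" "z' \<in> trans_acts n" and eq: "stab z' = stab z" and n: "n \<ge> 1"
  shows "\<exists>p. p permutes {1..<n} \<and> z' = conj_pair p z"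
proof -
  obtain x y where xy: "z = (x, y)" by fastforce
  obtain x' y' where xy': "z' = (x', y')" by fastforce
  have act: "gamma_act x y" "gamma_act x' y'"
    and perm: "x permutes {..<n}" "y permutes {..<n}" "x' permutes {..<n}" "y' permutes {..<n}"
    and w: "\<forall>t<n. \<exists>w. run x y w 0 = t" "\<forall>t<n. \<exists>w. run x' y' w 0 = t"
    using z connected_from_run[of x n y] connected_from_run[of x' n y'] n
    by (auto simp: trans_acts_def xy xy')
  have st: "run x y w 0 = 0 \<longleftrightarrow> run x' y' w 0 = 0" for w
    using eq stab_eq_iff[OF act] by (simp add: xy xy')
  have key: "run x y u 0 = run x y v 0 \<longleftrightarrow> run x' y' u 0 = run x' y' v 0" for u v
  proof -
    have *: "run x y u 0 = run x y v 0 \<longleftrightarrow> run x y (u @ word_inv v) 0 = 0" if "gamma_act x y" for x y :: "nat \<Rightarrow> nat"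
      using run_word_inv[OF that, of v] by (metis run_append)
    show ?thesis by (simp only: *[OF act(1)] *[OF act(2)] st)
  qed
  have lt: "run x y w 0 < n" "run x' y' w 0 < n" for w
    using run_closed[OF perm(1,2), of "{..<n}" 0 w] run_closed[OF perm(3,4), of "{..<n}" 0 w] perm n
    by (auto simp: closed_under_def permutes_image)
  define p where "p = (\<lambda>t. if t < n then run x' y' (SOME w. run x y w 0 = t) 0 else t)"
  have p_run: "p (run x y w 0) = run x' y' w 0" for w
  proof -
    have "run x y (SOME v. run x y v 0 = run x y w 0) 0 = run x y w 0"
      by (rule someI[of _ w]) simp
    then show ?thesis using key lt by (simp add: p_def)
  qed
  have inj: "inj_on p {..<n}"
  proof (rule inj_onI)
    fix s t assume "s \<in> {..<n}" "t \<in> {..<n}" "p s = p t"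
    moreover from this obtain u v where "run x y u 0 = s" "run x y v 0 = t" using w(1) by blast
    ultimately show "s = t" using p_run key by metis
  qed
  have "p ` {..<n} = {..<n}"
  proof (intro endo_inj_surj inj finite_lessThan)
    show "p ` {..<n} \<subseteq> {..<n}" using w(1) lt(2) p_run by (metis image_subsetI lessThan_iff)
  qed
  then have pn: "p permutes {..<n}"
    using inj by (intro bij_imp_permutes) (auto simp: bij_betw_def p_def)
  have p0: "p 0 = 0" using p_run[of "[]"] by simp
  have p: "p permutes {1..<n}" using permutes_superset[OF pn, of "{1..<n}"] p0
    by (metis DiffE One_nat_def Suc_leI atLeastLessThan_iff lessThan_iff not_gr_zero)
  have bp: "bij p" using p by (rule permutes_bij)
  have com: "p (x t) = x' (p t)" "p (y t) = y' (p t)" for t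
  proof -
    show "p (x t) = x' (p t)"
    proof (cases "t < n")
      case True
      then obtain w where t: "t = run x y w 0" using w(1) by blast
      have "p (run x y (w @ [(Gen_x, True)]) 0) = run x' y' (w @ [(Gen_x, True)]) 0" by (rule p_run)
      then show ?thesis by (simp add: t p_run)
    next
      case False
      then show ?thesis using permutes_not_in[OF pn] permutes_not_in[OF perm(1)] permutes_not_in[OF perm(3)] by simp
    qed
    show "p (y t) = y' (p t)"
    proof (cases "t < n")
      case True
      then obtain w where t: "t = run x y w 0" using w(1) by blast
      have "p (run x y (w @ [(Gen_y, True)]) 0) = run x' y' (w @ [(Gen_y, True)]) 0" by (rule p_run)
      then show ?thesis by (simp add: t p_run)
    next
      case False
      then show ?thesis using permutes_not_in[OF pn] permutes_not_in[OF perm(2)] permutes_not_in[OF perm(4)] by simp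
    qed
  qed
  have "z' = conj_pair p z"
    using bp by (simp add: xy xy' conj_pair_def fun_eq_iff com bij_is_surj surj_f_inv_f)
  with p show ?thesis by blast
qed

text \<open>The image of the point that \<open>w\<close> reaches is the point that \<open>w\<close>
  reaches in the conjugated action, so transitivity determines the relabelling.\<close>

lemma conj_pair_inj:
  assumes z: "z \<in> trans_acts n" and p: "p permutes {1..<n}" "q permutes {1..<n}" and n: "n \<ge> 1"
    and eq: "conj_pair p z = conj_pair q z"
  shows "p = q"
proof
  fix t
  obtain x y where xy: "z = (x, y)" by fastforce
  have act: "gamma_act x y" and bij: "bij x" "bij y" and w: "\<forall>t<n. \<exists>w. run x y w 0 = t"
    using z connected_from_run[of x n y] n by (auto simp: trans_acts_def xy gamma_act_def)
  have 0: "p 0 = 0" "q 0 = 0" using permutes_not_in[OF p(1), of 0] permutes_not_in[OF p(2), of 0] by auto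
  have bp: "bij p" "bij q" using p by (auto intro: permutes_bij)
  show "p t = q t"
  proof (cases "t < n")
    case True
    then obtain w where "t = run x y w 0" using w by blast
    then show ?thesis
      using run_conj[OF bp(1) bij, of w 0] run_conj[OF bp(2) bij, of w 0] eq
      by (simp add: 0 xy conj_pair_def)
  next
    case False
    then show ?thesis using permutes_not_in[OF p(1), of t] permutes_not_in[OF p(2), of t] by simp
  qed
qed

text \<open>The relabellings that fix 0 act freely (\<open>conj_pair_inj\<close>) and transitively
  (\<open>same_stab_imp_conj\<close>) on the actions with a given stabiliser.\<close>

lemma card_stab_fibre:
  assumes z: "z \<in> trans_acts n" and n: "n \<ge> 1"
  shows "card {z' \<in> trans_acts n. stab z' = stab z} = fact (n - 1)"
proof -
  have "{z' \<in> trans_acts n. stab z' = stab z} = (\<lambda>p. conj_pair p z) ` {p. p permutes {1..<n}}"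
    using conj_trans_act[OF z _ n] same_stab_imp_conj[OF z _ _ n] by (auto simp: image_iff)
  moreover have "inj_on (\<lambda>p. conj_pair p z) {p. p permutes {1..<n}}"
    using conj_pair_inj[OF z _ _ n] by (auto intro!: inj_onI)
  ultimately show ?thesis by (simp add: card_image card_permutations)
qed

section \<open>Splitting by the central element\<close>

interpretation gamma_rel: local_property "gamma_rel e" for e
proof
  fix b :: "nat \<Rightarrow> nat" and S x y x' y' t
  assume inj: "inj_on b S" and cl: "closed_under x y S" and x: "\<And>s. s \<in> S \<Longrightarrow> x' (b s) = b (x s)"
    and y: "\<And>s. s \<in> S \<Longrightarrow> y' (b s) = b (y s)" and t: "t \<in> S"
  have S: "x s \<in> S" "y s \<in> S" if "s \<in> S" for s using cl that by (auto simp: closed_under_def)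
  have pow: "(y' ^^ k) (b t) = b ((y ^^ k) t) \<and> (y ^^ k) t \<in> S" for k
    using t S y by (induction k) auto
  show "gamma_rel e x' y' (b t) = gamma_rel e x y t"
    unfolding gamma_rel_def using t S x y pow[of 9] by (simp add: inj_on_eq_iff[OF inj])
qed

abbreviation kind_acts :: "bool \<Rightarrow> nat \<Rightarrow> ((nat \<Rightarrow> nat) \<times> (nat \<Rightarrow> nat)) set" where
  "kind_acts e n \<equiv> conn_acts (gamma_rel e) 0 {..<n}"

lemma gamma_act_iff:
  assumes "x permutes T" "y permutes T"
  shows "gamma_act x y \<longleftrightarrow> (\<forall>t\<in>T. x (x t) = y (y (y t)) \<and> (y ^^ 9) t = t)"
proof -
  have fix_pow: "(y ^^ k) t = t" if "t \<notin> T" for k t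
    by (induction k) (use that permutes_not_in[OF assms(2)] in auto)
  have "x (x t) = y (y (y t))" "(y ^^ 9) t = t" if "t \<notin> T" for t
    using that fix_pow[OF that] permutes_not_in[OF assms(1)] permutes_not_in[OF assms(2)] by simp_all
  then show ?thesis using assms by (auto simp: gamma_act_def permutes_bij)
qed

text \<open>Since \<open>y^3 = x^2\<close> commutes with both generators, the set \<open>D\<close>
  of points that it treats like 0 is closed. In a transitive action the point 0 thus decides for all
  points.\<close>

lemma kind_acts_eq:
  assumes n: "n \<ge> 1"
  shows "kind_acts e n = {z \<in> trans_acts n. (cls (gen_pow Gen_y 3) \<in> stab z) = e}"
proof -
  have "(x, y) \<in> kind_acts e n \<longleftrightarrow> (x, y) \<in> trans_acts n \<and> (cls (gen_pow Gen_y 3) \<in> stab (x, y)) = e" for x y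
  proof (cases "(x, y) \<in> trans_acts n")
    case True
    then have act: "gamma_act x y" and perm: "x permutes {..<n}" "y permutes {..<n}"
      and c: "connected_from 0 {..<n} x y" by (auto simp: trans_acts_def)
    have e: "cls (gen_pow Gen_y 3) \<in> stab (x, y) \<longleftrightarrow> y (y (y 0)) = 0"
      unfolding cls_in_stab[OF act] run_gen_pow by (simp add: eval_nat_numeral)
    have rel: "x (x t) = y (y (y t))" "(y ^^ 9) t = t" for t using act by (auto simp: gamma_act_def)
    have "inj x" "inj y" using perm by (auto intro: permutes_inj)
    then have cc: "y (y (y (x t))) = x t \<longleftrightarrow> y (y (y t)) = t" "y (y (y (y t))) = y t \<longleftrightarrow> y (y (y t)) = t" for t
      by (simp_all add: rel(1)[symmetric] inj_eq)
    define D where "D = {t \<in> {..<n}. (y (y (y t)) = t) = (y (y (y 0)) = 0)}"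
    have "closed_under x y D"
      using cc permutes_in_image[OF perm(1)] permutes_in_image[OF perm(2)]
      by (auto simp: closed_under_def D_def)
    moreover have "0 \<in> D" "D \<subseteq> {..<n}" using n by (auto simp: D_def)
    ultimately have "D = {..<n}" by (intro c[unfolded connected_from_def, rule_format])
    then have *: "(y (y (y t)) = t) = (y (y (y 0)) = 0)" if "t < n" for t using that by (auto simp: D_def)
    have "(x, y) \<in> kind_acts e n \<longleftrightarrow> (\<forall>t<n. gamma_rel e x y t)"
      using perm c by (auto simp: conn_acts_def acts_def)
    also have "\<dots> \<longleftrightarrow> (\<forall>t<n. (y (y (y t)) = t) = e)"
      unfolding gamma_rel_def using rel by auto
    also have "\<dots> \<longleftrightarrow> (y (y (y 0)) = 0) = e"
      using * n by (metis less_le_trans zero_less_one)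
    finally show ?thesis unfolding e using True by blast
  next
    case False
    have "(x, y) \<notin> kind_acts e n"
      using False gamma_act_iff[of x "{..<n}" y] by (auto simp: conn_acts_def acts_def gamma_rel_def trans_acts_def)
    with False show ?thesis by simp
  qed
  then show ?thesis by auto
qed

lemma finite_trans_acts: "finite (trans_acts n)"
  by (rule finite_subset[of _ "{x. x permutes {..<n}} \<times> {y. y permutes {..<n}}"])
     (auto simp: trans_acts_def finite_permutations)

text \<open>For \<open>n \<ge> 1\<close> these are the subgroups of index \<open>n\<close> that
  contain the central element \<open>y^3\<close>, or those that do not contain it, by
  \<open>kind_acts_eq\<close>.\<close>

definition kind_subgroups :: "bool \<Rightarrow> nat \<Rightarrow> nat" where
  "kind_subgroups e n = card (stab ` kind_acts e n)"

lemma card_kind_acts: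
  assumes n: "n \<ge> 1" shows "card (kind_acts e n) = kind_subgroups e n * fact (n - 1)"
proof -
  have fin: "finite (kind_acts e n)" by (simp add: finite_conn_acts)
  have "card (kind_acts e n) = (\<Sum>H\<in>stab ` kind_acts e n. card {z \<in> kind_acts e n. stab z = H})"
    using sum.image_gen[OF fin, of "\<lambda>_. 1 :: nat" stab] by simp
  also have "\<dots> = (\<Sum>H\<in>stab ` kind_acts e n. fact (n - 1))"
  proof (rule sum.cong[OF refl])
    fix H assume "H \<in> stab ` kind_acts e n"
    then obtain z where z: "z \<in> kind_acts e n" "H = stab z" by auto
    then have "{z' \<in> kind_acts e n. stab z' = H} = {z' \<in> trans_acts n. stab z' = stab z}"
      by (auto simp: kind_acts_eq[OF n])
    then show "card {z' \<in> kind_acts e n. stab z' = H} = fact (n - 1)"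
      using card_stab_fibre[OF _ n, of z] z by (simp add: kind_acts_eq[OF n])
  qed
  finally show ?thesis by (simp add: kind_subgroups_def)
qed

theorem num_subgroups_Gamma33:
  assumes n: "n \<ge> 1"
  shows "num_subgroups Gamma33 n = kind_subgroups True n + kind_subgroups False n"
proof -
  have "{H. subgroup H Gamma33 \<and> card (rcosets\<^bsub>Gamma33\<^esub> H) = n} = stab ` trans_acts n"
  proof (intro subset_antisym subsetI)
    fix H assume "H \<in> {H. subgroup H Gamma33 \<and> card (rcosets\<^bsub>Gamma33\<^esub> H) = n}"
    then show "H \<in> stab ` trans_acts n" using ex_trans_act[of H n] n by blast
  next
    fix H assume "H \<in> stab ` trans_acts n"
    then obtain x y where z: "(x, y) \<in> trans_acts n" "H = stab (x, y)" by auto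
    then have "gamma_act x y" by (simp add: trans_acts_def)
    then show "H \<in> {H. subgroup H Gamma33 \<and> card (rcosets\<^bsub>Gamma33\<^esub> H) = n}"
      using subgroup_stab card_rcosets_stab[OF z(1) n] z(2) by blast
  qed
  also have "\<dots> = stab ` kind_acts True n \<union> stab ` kind_acts False n"
    by (auto simp: kind_acts_eq[OF n])
  finally show ?thesis
    unfolding num_subgroups_def kind_subgroups_def
    by (simp only:) (rule card_Un_disjoint, auto simp: kind_acts_eq[OF n] finite_trans_acts)
qed

theorem gamma_acts_recurrence:
  assumes n: "n \<ge> 1"
  shows "card (acts (gamma_rel e) {..<n}) =
    (\<Sum>k = 1..n. (n - 1 choose (k - 1)) * (kind_subgroups e k * fact (k - 1) * card (acts (gamma_rel e) {..<n - k})))"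
  unfolding gamma_rel.acts_recurrence[OF n] by (intro sum.cong refl) (simp add: card_kind_acts)

subsection \<open>Permutations with prescribed cycle lengths\<close>

text \<open>Forcing the second permutation to be the identity makes the orbit decomposition of pairs
  available for one permutation; \<open>least_power x t\<close> is the length of the cycle through
  \<open>t\<close>.\<close>

definition cyc_rel :: "nat set \<Rightarrow> (nat \<Rightarrow> nat) \<Rightarrow> (nat \<Rightarrow> nat) \<Rightarrow> nat \<Rightarrow> bool" where
  "cyc_rel K x y t \<longleftrightarrow> least_power x t \<in> K \<and> y t = t"

definition cyc_perms :: "nat set \<Rightarrow> nat set \<Rightarrow> (nat \<Rightarrow> nat) set" where
  "cyc_perms K T = {x. x permutes T \<and> (\<forall>t\<in>T. least_power x t \<in> K)}"

lemma finite_cyc_perms: "finite T \<Longrightarrow> finite (cyc_perms K T)"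
  by (rule finite_subset[of _ "{x. x permutes T}"]) (auto simp: cyc_perms_def finite_permutations)

lemma least_power_transfer:
  assumes "inj_on b S" "x ` S \<subseteq> S" "\<And>s. s \<in> S \<Longrightarrow> x' (b s) = b (x s)" "t \<in> S"
  shows "least_power x' (b t) = least_power x t"
proof -
  have "(x' ^^ k) (b t) = b ((x ^^ k) t) \<and> (x ^^ k) t \<in> S" for k
    using assms by (induction k) auto
  then show ?thesis unfolding least_power_def using assms(1,4) by (simp add: inj_on_eq_iff)
qed

interpretation cyc_rel: local_property "cyc_rel K" for K
proof
  fix b :: "nat \<Rightarrow> nat" and S x y x' y' t
  assume "inj_on b S" "closed_under x y S" "\<And>s. s \<in> S \<Longrightarrow> x' (b s) = b (x s)"
    "\<And>s. s \<in> S \<Longrightarrow> y' (b s) = b (y s)" "t \<in> S"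
  moreover from this have "least_power x' (b t) = least_power x t"
    by (intro least_power_transfer[of b S]) (auto simp: closed_under_def)
  ultimately show "cyc_rel K x' y' (b t) = cyc_rel K x y t"
    by (auto simp: cyc_rel_def closed_under_def inj_on_eq_iff image_subset_iff)
qed

lemma acts_cyc_rel: "acts (cyc_rel K) T = (\<lambda>x. (x, id)) ` cyc_perms K T"
proof -
  have "y = id" if "y permutes T" "\<forall>t\<in>T. y t = t" for y :: "nat \<Rightarrow> nat"
    using that permutes_not_in[OF that(1)] by (auto simp: fun_eq_iff)
  then show ?thesis by (auto simp: acts_def cyc_perms_def cyc_rel_def permutes_id)
qed

lemma card_acts_cyc_rel: "card (acts (cyc_rel K) T) = card (cyc_perms K T)"
  unfolding acts_cyc_rel by (rule card_image) (auto intro: inj_onI)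

text \<open>If \<open>x\<close> alone is transitive, then it is a single cycle: the cycle through
  \<open>p\<close>, listed by \<open>support\<close>, is a closed set.\<close>

lemma connected_from_least_power:
  assumes x: "x permutes T" and T: "finite T" and conn: "connected_from p T x id" and p: "p \<in> T" and t: "t \<in> T"
  shows "least_power x t = card T"
proof -
  have perm: "permutation x" using x T by (auto simp: permutation_permutes)
  have "set (support x p) = T"
  proof (intro conn[unfolded connected_from_def, rule_format])
    have "(x ^^ i) p \<in> T" for i using p permutes_in_image[OF x] by (induction i) auto
    then show "set (support x p) \<subseteq> T" by auto
    show "p \<in> set (support x p)" unfolding support_set[OF perm] by (rule range_eqI[of _ _ 0]) simp
    have "x ((x ^^ i) p) = (x ^^ Suc i) p" for i by simp
    then show "closed_under x id (set (support x p))"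
      unfolding support_set[OF perm] closed_under_def by (auto simp del: funpow.simps)
  qed
  then have p_len: "card T = least_power x p"
    using cycle_of_permutation[OF perm, of p] by (metis distinct_card length_map length_upt minus_nat.diff_0)
  \<comment> \<open>Conjugating \<open>x\<close> by itself changes nothing, so the length is
    constant along a cycle.\<close>
  have "least_power x (x s) = least_power x s" for s
    using permutes_inj[OF x] by (intro least_power_transfer[of x UNIV]) auto
  then have "{s \<in> T. least_power x s = least_power x p} = T"
    using p x by (intro conn[unfolded connected_from_def, rule_format])
      (auto simp: closed_under_def permutes_in_image)
  with t p_len show ?thesis by auto
qed

lemma conn_acts_cyc_rel:
  assumes "k \<ge> 1"
  shows "conn_acts (cyc_rel K) 0 {..<k} = (if k \<in> K then conn_acts (cyc_rel UNIV) 0 {..<k} else {})"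
proof -
  have "(x, y) \<in> conn_acts (cyc_rel K) 0 {..<k} \<longleftrightarrow> k \<in> K \<and> (x, y) \<in> conn_acts (cyc_rel UNIV) 0 {..<k}" for x y
  proof (cases "(x, y) \<in> conn_acts (cyc_rel UNIV) 0 {..<k}")
    case True
    then have x: "x permutes {..<k}" and "connected_from 0 {..<k} x y" "(x, y) \<in> acts (cyc_rel UNIV) {..<k}"
      by (auto simp: conn_acts_def acts_def)
    then have "connected_from 0 {..<k} x id" by (auto simp: acts_cyc_rel)
    then have "least_power x t = k" if "t < k" for t
      using connected_from_least_power[OF x, of 0 t] that assms by simp
    with True assms show ?thesis by (force simp: conn_acts_def acts_def cyc_rel_def)
  next
    case False
    then show ?thesis by (auto simp: conn_acts_def acts_def cyc_rel_def)
  qed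
  then show ?thesis by auto
qed

lemma choose_fact_mult:
  assumes "1 \<le> k" "k \<le> n"
  shows "(n - 1 choose (k - 1)) * (fact (k - 1) * fact (n - k)) = (fact (n - 1) :: nat)"
proof -
  have "n - 1 - (k - 1) = n - k" using assms by simp
  then show ?thesis using binomial_fact_lemma[of "k - 1" "n - 1"] assms by (simp add: mult_ac)
qed

text \<open>
  The number of \<open>n\<close>-cycles is obtained by applying the recurrence to the class of all \<open>n!\<close>
  permutations.
\<close>

lemma card_cycles:
  assumes "n \<ge> 1" shows "card (conn_acts (cyc_rel UNIV) 0 {..<n}) = fact (n - 1)"
  using assms
proof (induction n rule: less_induct)
  case (less n)
  define t where "t = (\<lambda>k. card (conn_acts (cyc_rel UNIV) 0 {..<k}))"
  have all: "card (acts (cyc_rel UNIV) {..<m}) = fact m" for m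
    unfolding card_acts_cyc_rel cyc_perms_def by (simp add: card_permutations)
  have "fact n = (\<Sum>k = 1..n. (n - 1 choose (k - 1)) * (t k * fact (n - k)))"
    using cyc_rel.acts_recurrence[OF less.prems, of UNIV] unfolding all t_def .
  also have "{1..n} = insert n {1..<n}" using less.prems by auto
  also have "(\<Sum>k\<in>insert n {1..<n}. (n - 1 choose (k - 1)) * (t k * fact (n - k)))
      = t n + (\<Sum>k = 1..<n. (n - 1 choose (k - 1)) * (t k * fact (n - k)))"
    using less.prems by simp
  also have "(\<Sum>k = 1..<n. (n - 1 choose (k - 1)) * (t k * fact (n - k))) = (\<Sum>k = 1..<n. fact (n - 1))"
  proof (rule sum.cong[OF refl])
    fix k assume k: "k \<in> {1..<n}"
    then have "t k = fact (k - 1)" using less.IH[of k] by (simp add: t_def)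
    then show "(n - 1 choose (k - 1)) * (t k * fact (n - k)) = fact (n - 1)"
      using choose_fact_mult[of k n] k by simp
  qed
  also have "\<dots> = (n - 1) * fact (n - 1)" by simp
  finally have "fact n = t n + (n - 1) * fact (n - 1)" .
  moreover have "(fact n :: nat) = fact (n - 1) + (n - 1) * fact (n - 1)"
    using less.prems by (cases n) simp_all
  ultimately show ?case by (simp add: t_def)
qed

text \<open>The coefficient of \<open>X^n\<close> in the exponential of the sum of
  \<open>X^k / k\<close> over \<open>k\<close> in \<open>K\<close>.\<close>

definition cyc_coeff :: "nat set \<Rightarrow> nat \<Rightarrow> real" where
  "cyc_coeff K n = real (card (cyc_perms K {..<n})) / fact n"

lemma cyc_coeff_0 [simp]: "cyc_coeff K 0 = 1"
  by (simp add: cyc_coeff_def cyc_perms_def)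

text \<open>There are \<open>(k - 1)!\<close> cycles on \<open>k\<close> given points, which cancels
  the factorials in the orbit recurrence. For the generating function \<open>F\<close> it says that
  \<open>X * F'\<close> is \<open>F\<close> times the sum of \<open>X^k\<close> over
  \<open>K\<close>.\<close>

theorem cyc_coeff_recurrence: "real n * cyc_coeff K n = (\<Sum>k\<in>K \<inter> {1..n}. cyc_coeff K (n - k))"
proof (cases "n \<ge> 1")
  case True
  have "real (card (cyc_perms K {..<n})) =
      (\<Sum>k = 1..n. if k \<in> K then fact (n - 1) * cyc_coeff K (n - k) else 0)"
    unfolding card_acts_cyc_rel[symmetric] cyc_rel.acts_recurrence[OF True] of_nat_sum
  proof (rule sum.cong[OF refl])
    fix k assume k: "k \<in> {1..n}"
    have "real (fact (n - 1)) = real ((n - 1 choose (k - 1)) * (fact (k - 1) * fact (n - k)))"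
      using choose_fact_mult[of k n] k by simp
    moreover have "card (conn_acts (cyc_rel K) 0 {..<k}) = (if k \<in> K then fact (k - 1) else 0)"
      using k card_cycles[of k] conn_acts_cyc_rel[of k K] by auto
    ultimately show "real ((n - 1 choose (k - 1)) * (card (conn_acts (cyc_rel K) 0 {..<k}) * card (acts (cyc_rel K) {..<n - k})))
        = (if k \<in> K then fact (n - 1) * cyc_coeff K (n - k) else 0)"
      by (simp add: cyc_coeff_def card_acts_cyc_rel)
  qed
  also have "\<dots> = (\<Sum>k\<in>K \<inter> {1..n}. fact (n - 1) * cyc_coeff K (n - k))"
    by (simp add: sum.If_cases Int_commute)
  finally have "real (card (cyc_perms K {..<n})) = fact (n - 1) * (\<Sum>k\<in>K \<inter> {1..n}. cyc_coeff K (n - k))"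
    by (simp add: sum_distrib_left)
  moreover have "(fact n :: real) = real n * fact (n - 1)" using True by (simp add: fact_reduce)
  ultimately show ?thesis using True by (simp add: cyc_coeff_def)
qed simp

text \<open>A power \<open>x^k\<close> fixes \<open>t\<close> exactly if the cycle length at
  \<open>t\<close> divides \<open>k\<close>. So 3 and 6 are the divisors of 6 that do not divide 2,
  and 9 is the divisor of 9 that does not divide 3. The first two conditions may range over all
  \<open>t\<close>, because points outside \<open>T\<close> have cycle length 1.\<close>

lemma cyc_perms_iff_power:
  assumes "finite T" "x permutes T"
  shows "x \<in> cyc_perms {1, 2} T \<longleftrightarrow> (\<forall>t. x (x t) = t)"
    and "x \<in> cyc_perms {1, 3} T \<longleftrightarrow> (\<forall>t. x (x (x t)) = t)"
    and "x \<in> cyc_perms {3} T \<longleftrightarrow> (\<forall>t\<in>T. x (x (x t)) = t \<and> x t \<noteq> t)"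
    and "x \<in> cyc_perms {3, 6} T \<longleftrightarrow> (\<forall>t\<in>T. (x ^^ 6) t = t \<and> x (x t) \<noteq> t)"
    and "x \<in> cyc_perms {9} T \<longleftrightarrow> (\<forall>t\<in>T. (x ^^ 9) t = t \<and> x (x (x t)) \<noteq> t)"
proof -
  have perm: "permutation x" using assms by (auto simp: permutation_permutes)
  have out: "x t = t" if "t \<notin> T" for t using permutes_not_in[OF assms(2) that] .
  note dvd = least_power_dvd[OF perm, symmetric]
  have d2: "d dvd 2 \<longleftrightarrow> d = 1 \<or> d = 2" and d3: "d dvd 3 \<longleftrightarrow> d = 1 \<or> d = 3"
    and d6: "d dvd 6 \<longleftrightarrow> d = 1 \<or> d = 2 \<or> d = 3 \<or> d = 6"
    and d9: "d dvd 9 \<longleftrightarrow> d = 1 \<or> d = 3 \<or> d = 9" for d :: nat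
  proof -
    have *: "d dvd m \<longleftrightarrow> d \<in> set (filter (\<lambda>d. d dvd m) [1..<Suc m])" if "m > 0" for m
      using that by (auto dest: dvd_imp_le simp: Suc_le_eq dvd_pos_nat)
    have 2: "filter (\<lambda>d. d dvd 2) [1..<Suc 2] = [1, 2]" and 3: "filter (\<lambda>d. d dvd 3) [1..<Suc 3] = [1, 3]"
      and 6: "filter (\<lambda>d. d dvd 6) [1..<Suc 6] = [1, 2, 3, 6]"
      and 9: "filter (\<lambda>d. d dvd 9) [1..<Suc 9] = [1, 3, 9]"
      by code_simp+
    show "d dvd 2 \<longleftrightarrow> d = 1 \<or> d = 2" using *[of 2] unfolding 2 by simp
    show "d dvd 3 \<longleftrightarrow> d = 1 \<or> d = 3" using *[of 3] unfolding 3 by simp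
    show "d dvd 6 \<longleftrightarrow> d = 1 \<or> d = 2 \<or> d = 3 \<or> d = 6" using *[of 6] unfolding 6 by simp
    show "d dvd 9 \<longleftrightarrow> d = 1 \<or> d = 3 \<or> d = 9" using *[of 9] unfolding 9 by simp
  qed
  have p1: "x t = t \<longleftrightarrow> least_power x t = 1" for t
    using dvd[of 1 t] by simp
  have "(x ^^ 2) t = x (x t)" "(x ^^ 3) t = x (x (x t))" for t by (simp_all add: eval_nat_numeral)
  then have p2: "x (x t) = t \<longleftrightarrow> least_power x t = 1 \<or> least_power x t = 2"
    and p3: "x (x (x t)) = t \<longleftrightarrow> least_power x t = 1 \<or> least_power x t = 3" for t
    using dvd[of 2 t] dvd[of 3 t] unfolding d2 d3 by simp_all
  have p6: "(x ^^ 6) t = t \<longleftrightarrow> least_power x t = 1 \<or> least_power x t = 2 \<or> least_power x t = 3 \<or> least_power x t = 6"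
    and p9: "(x ^^ 9) t = t \<longleftrightarrow> least_power x t = 1 \<or> least_power x t = 3 \<or> least_power x t = 9" for t
    unfolding dvd d6 d9 by simp_all
  have fixed: "least_power x t = 1" if "t \<notin> T" for t using out[OF that] p1 by blast
  show "x \<in> cyc_perms {1, 2} T \<longleftrightarrow> (\<forall>t. x (x t) = t)"
    using assms(2) fixed unfolding cyc_perms_def p2 by blast
  show "x \<in> cyc_perms {1, 3} T \<longleftrightarrow> (\<forall>t. x (x (x t)) = t)"
    using assms(2) fixed unfolding cyc_perms_def p3 by blast
  show "x \<in> cyc_perms {3} T \<longleftrightarrow> (\<forall>t\<in>T. x (x (x t)) = t \<and> x t \<noteq> t)"
    using assms(2) unfolding cyc_perms_def p3 p1 by auto
  show "x \<in> cyc_perms {3, 6} T \<longleftrightarrow> (\<forall>t\<in>T. (x ^^ 6) t = t \<and> x (x t) \<noteq> t)"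
    using assms(2) unfolding cyc_perms_def p6 p2 by auto
  show "x \<in> cyc_perms {9} T \<longleftrightarrow> (\<forall>t\<in>T. (x ^^ 9) t = t \<and> x (x (x t)) \<noteq> t)"
    using assms(2) unfolding cyc_perms_def p9 p3 by auto
qed

text \<open>With trivial central element the relations become \<open>x^2 = 1\<close> and
  \<open>y^3 = 1\<close>, which do not link \<open>x\<close> and \<open>y\<close>: an action of the
  free product of \<open>C_2\<close> and \<open>C_3\<close>.\<close>

lemma card_acts_central_trivial:
  assumes "finite T"
  shows "card (acts (gamma_rel True) T) = card (cyc_perms {1, 2} T) * card (cyc_perms {1, 3} T)"
proof -
  have "(x, y) \<in> acts (gamma_rel True) T \<longleftrightarrow> x \<in> cyc_perms {1, 2} T \<and> y \<in> cyc_perms {1, 3} T" for x y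
  proof (cases "x permutes T \<and> y permutes T")
    case True
    then have out: "x t = t" "y t = t" if "t \<notin> T" for t using that permutes_not_in by metis+
    have "(y ^^ 9) t = t" if "\<forall>t. y (y (y t)) = t" for t using that by (simp add: eval_nat_numeral)
    then have "(\<forall>t\<in>T. gamma_rel True x y t) \<longleftrightarrow> (\<forall>t. x (x t) = t) \<and> (\<forall>t. y (y (y t)) = t)"
      using out unfolding gamma_rel_def by metis
    then show ?thesis using True cyc_perms_iff_power[OF assms] by (auto simp: acts_def)
  next
    case False
    then show ?thesis by (auto simp: acts_def cyc_perms_def)
  qed
  then have "acts (gamma_rel True) T = cyc_perms {1, 2} T \<times> cyc_perms {1, 3} T" by auto
  then show ?thesis by (simp add: card_cartesian_product)
qed

text \<open>Both permutations consist of 3-cycles only, and equally many of them. The induction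
  matches one 3-cycle with another and removes both.\<close>

lemma order_three_conjugate:
  fixes c :: "'a \<Rightarrow> 'a" and c' :: "'b \<Rightarrow> 'b"
  assumes "finite T" "finite T'" "card T = card T'"
    and "c ` T \<subseteq> T" "\<forall>t\<in>T. c (c (c t)) = t \<and> c t \<noteq> t"
    and "c' ` T' \<subseteq> T'" "\<forall>t\<in>T'. c' (c' (c' t)) = t \<and> c' t \<noteq> t"
  shows "\<exists>p. bij_betw p T T' \<and> (\<forall>t\<in>T. p (c t) = c' (p t))"
  using assms
proof (induction "card T" arbitrary: T T' rule: less_induct)
  case less
  show ?case
  proof (cases "T = {}")
    case True
    then show ?thesis using less.prems by (auto simp: bij_betw_def)
  next
    case False
    then obtain t where t: "t \<in> T" by blast
    have "T' \<noteq> {}" using False less.prems by auto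
    then obtain t' where t': "t' \<in> T'" by blast
    define O1 where "O1 = {t, c t, c (c t)}"
    define O2 where "O2 = {t', c' t', c' (c' t')}"
    have ct: "c t \<in> T" "c (c t) \<in> T" "c (c (c t)) = t" "c t \<noteq> t" "c (c t) \<noteq> c t" "c (c t) \<noteq> t"
      using t less.prems(4,5) by (auto simp: image_subset_iff)
    have ct': "c' t' \<in> T'" "c' (c' t') \<in> T'" "c' (c' (c' t')) = t'" "c' t' \<noteq> t'" "c' (c' t') \<noteq> c' t'" "c' (c' t') \<noteq> t'"
      using t' less.prems(6,7) by (auto simp: image_subset_iff)
    have sub: "O1 \<subseteq> T" "O2 \<subseteq> T'" and card: "card O1 = 3" "card O2 = 3"
      using t t' ct ct' by (auto simp: O1_def O2_def)
    have lt: "card (T - O1) < card T" and eq: "card (T - O1) = card (T' - O2)"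
      using sub card less.prems(1-3) t by (auto simp: card_Diff_subset finite_subset card_gt_0_iff intro!: diff_less)
    have cl: "c ` (T - O1) \<subseteq> T - O1"
      using less.prems(4,5) ct by (auto simp: O1_def image_subset_iff)
    have cl': "c' ` (T' - O2) \<subseteq> T' - O2"
      using less.prems(6,7) ct' by (auto simp: O2_def image_subset_iff)
    obtain p where p: "bij_betw p (T - O1) (T' - O2)" "\<forall>s\<in>T - O1. p (c s) = c' (p s)"
      using less.hyps[OF lt _ _ eq cl _ cl'] less.prems by auto
    define q where "q = (\<lambda>s. if s = t then t' else if s = c t then c' t' else c' (c' t'))"
    have q: "bij_betw q O1 O2" using ct ct' by (auto simp: bij_betw_def inj_on_def q_def O1_def O2_def)
    have "bij_betw (\<lambda>s. if s \<in> O1 then q s else p s) (O1 \<union> (T - O1)) (O2 \<union> (T' - O2))"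
      using q p(1) by (rule bij_betw_disjoint_Un) auto
    then have "bij_betw (\<lambda>s. if s \<in> O1 then q s else p s) T T'"
      using sub by (simp add: Un_absorb1 Un_Diff_cancel)
    moreover have "\<forall>s\<in>T. (if c s \<in> O1 then q (c s) else p (c s)) = c' (if s \<in> O1 then q s else p s)"
    proof
      fix s assume s: "s \<in> T"
      show "(if c s \<in> O1 then q (c s) else p (c s)) = c' (if s \<in> O1 then q s else p s)"
      proof (cases "s \<in> O1")
        case True
        then show ?thesis using ct ct' by (auto simp: q_def O1_def)
      next
        case False
        then have "c s \<notin> O1" using s cl by auto
        then show ?thesis using False s p(2) by simp
      qed
    qed
    ultimately show ?thesis by (intro exI[of _ "\<lambda>s. if s \<in> O1 then q s else p s"] conjI)
  qed
qed

text \<open>All products of 3-cycles that cover \<open>T\<close> are conjugate, and conjugation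
  carries the \<open>d\<close>-th roots of one to those of the other without changing cycle
  lengths.\<close>

lemma card_power_fibres:
  assumes T: "finite T" and c: "c \<in> cyc_perms {3} T" "c' \<in> cyc_perms {3} T"
  shows "card {x \<in> cyc_perms K T. x ^^ d = c} = card {x \<in> cyc_perms K T. x ^^ d = c'}"
proof -
  have perm: "c permutes T" "c' permutes T" using c by (auto simp: cyc_perms_def)
  have 3: "\<forall>t\<in>T. c (c (c t)) = t \<and> c t \<noteq> t" "\<forall>t\<in>T. c' (c' (c' t)) = t \<and> c' t \<noteq> t"
    using cyc_perms_iff_power(3)[OF T perm(1)] cyc_perms_iff_power(3)[OF T perm(2)] c by auto
  obtain p0 where p0: "bij_betw p0 T T" "\<forall>t\<in>T. p0 (c t) = c' (p0 t)"
    using order_three_conjugate[OF T T refl _ 3(1) _ 3(2)] perm by (auto simp: permutes_image)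
  define p where "p = (\<lambda>t. if t \<in> T then p0 t else t)"
  define r where "r = inv_into UNIV p"
  have p: "p permutes T"
    using p0(1) by (intro bij_imp_permutes) (auto simp: p_def cong: bij_betw_cong)
  have r: "r permutes T" unfolding r_def using p by (rule permutes_inv)
  have pr: "p (r t) = t" "r (p t) = t" for t
    using p by (simp_all add: r_def permutes_inverses)
  have pc: "p (c t) = c' (p t)" for t
    using p0(2) permutes_in_image[OF perm(1), of t] permutes_not_in[OF perm(1), of t] permutes_not_in[OF perm(2), of t]
    by (auto simp: p_def)
  have conj: "g \<circ> x \<circ> f \<in> {x \<in> cyc_perms K T. x ^^ d = b'}"
    if x: "x \<in> {x \<in> cyc_perms K T. x ^^ d = b}" and g: "g permutes T" "f permutes T"
      and gf: "\<And>t. g (f t) = t" "\<And>t. f (g t) = t" and b: "\<And>t. g (b t) = b' (g t)" for g f x b b'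
  proof -
    have "least_power (g \<circ> x \<circ> f) (g s) = least_power x s" for s
      using permutes_inj[OF g(1)] gf by (intro least_power_transfer[of g UNIV]) auto
    then have "least_power (g \<circ> x \<circ> f) t = least_power x (f t)" for t using gf by metis
    moreover have "((g \<circ> x \<circ> f) ^^ k) t = g ((x ^^ k) (f t))" for k t
      by (induction k) (simp_all add: gf)
    then have "(g \<circ> x \<circ> f) ^^ d = b'" using x b gf by (auto simp: fun_eq_iff)
    ultimately show ?thesis using x g permutes_in_image[OF g(2)] by (auto simp: cyc_perms_def intro!: permutes_compose)
  qed
  have pc': "r (c' t) = c (r t)" for t using pc pr by metis
  have "bij_betw (\<lambda>x. p \<circ> x \<circ> r) {x \<in> cyc_perms K T. x ^^ d = c} {x \<in> cyc_perms K T. x ^^ d = c'}"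
  proof (rule bij_betw_byWitness[of _ "\<lambda>x. r \<circ> x \<circ> p"])
    show "(\<lambda>x. p \<circ> x \<circ> r) ` {x \<in> cyc_perms K T. x ^^ d = c} \<subseteq> {x \<in> cyc_perms K T. x ^^ d = c'}"
      using conj[where g = p and f = r and b = c and b' = c', OF _ p r pr pc] by blast
    show "(\<lambda>x. r \<circ> x \<circ> p) ` {x \<in> cyc_perms K T. x ^^ d = c'} \<subseteq> {x \<in> cyc_perms K T. x ^^ d = c}"
      using conj[where g = r and f = p and b = c' and b' = c, OF _ r p pr(2,1) pc'] by blast
  qed (auto simp: fun_eq_iff pr)
  then show ?thesis by (rule bij_betw_same_card)
qed

text \<open>Sort by the common value \<open>c = x^2 = y^3\<close>, which runs through
  \<open>cyc_perms {3} T\<close>. The numbers \<open>f\<close> of square roots and \<open>g\<close>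
  of cube roots of the required cycle lengths do not depend on \<open>c\<close>. With
  \<open>N\<close> values of \<open>c\<close> there are \<open>N * f * g\<close> actions, while the
  two classes on the right have \<open>N * f\<close> and \<open>N * g\<close> elements. The product
  form also covers \<open>N = 0\<close>.\<close>

lemma card_acts_central_free:
  assumes T: "finite T"
  shows "card (acts (gamma_rel False) T) * card (cyc_perms {3} T) = card (cyc_perms {3, 6} T) * card (cyc_perms {9} T)"
proof -
  let ?C = "cyc_perms {3} T"
  let ?F = "\<lambda>K d c. {x \<in> cyc_perms K T. x ^^ d = c}"
  have finC: "finite ?C" using T by (rule finite_cyc_perms)
  have finF: "finite (?F K d c)" for K d c using finite_cyc_perms[OF T, of K] by simp
  have pow_perm: "x ^^ d permutes T" if "x permutes T" for x d
    using that by (rule permutes_funpow)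
  have V: "x ^^ 2 \<in> ?C" if x: "x \<in> cyc_perms {3, 6} T" for x
  proof -
    have p: "x permutes T" using x by (simp add: cyc_perms_def)
    then show ?thesis
      using x unfolding cyc_perms_iff_power(4)[OF T p] cyc_perms_iff_power(3)[OF T pow_perm[OF p]]
      by (simp add: eval_nat_numeral)
  qed
  have R: "y ^^ 3 \<in> ?C" if y: "y \<in> cyc_perms {9} T" for y
  proof -
    have p: "y permutes T" using y by (simp add: cyc_perms_def)
    then show ?thesis
      using y unfolding cyc_perms_iff_power(5)[OF T p] cyc_perms_iff_power(3)[OF T pow_perm[OF p]]
      by (simp add: eval_nat_numeral)
  qed
  have "acts (gamma_rel False) T = (\<Union>c\<in>?C. ?F {3, 6} 2 c \<times> ?F {9} 3 c)"
  proof -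
    have "(x, y) \<in> acts (gamma_rel False) T \<longleftrightarrow> x \<in> cyc_perms {3, 6} T \<and> y \<in> cyc_perms {9} T \<and> x ^^ 2 = y ^^ 3" for x y
    proof (cases "x permutes T \<and> y permutes T")
      case True
      then have out: "x t = t" "y t = t" if "t \<notin> T" for t using that permutes_not_in by metis+
      have "x ^^ 2 = y ^^ 3 \<longleftrightarrow> (\<forall>t. x (x t) = y (y (y t)))" by (simp add: eval_nat_numeral fun_eq_iff)
      also have "\<dots> \<longleftrightarrow> (\<forall>t\<in>T. x (x t) = y (y (y t)))" using out by metis
      finally have eq: "x ^^ 2 = y ^^ 3 \<longleftrightarrow> (\<forall>t\<in>T. x (x t) = y (y (y t)))" .
      have 6: "x ^^ 6 = y ^^ 9" if "x ^^ 2 = y ^^ 3"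
      proof -
        have "x ^^ 6 = (x ^^ 2) ^^ 3" by (simp add: funpow_mult)
        also have "\<dots> = y ^^ 9" by (simp add: that funpow_mult)
        finally show ?thesis .
      qed
      have "(x, y) \<in> acts (gamma_rel False) T \<longleftrightarrow> x ^^ 2 = y ^^ 3 \<and> (\<forall>t\<in>T. (y ^^ 9) t = t \<and> y (y (y t)) \<noteq> t)"
        using True by (auto simp: acts_def gamma_rel_def eq)
      also have "\<dots> \<longleftrightarrow> (\<forall>t\<in>T. (x ^^ 6) t = t \<and> x (x t) \<noteq> t) \<and> (\<forall>t\<in>T. (y ^^ 9) t = t \<and> y (y (y t)) \<noteq> t) \<and> x ^^ 2 = y ^^ 3"
        using 6 eq by auto
      finally show ?thesis using True cyc_perms_iff_power(4)[OF T, of x] cyc_perms_iff_power(5)[OF T, of y] by simp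
    next
      case False
      then show ?thesis by (auto simp: acts_def cyc_perms_def)
    qed
    then show ?thesis using R by auto
  qed
  then have A: "card (acts (gamma_rel False) T) = (\<Sum>c\<in>?C. card (?F {3, 6} 2 c) * card (?F {9} 3 c))"
    using finF by (simp add: card_UN_disjoint[OF finC] card_cartesian_product disjoint_iff) 
  have group: "card (cyc_perms K T) = (\<Sum>c\<in>?C. card (?F K d c))"
    if "\<And>x. x \<in> cyc_perms K T \<Longrightarrow> x ^^ d \<in> ?C" for K d
  proof -
    have "(\<lambda>x. x ^^ d) ` cyc_perms K T \<subseteq> ?C" using that by blast
    from sum.group[OF finite_cyc_perms[OF T] finC this, of "\<lambda>_. 1 :: nat"] show ?thesis by simp
  qed
  show ?thesis
  proof (cases "?C = {}")
    case True
    then have "cyc_perms {9} T = {}" using R by blast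
    then show ?thesis using True by simp
  next
    case False
    then obtain c where c: "c \<in> ?C" by blast
    note const = card_power_fibres[OF T _ c]
    have "card (acts (gamma_rel False) T) = card ?C * (card (?F {3, 6} 2 c) * card (?F {9} 3 c))"
      unfolding A by (simp add: const)
    moreover have "card (cyc_perms {3, 6} T) = card ?C * card (?F {3, 6} 2 c)"
      using group[of "{3, 6}" 2] V by (simp add: const)
    moreover have "card (cyc_perms {9} T) = card ?C * card (?F {9} 3 c)"
      using group[of "{9}" 3] R by (simp add: const)
    ultimately show ?thesis by simp
  qed
qed

definition acts_coeff :: "bool \<Rightarrow> nat \<Rightarrow> real" where
  "acts_coeff e n = real (card (acts (gamma_rel e) {..<n})) / fact n"

lemma acts_coeff_recurrence:
  "real n * acts_coeff e n = (\<Sum>k = 1..n. real (kind_subgroups e k) * acts_coeff e (n - k))"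
proof (cases "n \<ge> 1")
  case True
  have "real (card (acts (gamma_rel e) {..<n})) =
      (\<Sum>k = 1..n. fact (n - 1) * (real (kind_subgroups e k) * acts_coeff e (n - k)))"
    unfolding gamma_acts_recurrence[OF True] of_nat_sum
  proof (rule sum.cong[OF refl])
    fix k assume k: "k \<in> {1..n}"
    have "real (fact (n - 1)) = real ((n - 1 choose (k - 1)) * (fact (k - 1) * fact (n - k)))"
      using choose_fact_mult[of k n] k by simp
    then show "real ((n - 1 choose (k - 1)) * (kind_subgroups e k * fact (k - 1) * card (acts (gamma_rel e) {..<n - k})))
        = fact (n - 1) * (real (kind_subgroups e k) * acts_coeff e (n - k))"
      by (simp add: acts_coeff_def)
  qed
  then have "real (card (acts (gamma_rel e) {..<n})) =
      fact (n - 1) * (\<Sum>k = 1..n. real (kind_subgroups e k) * acts_coeff e (n - k))"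
    by (simp only: sum_distrib_left)
  moreover have "(fact n :: real) = real n * fact (n - 1)" using True by (simp add: fact_reduce)
  ultimately show ?thesis using True by (simp add: acts_coeff_def[of e n])
qed simp

subsection \<open>Actions with trivial central element\<close>

definition invols :: "nat \<Rightarrow> real" where
  "invols n = fact n * cyc_coeff {1, 2} n"

definition cubes :: "nat \<Rightarrow> real" where
  "cubes n = fact n * cyc_coeff {1, 3} n"

lemma invols_rec: "invols 0 = 1" "invols 1 = 1" "invols (n + 2) = invols (n + 1) + (real n + 1) * invols n"
proof -
  have "{1, 2} \<inter> {1..n + 2} = {1, 2 :: nat}" by auto
  then have r: "real (n + 2) * cyc_coeff {1, 2} (n + 2) = cyc_coeff {1, 2} (n + 1) + cyc_coeff {1, 2} n"
    using cyc_coeff_recurrence[of "n + 2" "{1, 2}"] by (simp del: of_nat_add add: numeral_eq_Suc)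
  have "invols (n + 2) = fact (n + 1) * (real (n + 2) * cyc_coeff {1, 2} (n + 2))"
    by (simp add: invols_def)
  also have "\<dots> = invols (n + 1) + (real n + 1) * invols n"
    unfolding r by (simp add: invols_def algebra_simps)
  finally show "invols (n + 2) = invols (n + 1) + (real n + 1) * invols n" .
  have "{1, 2} \<inter> {1..1} = {1 :: nat}" by auto
  then show "invols 1 = 1" using cyc_coeff_recurrence[of 1 "{1, 2}"] by (simp add: invols_def)
qed (simp add: invols_def)

lemma cubes_rec: "cubes 0 = 1" "cubes 1 = 1" "cubes 2 = 1"
  "cubes (n + 3) = cubes (n + 2) + (real n + 2) * (real n + 1) * cubes n"
proof -
  have "{1, 3} \<inter> {1..n + 3} = {1, 3 :: nat}" by auto
  then have r: "real (n + 3) * cyc_coeff {1, 3} (n + 3) = cyc_coeff {1, 3} (n + 2) + cyc_coeff {1, 3} n"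
    using cyc_coeff_recurrence[of "n + 3" "{1, 3}"] by (simp del: of_nat_add add: numeral_eq_Suc)
  have f: "fact (n + 3) = fact (n + 2) * real (n + 3)" "fact (n + 2) = (real n + 2) * (real n + 1) * fact n"
    by (simp_all add: numeral_eq_Suc algebra_simps)
  have "cubes (n + 3) = fact (n + 2) * (real (n + 3) * cyc_coeff {1, 3} (n + 3))"
    unfolding cubes_def f(1) by (simp only: mult.assoc)
  also have "\<dots> = cubes (n + 2) + (real n + 2) * (real n + 1) * cubes n"
    unfolding r cubes_def f(2) by (simp add: algebra_simps)
  finally show "cubes (n + 3) = cubes (n + 2) + (real n + 2) * (real n + 1) * cubes n" .
  have "{1, 3} \<inter> {1..1} = {1 :: nat}" "{1, 3} \<inter> {1..2} = {1 :: nat}" by auto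
  then show "cubes 1 = 1" "cubes 2 = 1"
    using cyc_coeff_recurrence[of 1 "{1, 3}"] cyc_coeff_recurrence[of 2 "{1, 3}"]
    by (simp_all add: cubes_def numeral_2_eq_2)
qed (simp add: cubes_def)

lemma acts_coeff_trivial: "fact n * acts_coeff True n = invols n * cubes n"
  by (simp add: acts_coeff_def card_acts_central_trivial invols_def cubes_def cyc_coeff_def)

text \<open>Expressing everything by \<open>I0\<close>, \<open>I1\<close>, \<open>J0\<close>,
  \<open>J1\<close>, \<open>J2\<close> leaves polynomials in \<open>w\<close> times six products, so
  a recurrence for the products is a matter of comparing polynomials. The long products of linear
  factors are the quotients \<open>(j+8)! / (j+i)!\<close> and disappear when counts are replaced by
  counts over factorials. The remaining factors have degree at most two in \<open>w\<close>, hence a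
  differential equation of order two.\<close>

lemma involution_cube_identity:
  fixes w :: real
  assumes I: "I2 = I1 + (w+1)*I0" "I3 = I2 + (w+2)*I1" "I4 = I3 + (w+3)*I2" "I5 = I4 + (w+4)*I3"
     "I6 = I5 + (w+5)*I4" "I7 = I6 + (w+6)*I5" "I8 = I7 + (w+7)*I6" "I9 = I8 + (w+8)*I7"
   and J: "J3 = J2 + (w+2)*(w+1)*J0" "J4 = J3 + (w+3)*(w+2)*J1" "J5 = J4 + (w+4)*(w+3)*J2" "J6 = J5 + (w+5)*(w+4)*J3"
    "J7 = J6 + (w+6)*(w+5)*J4" "J8 = J7 + (w+7)*(w+6)*J5" "J9 = J8 + (w+8)*(w+7)*J6"
  shows "I9*J9 = I8*J8 + (w+8)*I7*J7 + (4*w+28)*(w+8)*(w+7)*I6*J6 + (2*w+14)*(w+8)*(w+7)*(w+6)*I5*J5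
    - (w+8)*(w+7)*(w+6)*(w+5)*I4*J4 + ((w+3)*(w+2)+4*(w+3)+4)*(w+8)*(w+7)*(w+6)*(w+5)*(w+4)*I3*J3
    - (2*(w+2)+2)*(w+8)*(w+7)*(w+6)*(w+5)*(w+4)*(w+3)*I2*J2
    - (w*(w-1)+4*w+2)*(w+8)*(w+7)*(w+6)*(w+5)*(w+4)*(w+3)*(w+2)*(w+1)*I0*J0"
  unfolding J I by algebra

lemma acts_coeff_trivial_recurrence:
  fixes j :: nat
  defines "w \<equiv> real j" and "a \<equiv> (\<lambda>i. acts_coeff True (j + i))"
  shows "(w + 9) * a 9 = a 8 + a 7 + (4 * w + 28) * a 6 + (2 * w + 14) * a 5 - a 4
    + ((w + 3) * (w + 2) + 4 * (w + 3) + 4) * a 3 - (2 * (w + 2) + 2) * a 2 - (w * (w - 1) + 4 * w + 2) * a 0"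
proof -
  define I where "I = (\<lambda>i. invols (j + i))"
  define J where "J = (\<lambda>i. cubes (j + i))"
  define f where "f = (\<lambda>i. fact (j + i) :: real)"
  have I: "I (i + 2) = I (i + 1) + (w + real i + 1) * I i" for i
    using invols_rec(3)[of "j + i"] by (simp add: I_def w_def algebra_simps)
  have J: "J (i + 3) = J (i + 2) + (w + real i + 2) * (w + real i + 1) * J i" for i
    using cubes_rec(4)[of "j + i"] by (simp add: J_def w_def algebra_simps)
  have f: "f (i + 1) = (w + real i + 1) * f i" for i
    by (simp add: f_def w_def algebra_simps)
  have fa: "f i * a i = I i * J i" for i
    by (simp add: f_def a_def I_def J_def acts_coeff_trivial)
  have f8: "f 8 = (w + 8) * f 7" "f 7 = (w + 7) * f 6" "f 6 = (w + 6) * f 5" "f 5 = (w + 5) * f 4"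
    "f 4 = (w + 4) * f 3" "f 3 = (w + 3) * f 2" "f 2 = (w + 2) * f 1" "f 1 = (w + 1) * f 0" "f 9 = (w + 9) * f 8"
    using f[of 8] f[of 7] f[of 6] f[of 5] f[of 4] f[of 3] f[of 2] f[of 1] f[of 0]
    by (simp_all add: numeral_eq_Suc)
  have pos: "f 8 \<noteq> 0" by (simp add: f_def)
  have id: "I 9 * J 9 = I 8 * J 8 + (w+8) * I 7 * J 7 + (4*w+28)*(w+8)*(w+7)*I 6 * J 6 + (2*w+14)*(w+8)*(w+7)*(w+6)*I 5 * J 5
    - (w+8)*(w+7)*(w+6)*(w+5)*I 4 * J 4 + ((w+3)*(w+2)+4*(w+3)+4)*(w+8)*(w+7)*(w+6)*(w+5)*(w+4)*I 3 * J 3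
    - (2*(w+2)+2)*(w+8)*(w+7)*(w+6)*(w+5)*(w+4)*(w+3)*I 2 * J 2
    - (w*(w-1)+4*w+2)*(w+8)*(w+7)*(w+6)*(w+5)*(w+4)*(w+3)*(w+2)*(w+1)*I 0 * J 0"
    using I[of 0] I[of 1] I[of 2] I[of 3] I[of 4] I[of 5] I[of 6] I[of 7]
      J[of 0] J[of 1] J[of 2] J[of 3] J[of 4] J[of 5] J[of 6]
    by (intro involution_cube_identity) (simp_all add: numeral_eq_Suc, simp_all add: algebra_simps)
  have "f 8 * ((w + 9) * a 9) = I 9 * J 9" using fa[of 9] by (simp add: f8(9) mult_ac)
  also have "\<dots> = f 8 * (a 8 + a 7 + (4 * w + 28) * a 6 + (2 * w + 14) * a 5 - a 4
    + ((w + 3) * (w + 2) + 4 * (w + 3) + 4) * a 3 - (2 * (w + 2) + 2) * a 2 - (w * (w - 1) + 4 * w + 2) * a 0)"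
    unfolding id unfolding mult.assoc fa[symmetric] f8(1-8) by algebra
  finally show ?thesis using pos by (simp only: mult_cancel_left) simp
qed

lemma acts_coeff_trivial_values:
  "acts_coeff True 0 = 1" "acts_coeff True 1 = 1" "acts_coeff True 2 = 1" "acts_coeff True 3 = 2"
  "acts_coeff True 4 = 15 / 4" "acts_coeff True 5 = 91 / 20" "acts_coeff True 6 = 171 / 20"
  "acts_coeff True 7 = 2262 / 140" "acts_coeff True 8 = 942012 / 40320"
proof -
  have I: "invols 2 = 2" "invols 3 = 4" "invols 4 = 10" "invols 5 = 26" "invols 6 = 76" "invols 7 = 232" "invols 8 = 764"
    using invols_rec(1,2) invols_rec(3)[of 0] invols_rec(3)[of 1] invols_rec(3)[of 2] invols_rec(3)[of 3]
      invols_rec(3)[of 4] invols_rec(3)[of 5] invols_rec(3)[of 6]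
    by (simp_all add: numeral_eq_Suc)
  have J: "cubes 3 = 3" "cubes 4 = 9" "cubes 5 = 21" "cubes 6 = 81" "cubes 7 = 351" "cubes 8 = 1233"
    using cubes_rec(1-3) cubes_rec(4)[of 0] cubes_rec(4)[of 1] cubes_rec(4)[of 2] cubes_rec(4)[of 3]
      cubes_rec(4)[of 4] cubes_rec(4)[of 5]
    by (simp_all add: numeral_eq_Suc)
  have "acts_coeff True n = invols n * cubes n / fact n" for n
    using acts_coeff_trivial[of n] by (simp add: field_simps)
  note * = this
  show "acts_coeff True 0 = 1" "acts_coeff True 1 = 1" "acts_coeff True 2 = 1" "acts_coeff True 3 = 2"
    "acts_coeff True 4 = 15 / 4" "acts_coeff True 5 = 91 / 20" "acts_coeff True 6 = 171 / 20"
    "acts_coeff True 7 = 2262 / 140" "acts_coeff True 8 = 942012 / 40320"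
    unfolding * I J invols_rec(1,2) cubes_rec(1-3) by (simp_all add: fact_numeral)
qed

subsection \<open>Actions with fixed point free central element\<close>

text \<open>The number of square roots, with cycles of length 3 and 6, of a fixed product of
  \<open>m\<close> disjoint 3-cycles: it is the quotient of \<open>cyc_coeff {3, 6}\<close> by
  \<open>cyc_coeff {3}\<close> at \<open>3 * m\<close>. A single 3-cycle has one square root on its
  own points, and two 3-cycles interleave to a 6-cycle in three ways. These are involutions on
  \<open>m\<close> points with weight 3 for each transposition.\<close>

definition weighted_invols :: "nat \<Rightarrow> real" where
  "weighted_invols m = 3 ^ m * fact m * cyc_coeff {3, 6} (3 * m)"

lemma weighted_invols_rec: "weighted_invols 0 = 1" "weighted_invols 1 = 1"
  "weighted_invols (m + 2) = weighted_invols (m + 1) + 3 * (real m + 1) * weighted_invols m"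
proof -
  have "{3, 6} \<inter> {1..3 * (m + 2)} = {3, 6 :: nat}" by auto
  then have r: "real (3 * (m + 2)) * cyc_coeff {3, 6} (3 * (m + 2)) = cyc_coeff {3, 6} (3 * (m + 1)) + cyc_coeff {3, 6} (3 * m)"
    using cyc_coeff_recurrence[of "3 * (m + 2)" "{3, 6}"] by simp
  have "weighted_invols (m + 2) = 3 ^ (m + 1) * fact (m + 1) * (real (3 * (m + 2)) * cyc_coeff {3, 6} (3 * (m + 2)))"
    by (simp add: weighted_invols_def algebra_simps)
  also have "\<dots> = weighted_invols (m + 1) + 3 * (real m + 1) * weighted_invols m"
    unfolding r by (simp add: weighted_invols_def algebra_simps)
  finally show "weighted_invols (m + 2) = weighted_invols (m + 1) + 3 * (real m + 1) * weighted_invols m" .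
  have "{3, 6} \<inter> {1..3} = {3 :: nat}" by auto
  then show "weighted_invols 1 = 1" using cyc_coeff_recurrence[of 3 "{3, 6}"] by (simp add: weighted_invols_def)
qed (simp add: weighted_invols_def)

text \<open>These are the coefficients of \<open>exp (X^d / d)\<close>.\<close>

lemma cyc_coeff_single:
  assumes "d \<ge> 1"
  shows "cyc_coeff {d} (d * k) = 1 / (real d ^ k * fact k)" and "\<not> d dvd n \<Longrightarrow> cyc_coeff {d} n = 0"
proof -
  show "cyc_coeff {d} (d * k) = 1 / (real d ^ k * fact k)"
  proof (induction k)
    case (Suc k)
    have "{d} \<inter> {1..d * Suc k} = {d}" using assms by auto
    then have "real (d * Suc k) * cyc_coeff {d} (d * Suc k) = cyc_coeff {d} (d * k)"
      using cyc_coeff_recurrence[of "d * Suc k" "{d}"] by simp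
    moreover have "real (d * Suc k) \<noteq> 0" using assms by (simp del: of_nat_mult mult_Suc_right)
    ultimately have "cyc_coeff {d} (d * Suc k) = cyc_coeff {d} (d * k) / real (d * Suc k)"
      by (metis nonzero_mult_div_cancel_left)
    then show ?case unfolding Suc.IH by (simp add: algebra_simps)
  qed simp
  show "cyc_coeff {d} n = 0" if "\<not> d dvd n"
    using that
  proof (induction n rule: less_induct)
    case (less n)
    have n: "n > 0" using less.prems by (cases n) auto
    show ?case
    proof (cases "d \<le> n")
      case True
      then have "{d} \<inter> {1..n} = {d}" using assms by auto
      moreover have "cyc_coeff {d} (n - d) = 0" using less True assms n by (simp add: dvd_minus_self)
      ultimately show ?thesis using cyc_coeff_recurrence[of n "{d}"] n by simp
    next
      case False
      then have "{d} \<inter> {1..n} = {}" by auto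
      then show ?thesis using cyc_coeff_recurrence[of n "{d}"] n by simp
    qed
  qed
qed

text \<open>In such an action \<open>y\<close> has cycles of length 9 only.\<close>

lemma acts_coeff_free_zero:
  assumes "\<not> 9 dvd n" shows "acts_coeff False n = 0" "kind_subgroups False n = 0"
proof -
  have "cyc_perms {9} {..<n} = {}"
    using cyc_coeff_single(2)[of 9 n] assms finite_cyc_perms[of "{..<n}" "{9}"] by (simp add: cyc_coeff_def)
  then have "acts (gamma_rel False) {..<n} = {}"
    using cyc_perms_iff_power(5)[of "{..<n}"] by (fastforce simp: acts_def gamma_rel_def)
  then show "acts_coeff False n = 0" "kind_subgroups False n = 0"
    by (simp_all add: acts_coeff_def kind_subgroups_def conn_acts_def)
qed

lemma acts_coeff_free: "acts_coeff False (9 * k) = weighted_invols (3 * k) / (9 ^ k * fact k)"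
proof -
  have "acts_coeff False n * cyc_coeff {3} n = cyc_coeff {3, 6} n * cyc_coeff {9} n" for n
    using arg_cong[OF card_acts_central_free[of "{..<n}"], of real]
    by (simp add: acts_coeff_def cyc_coeff_def)
  from this[of "9 * k"] have "acts_coeff False (9 * k) * (1 / (3 ^ (3 * k) * fact (3 * k))) =
      cyc_coeff {3, 6} (9 * k) * (1 / (9 ^ k * fact k))"
    using cyc_coeff_single(1)[of 3 "3 * k"] cyc_coeff_single(1)[of 9 k] by simp
  then show ?thesis by (simp add: weighted_invols_def field_simps)
qed

text \<open>Only every third term of the sequence is needed, since \<open>acts_coeff_free\<close>
  evaluates it at \<open>3 * k\<close>. Everything reduces to \<open>L0\<close> and
  \<open>L1\<close>. The factors \<open>9 * (k+2)\<close> and \<open>81 * (k+2) * (k+1)\<close> are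
  quotients of the numbers \<open>9^k * k!\<close> by which the terms are divided later.\<close>

lemma weighted_invols_identity:
  fixes k :: real
  assumes "L2 = L1 + 3 * (3*k+1) * L0" "L3 = L2 + 3 * (3*k+2) * L1" "L4 = L3 + 3 * (3*k+3) * L2"
    "L5 = L4 + 3 * (3*k+4) * L3" "L6 = L5 + 3 * (3*k+5) * L4" "L7 = L6 + 3 * (3*k+6) * L5"
    "L8 = L7 + 3 * (3*k+7) * L6" "L9 = L8 + 3 * (3*k+8) * L7"
  shows "L9 = (36 * (k+2) + 10) * L6 + (81*(k+1)*k + 216*(k+1) + 44) * 9 * (k+2) * L3
    - (81*k*(k-1) + 162*k + 18) * 81 * (k+2) * (k+1) * L0"
  unfolding assms by algebra

lemma acts_coeff_free_recurrence:
  fixes k :: nat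
  defines "w \<equiv> real k" and "g \<equiv> (\<lambda>i. acts_coeff False (9 * (k + i)))"
  shows "9 * (w + 3) * g 3 = (36 * (w + 2) + 10) * g 2 + (81 * (w + 1) * w + 216 * (w + 1) + 44) * g 1
    - (81 * w * (w - 1) + 162 * w + 18) * g 0"
proof -
  define L where "L = (\<lambda>i. weighted_invols (3 * k + i))"
  define f where "f = (\<lambda>i. 9 ^ (k + i) * fact (k + i) :: real)"
  have L: "L (i + 2) = L (i + 1) + 3 * (3 * w + real i + 1) * L i" for i
    using weighted_invols_rec(3)[of "3 * k + i"] by (simp add: L_def w_def algebra_simps)
  have f: "f 3 = 9 * (w + 3) * f 2" "f 2 = 9 * (w + 2) * f 1" "f 1 = 9 * (w + 1) * f 0"
    by (simp_all add: f_def w_def numeral_eq_Suc algebra_simps)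
  have fg: "f i * g i = L (3 * i)" for i
    unfolding f_def g_def L_def acts_coeff_free by (simp add: distrib_left)
  have fg': "f 0 * g 0 = L 0" "f 1 * g 1 = L 3" "f 2 * g 2 = L 6" "f 3 * g 3 = L 9"
    using fg[of 0] fg[of 1] fg[of 2] fg[of 3] by simp_all
  have pos: "f 2 \<noteq> 0" by (simp add: f_def)
  have id: "L 9 = (36 * (w+2) + 10) * L 6 + (81*(w+1)*w + 216*(w+1) + 44) * 9 * (w+2) * L 3
    - (81*w*(w-1) + 162*w + 18) * 81 * (w+2) * (w+1) * L 0"
    using L[of 0] L[of 1] L[of 2] L[of 3] L[of 4] L[of 5] L[of 6] L[of 7]
    by (intro weighted_invols_identity) (simp_all add: numeral_eq_Suc, simp_all add: algebra_simps)
  have "f 2 * (9 * (w + 3) * g 3) = L 9" using fg'(4) by (simp add: f(1) mult_ac)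
  also have "\<dots> = f 2 * ((36 * (w + 2) + 10) * g 2 + (81 * (w + 1) * w + 216 * (w + 1) + 44) * g 1
    - (81 * w * (w - 1) + 162 * w + 18) * g 0)"
    unfolding id fg'[symmetric] f(2,3) by algebra
  finally show ?thesis using pos by (simp only: mult_cancel_left) simp
qed

lemma acts_coeff_free_values:
  "acts_coeff False 0 = 1" "acts_coeff False 9 = 10 / 9" "acts_coeff False 18 = 856 / 162"
proof -
  have "weighted_invols 2 = 4" "weighted_invols 3 = 10" "weighted_invols 4 = 46" "weighted_invols 5 = 166"
    "weighted_invols 6 = 856"
    using weighted_invols_rec(1,2) weighted_invols_rec(3)[of 0] weighted_invols_rec(3)[of 1]
      weighted_invols_rec(3)[of 2] weighted_invols_rec(3)[of 3] weighted_invols_rec(3)[of 4]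
    by (simp_all add: numeral_eq_Suc)
  then show "acts_coeff False 0 = 1" "acts_coeff False 9 = 10 / 9" "acts_coeff False 18 = 856 / 162"
    using acts_coeff_free[of 0] acts_coeff_free[of 1] acts_coeff_free[of 2] weighted_invols_rec(1)
    by (simp_all add: fact_numeral)
qed

unbundle fps_syntax

subsection \<open>Riccati equations\<close>

text \<open>Carries the equation for the integral series \<open>H'/H\<close> to the reals, where the
  factor \<open>H\<close> with its fractional coefficients can be cancelled, and back.\<close>

definition fps_of_ints :: "int fps \<Rightarrow> real fps" where
  "fps_of_ints f = Abs_fps (\<lambda>n. of_int (f $ n))"

lemma fps_of_ints_nth [simp]: "fps_of_ints f $ n = of_int (f $ n)"
  by (simp add: fps_of_ints_def)

lemma fps_of_ints_inj: "fps_of_ints f = fps_of_ints g \<Longrightarrow> f = g"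
  by (simp add: fps_eq_iff)

lemma fps_of_ints_mult: "fps_of_ints (f * g) = fps_of_ints f * fps_of_ints g"
  by (simp add: fps_eq_iff fps_mult_nth)

lemma fps_of_ints_add: "fps_of_ints (f + g) = fps_of_ints f + fps_of_ints g"
  by (simp add: fps_eq_iff)

lemma fps_of_ints_diff: "fps_of_ints (f - g) = fps_of_ints f - fps_of_ints g"
  by (simp add: fps_eq_iff)

lemma fps_of_ints_deriv: "fps_of_ints (fps_deriv f) = fps_deriv (fps_of_ints f)"
  by (simp add: fps_eq_iff)

lemma fps_of_ints_one: "fps_of_ints 1 = 1"
  by (simp add: fps_eq_iff)

lemma fps_of_ints_numeral: "fps_of_ints (numeral k) = numeral k"
  by (simp add: fps_eq_iff fps_numeral_nth)

lemma fps_of_ints_X: "fps_of_ints fps_X = fps_X"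
  by (simp add: fps_eq_iff fps_X_def)

lemma fps_of_ints_power: "fps_of_ints (f ^ k) = fps_of_ints f ^ k"
  by (induction k) (simp_all add: fps_of_ints_one fps_of_ints_mult)

lemmas fps_of_ints_hom = fps_of_ints_mult fps_of_ints_add fps_of_ints_diff fps_of_ints_deriv
  fps_of_ints_one fps_of_ints_numeral fps_of_ints_X fps_of_ints_power

text \<open>This is \<open>H'/H\<close>, so the coefficient of \<open>X^n\<close> belongs to index
  \<open>n + 1\<close>.\<close>

definition trivial_fps :: "int fps" where
  "trivial_fps = Abs_fps (\<lambda>n. int (kind_subgroups True (n + 1)))"

text \<open>All indices are multiples of 9, so the series is written in a variable that stands for
  \<open>X^9\<close>; the coefficient at \<open>n\<close> belongs to index
  \<open>9 * (n + 1)\<close>.\<close>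

definition free_fps :: "int fps" where
  "free_fps = Abs_fps (\<lambda>n. int (kind_subgroups False (9 * (n + 1))))"

lemma trivial_fps_log_deriv:
  "fps_deriv (Abs_fps (acts_coeff True)) = fps_of_ints trivial_fps * Abs_fps (acts_coeff True)"
proof (rule fps_ext)
  fix n
  have "fps_deriv (Abs_fps (acts_coeff True)) $ n = real (n + 1) * acts_coeff True (n + 1)" by simp
  also have "\<dots> = (\<Sum>k = 0..n. real (kind_subgroups True (k + 1)) * acts_coeff True (n - k))"
    unfolding acts_coeff_recurrence by (rule sum.reindex_bij_witness[of _ "\<lambda>k. k + 1" "\<lambda>m. m - 1"]) auto
  finally show "fps_deriv (Abs_fps (acts_coeff True)) $ n = (fps_of_ints trivial_fps * Abs_fps (acts_coeff True)) $ n"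
    by (simp add: fps_mult_nth trivial_fps_def)
qed

text \<open>The factor 9 arises from the change of variable: for \<open>Z = X^9\<close>, the
  operator \<open>X d/dX\<close> becomes \<open>9 Z d/dZ\<close>.\<close>

lemma free_fps_log_deriv:
  defines "G \<equiv> Abs_fps (\<lambda>k. acts_coeff False (9 * k))"
  shows "9 * fps_deriv G = fps_of_ints free_fps * G"
proof (rule fps_ext)
  fix n
  let ?h = "\<lambda>k. 9 * (k + 1) :: nat"
  have "(9 * fps_deriv G) $ n = real (9 * (n + 1)) * acts_coeff False (9 * (n + 1))"
    by (simp add: G_def numeral_fps_const)
  also have "\<dots> = (\<Sum>m = 1..9 * (n + 1). real (kind_subgroups False m) * acts_coeff False (9 * (n + 1) - m))"
    by (rule acts_coeff_recurrence)
  also have "\<dots> = (\<Sum>m\<in>?h ` {0..n}. real (kind_subgroups False m) * acts_coeff False (9 * (n + 1) - m))"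
  proof (rule sum.mono_neutral_right)
    show "\<forall>m\<in>{1..9 * (n + 1)} - ?h ` {0..n}. real (kind_subgroups False m) * acts_coeff False (9 * (n + 1) - m) = 0"
    proof
      fix m assume m: "m \<in> {1..9 * (n + 1)} - ?h ` {0..n}"
      have "\<not> 9 dvd m"
      proof
        assume "9 dvd m"
        then obtain q where q: "m = 9 * q" by blast
        with m have "q \<noteq> 0" "q \<le> n + 1" by auto
        with q have "m = ?h (q - 1)" "q - 1 \<in> {0..n}" by auto
        with m show False by blast
      qed
      then show "real (kind_subgroups False m) * acts_coeff False (9 * (n + 1) - m) = 0"
        by (simp add: acts_coeff_free_zero)
    qed
  qed auto
  also have "\<dots> = (\<Sum>k = 0..n. real (kind_subgroups False (9 * (k + 1))) * acts_coeff False (9 * (n - k)))"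
    by (subst sum.reindex) (auto intro!: inj_onI sum.cong simp: right_diff_distrib')
  finally show "(9 * fps_deriv G) $ n = (fps_of_ints free_fps * G) $ n"
    by (simp add: fps_mult_nth free_fps_def G_def)
qed

text \<open>The recurrence read as an equation of series: multiplying the coefficient at
  \<open>w\<close> by \<open>w * (w - 1)\<close>, by \<open>w\<close> or by 1 corresponds to
  \<open>X^2 * H''\<close>, \<open>X * H'\<close> and \<open>H\<close>. This is why its quadratic
  factors are left in the form \<open>w * (w - 1) + 4 * w + 2\<close>.\<close>

lemma trivial_ode:
  defines "H \<equiv> Abs_fps (acts_coeff True)"
  shows "(fps_X ^ 10 - fps_X ^ 7) * fps_deriv (fps_deriv H)
    + (1 - 4 * fps_X ^ 3 - 2 * fps_X ^ 4 - 4 * fps_X ^ 6 + 2 * fps_X ^ 7 + 4 * fps_X ^ 9) * fps_deriv H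
    = (1 + fps_X ^ 1 + 4 * fps_X ^ 2 + 4 * fps_X ^ 3 - fps_X ^ 4 + 4 * fps_X ^ 5 - 2 * fps_X ^ 6 - 2 * fps_X ^ 8) * H"
proof (rule fps_ext)
  fix n
  have nth: "((fps_X ^ 10 - fps_X ^ 7) * fps_deriv (fps_deriv H)
    + (1 - 4 * fps_X ^ 3 - 2 * fps_X ^ 4 - 4 * fps_X ^ 6 + 2 * fps_X ^ 7 + 4 * fps_X ^ 9) * fps_deriv H) $ n =
     (fps_X ^ 10 * fps_deriv (fps_deriv H)) $ n - (fps_X ^ 7 * fps_deriv (fps_deriv H)) $ n
    + fps_deriv H $ n - 4 * (fps_X ^ 3 * fps_deriv H) $ n - 2 * (fps_X ^ 4 * fps_deriv H) $ n
    - 4 * (fps_X ^ 6 * fps_deriv H) $ n + 2 * (fps_X ^ 7 * fps_deriv H) $ n + 4 * (fps_X ^ 9 * fps_deriv H) $ n"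
    "((1 + fps_X ^ 1 + 4 * fps_X ^ 2 + 4 * fps_X ^ 3 - fps_X ^ 4 + 4 * fps_X ^ 5 - 2 * fps_X ^ 6 - 2 * fps_X ^ 8) * H) $ n
    = H $ n + (fps_X ^ 1 * H) $ n + 4 * (fps_X ^ 2 * H) $ n + 4 * (fps_X ^ 3 * H) $ n - (fps_X ^ 4 * H) $ n
     + 4 * (fps_X ^ 5 * H) $ n - 2 * (fps_X ^ 6 * H) $ n - 2 * (fps_X ^ 8 * H) $ n"
    by (simp_all only: numeral_fps_const distrib_right left_diff_distrib fps_add_nth fps_sub_nth mult.assoc
        fps_mult_left_const_nth mult_1_left)
  show "((fps_X ^ 10 - fps_X ^ 7) * fps_deriv (fps_deriv H)
    + (1 - 4 * fps_X ^ 3 - 2 * fps_X ^ 4 - 4 * fps_X ^ 6 + 2 * fps_X ^ 7 + 4 * fps_X ^ 9) * fps_deriv H) $ n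
    = ((1 + fps_X ^ 1 + 4 * fps_X ^ 2 + 4 * fps_X ^ 3 - fps_X ^ 4 + 4 * fps_X ^ 5 - 2 * fps_X ^ 6 - 2 * fps_X ^ 8) * H) $ n"
  \<comment> \<open>The recurrence at \<open>j\<close> is the equation at exponent
    \<open>j + 8\<close>. Below 10 some of the shifted terms vanish, and explicit values are
    needed.\<close>
  proof (cases "n < 10")
    case True
    then have "n = 0 \<or> n = 1 \<or> n = 2 \<or> n = 3 \<or> n = 4 \<or> n = 5 \<or> n = 6 \<or> n = 7 \<or> n = 8 \<or> n = 9" by arith
    then show ?thesis
      unfolding nth unfolding fps_X_power_mult_nth fps_deriv_nth H_def fps_nth_Abs_fps
      using acts_coeff_trivial_values acts_coeff_trivial_recurrence[of 0] acts_coeff_trivial_recurrence[of 1]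
      by (elim disjE) (simp_all add: numeral_eq_Suc)
  next
    case False
    then obtain j where n: "n = j + 10" by (metis add.commute le_Suc_ex not_less)
    show ?thesis
      unfolding nth unfolding fps_X_power_mult_nth fps_deriv_nth H_def fps_nth_Abs_fps
      unfolding n using acts_coeff_trivial_recurrence[of "j + 2"]
      by (simp add: algebra_simps numeral_eq_Suc)
  qed
qed

lemma free_ode:
  defines "G \<equiv> Abs_fps (\<lambda>k. acts_coeff False (9 * k))"
  shows "81 * ((fps_X ^ 4 - fps_X ^ 3) * fps_deriv (fps_deriv G))
    + 9 * ((1 - 4 * fps_X ^ 1 - 24 * fps_X ^ 2 + 18 * fps_X ^ 3) * fps_deriv G)
    = (10 + 44 * fps_X ^ 1 - 18 * fps_X ^ 2) * G"
proof (rule fps_ext)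
  fix n
  have nth: "(81 * ((fps_X ^ 4 - fps_X ^ 3) * fps_deriv (fps_deriv G))
    + 9 * ((1 - 4 * fps_X ^ 1 - 24 * fps_X ^ 2 + 18 * fps_X ^ 3) * fps_deriv G)) $ n =
     81 * ((fps_X ^ 4 * fps_deriv (fps_deriv G)) $ n - (fps_X ^ 3 * fps_deriv (fps_deriv G)) $ n)
    + 9 * (fps_deriv G $ n - 4 * (fps_X ^ 1 * fps_deriv G) $ n - 24 * (fps_X ^ 2 * fps_deriv G) $ n
    + 18 * (fps_X ^ 3 * fps_deriv G) $ n)"
    "((10 + 44 * fps_X ^ 1 - 18 * fps_X ^ 2) * G) $ n
    = 10 * G $ n + 44 * (fps_X ^ 1 * G) $ n - 18 * (fps_X ^ 2 * G) $ n"
    by (simp_all only: numeral_fps_const distrib_right left_diff_distrib fps_add_nth fps_sub_nth mult.assoc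
        fps_mult_left_const_nth mult_1_left)
  show "(81 * ((fps_X ^ 4 - fps_X ^ 3) * fps_deriv (fps_deriv G))
    + 9 * ((1 - 4 * fps_X ^ 1 - 24 * fps_X ^ 2 + 18 * fps_X ^ 3) * fps_deriv G)) $ n
    = ((10 + 44 * fps_X ^ 1 - 18 * fps_X ^ 2) * G) $ n"
  proof (cases "n < 2")
    case True
    then have "n = 0 \<or> n = 1" by arith
    then show ?thesis
      unfolding nth unfolding fps_X_power_mult_nth fps_deriv_nth G_def fps_nth_Abs_fps
      using acts_coeff_free_values by (elim disjE) simp_all
  next
    case False
    then obtain j where n: "n = j + 2" by (metis add.commute le_Suc_ex not_less)
    define g where "g = (\<lambda>k. acts_coeff False (9 * k))"
    have rec: "9 * (real j + 3) * g (j + 3) = (36 * (real j + 2) + 10) * g (j + 2)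
      + (81 * (real j + 1) * real j + 216 * (real j + 1) + 44) * g (j + 1)
      - (81 * real j * (real j - 1) + 162 * real j + 18) * g j"
      using acts_coeff_free_recurrence[of j] by (simp add: g_def)
    \<comment> \<open>For \<open>j < 2\<close> the exponent \<open>n\<close> is below 4, where terms
      multiplied by \<open>X^4\<close> or \<open>X^3\<close> may vanish.\<close>
    have "j = 0 \<or> j = 1 \<or> (\<exists>i. j = i + 2)" by presburger
    then show ?thesis
      unfolding nth unfolding fps_X_power_mult_nth fps_deriv_nth G_def fps_nth_Abs_fps g_def[symmetric]
      unfolding n using rec by (elim disjE exE) (simp_all add: algebra_simps numeral_eq_Suc)
  qed
qed

text \<open>For \<open>S = H'/H\<close> one has \<open>H'' = (S' + S^2) * H\<close>, so the linear
  equation can be divided by \<open>H\<close>, which has constant term 1.\<close>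

theorem trivial_riccati:
  "(fps_X ^ 10 - fps_X ^ 7) * (fps_deriv trivial_fps + trivial_fps ^ 2)
    + (1 - 4 * fps_X ^ 3 - 2 * fps_X ^ 4 - 4 * fps_X ^ 6 + 2 * fps_X ^ 7 + 4 * fps_X ^ 9) * trivial_fps
    = 1 + fps_X ^ 1 + 4 * fps_X ^ 2 + 4 * fps_X ^ 3 - fps_X ^ 4 + 4 * fps_X ^ 5 - 2 * fps_X ^ 6 - 2 * fps_X ^ 8"
proof (rule fps_of_ints_inj)
  define H where "H = Abs_fps (acts_coeff True)"
  define S where "S = fps_of_ints trivial_fps"
  have d: "fps_deriv H = S * H" unfolding H_def S_def by (rule trivial_fps_log_deriv)
  have dd: "fps_deriv (fps_deriv H) = (fps_deriv S + S ^ 2) * H"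
    unfolding d fps_deriv_mult by (simp add: d algebra_simps power2_eq_square)
  have "H $ 0 \<noteq> 0" using acts_coeff_trivial_values(1) by (simp add: H_def)
  then have "H \<noteq> 0" by auto
  moreover have "((fps_X ^ 10 - fps_X ^ 7) * (fps_deriv S + S ^ 2)
    + (1 - 4 * fps_X ^ 3 - 2 * fps_X ^ 4 - 4 * fps_X ^ 6 + 2 * fps_X ^ 7 + 4 * fps_X ^ 9) * S) * H
    = (1 + fps_X ^ 1 + 4 * fps_X ^ 2 + 4 * fps_X ^ 3 - fps_X ^ 4 + 4 * fps_X ^ 5 - 2 * fps_X ^ 6 - 2 * fps_X ^ 8) * H"
    using trivial_ode[folded H_def, unfolded dd, unfolded d] by (simp only: distrib_right[of _ _ H] mult.assoc)
  ultimately show "fps_of_ints ((fps_X ^ 10 - fps_X ^ 7) * (fps_deriv trivial_fps + trivial_fps ^ 2)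
    + (1 - 4 * fps_X ^ 3 - 2 * fps_X ^ 4 - 4 * fps_X ^ 6 + 2 * fps_X ^ 7 + 4 * fps_X ^ 9) * trivial_fps) =
    fps_of_ints (1 + fps_X ^ 1 + 4 * fps_X ^ 2 + 4 * fps_X ^ 3 - fps_X ^ 4 + 4 * fps_X ^ 5 - 2 * fps_X ^ 6 - 2 * fps_X ^ 8)"
    unfolding fps_of_ints_hom S_def[symmetric] by (metis mult_right_cancel)
qed

text \<open>As in \<open>trivial_riccati\<close>, but now \<open>U = 9 * G'/G\<close>, hence
  \<open>81 * G'' = (9 * U' + U^2) * G\<close> with a 9 at the derivative only.\<close>

theorem free_riccati:
  "(fps_X ^ 4 - fps_X ^ 3) * (9 * fps_deriv free_fps + free_fps ^ 2)
    + (1 - 4 * fps_X ^ 1 - 24 * fps_X ^ 2 + 18 * fps_X ^ 3) * free_fps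
    = 10 + 44 * fps_X ^ 1 - 18 * fps_X ^ 2"
proof (rule fps_of_ints_inj)
  define G where "G = Abs_fps (\<lambda>k. acts_coeff False (9 * k))"
  define U where "U = fps_of_ints free_fps"
  have d: "9 * fps_deriv G = U * G" unfolding G_def U_def by (rule free_fps_log_deriv)
  have "81 * fps_deriv (fps_deriv G) = 9 * fps_deriv (9 * fps_deriv G)"
    by (simp add: numeral_fps_const)
  also have "\<dots> = 9 * fps_deriv (U * G)" unfolding d ..
  also have "\<dots> = 9 * fps_deriv U * G + U * (9 * fps_deriv G)"
    by (simp add: algebra_simps)
  also have "\<dots> = 9 * fps_deriv U * G + U * (U * G)"
    unfolding d ..
  finally have dd: "81 * fps_deriv (fps_deriv G) = (9 * fps_deriv U + U ^ 2) * G"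
    by (simp add: algebra_simps power2_eq_square)
  have "G $ 0 \<noteq> 0" using acts_coeff_free_values(1) by (simp add: G_def)
  then have "G \<noteq> 0" by auto
  moreover have "((fps_X ^ 4 - fps_X ^ 3) * (9 * fps_deriv U + U ^ 2)
    + (1 - 4 * fps_X ^ 1 - 24 * fps_X ^ 2 + 18 * fps_X ^ 3) * U) * G
    = (10 + 44 * fps_X ^ 1 - 18 * fps_X ^ 2) * G"
  proof -
    have "((fps_X ^ 4 - fps_X ^ 3) * (9 * fps_deriv U + U ^ 2)
      + (1 - 4 * fps_X ^ 1 - 24 * fps_X ^ 2 + 18 * fps_X ^ 3) * U) * G
      = (fps_X ^ 4 - fps_X ^ 3) * ((9 * fps_deriv U + U ^ 2) * G)
      + (1 - 4 * fps_X ^ 1 - 24 * fps_X ^ 2 + 18 * fps_X ^ 3) * (U * G)"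
      by (simp only: distrib_right[of _ _ G] mult.assoc)
    also have "\<dots> = (10 + 44 * fps_X ^ 1 - 18 * fps_X ^ 2) * G"
      unfolding dd[symmetric] d[symmetric] free_ode[folded G_def, symmetric] by (simp only: mult.left_commute)
    finally show ?thesis .
  qed
  ultimately show "fps_of_ints ((fps_X ^ 4 - fps_X ^ 3) * (9 * fps_deriv free_fps + free_fps ^ 2)
    + (1 - 4 * fps_X ^ 1 - 24 * fps_X ^ 2 + 18 * fps_X ^ 3) * free_fps)
    = fps_of_ints (10 + 44 * fps_X ^ 1 - 18 * fps_X ^ 2)"
    unfolding fps_of_ints_hom U_def[symmetric] by (metis mult_right_cancel)
qed

subsection \<open>Solving the Riccati equations modulo 8\<close>

lemma fps_int_dvd_iff: "(of_int m :: int fps) dvd f \<longleftrightarrow> (\<forall>n. m dvd f $ n)"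
proof
  assume "of_int m dvd f"
  then obtain g where "f = of_int m * g" by (elim dvdE)
  then show "\<forall>n. m dvd f $ n" by (simp flip: fps_of_int)
next
  assume "\<forall>n. m dvd f $ n"
  then have "f = of_int m * Abs_fps (\<lambda>n. f $ n div m)"
    by (simp add: fps_eq_iff flip: fps_of_int)
  then show "of_int m dvd f" by (metis dvd_triv_left)
qed

text \<open>Meant for the difference \<open>D\<close> of two solutions modulo \<open>m\<close>, with
  \<open>E\<close> their sum, as \<open>S^2 - V^2 = (S - V) * (S + V)\<close>. The derivative lowers
  exponents by one and \<open>X^2\<close> raises them by two, so at exponent \<open>n\<close> all
  terms but \<open>D $ n\<close> involve earlier coefficients of \<open>D\<close>.\<close>

lemma riccati_difference_dvd:
  fixes D :: "int fps"
  assumes "of_int m dvd fps_X ^ 2 * a * (k * fps_deriv D + D * E) + (1 + fps_X * b) * D"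
  shows "of_int m dvd D"
  unfolding fps_int_dvd_iff
proof
  fix n
  show "m dvd D $ n"
  proof (induction n rule: less_induct)
    case (less n)
    have conv: "m dvd (f * g) $ j" if "\<And>i. i \<le> j \<Longrightarrow> m dvd g $ i" for f g :: "int fps" and j
      unfolding fps_mult_nth using that by (intro dvd_sum dvd_mult) auto
    have 1: "m dvd (fps_X ^ 2 * (a * (k * fps_deriv D + E * D))) $ n"
    proof -
      have "m dvd (a * (k * fps_deriv D + E * D)) $ (n - 2)" if n: "n \<ge> 2"
      proof (rule conv)
        fix i assume i: "i \<le> n - 2"
        have "m dvd (k * fps_deriv D) $ i"
        proof (rule conv)
          fix j assume "j \<le> i"
          then have "j + 1 < n" using i n by linarith
          then show "m dvd fps_deriv D $ j" using less by simp
        qed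
        moreover have "m dvd (E * D) $ i" using i n by (intro conv less) linarith
        ultimately show "m dvd (k * fps_deriv D + E * D) $ i" by simp
      qed
      then show ?thesis by (simp add: fps_X_power_mult_nth)
    qed
    have 2: "m dvd (fps_X * (b * D)) $ n"
    proof (cases n)
      case (Suc j)
      then show ?thesis using less by (auto intro!: conv)
    qed simp
    have "fps_X ^ 2 * a * (k * fps_deriv D + D * E) + (1 + fps_X * b) * D =
        fps_X ^ 2 * (a * (k * fps_deriv D + E * D)) + (D + fps_X * (b * D))"
      by (simp add: algebra_simps)
    with assms have "m dvd (fps_X ^ 2 * (a * (k * fps_deriv D + E * D))) $ n + (D $ n + (fps_X * (b * D)) $ n)"
      unfolding fps_int_dvd_iff by (metis fps_add_nth)
    with 1 2 show "m dvd D $ n" by (simp add: dvd_add_right_iff dvd_add_left_iff)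
  qed
qed

text \<open>The coefficient at \<open>k\<close> is the contribution, modulo 8, of the subgroups of
  index \<open>9 * (k + 1)\<close> without the central element; degree 6 means that none remains
  beyond index 63.\<close>

definition free_solution :: "int fps" where
  "free_solution = 2 + 4 * fps_X ^ 1 + 6 * fps_X ^ 2 + 4 * fps_X ^ 3 + 4 * fps_X ^ 4 + 4 * fps_X ^ 5 + 4 * fps_X ^ 6"

lemma free_fps_mod_8: "[free_fps $ n = free_solution $ n] (mod 8)"
proof -
  define x where "x = (fps_X :: int fps)"
  define U where "U = free_fps"
  define V where "V = free_solution"
  have V: "V = 2 + 4 * x ^ 1 + 6 * x ^ 2 + 4 * x ^ 3 + 4 * x ^ 4 + 4 * x ^ 5 + 4 * x ^ 6" by (simp add: V_def free_solution_def x_def)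
  have V': "fps_deriv V = 4 + 12 * x ^ 1 + 12 * x ^ 2 + 16 * x ^ 3 + 20 * x ^ 4 + 24 * x ^ 5"
    by (simp add: V x_def fps_deriv_power flip: numeral_fps_const)
  \<comment> \<open>The factor of 8 on the right is the explicit error of the polynomial
    \<open>V\<close> in the equation, found by expanding.\<close>
  have sol: "(x ^ 4 - x ^ 3) * (9 * fps_deriv V + V ^ 2) + (1 - 4 * x ^ 1 - 24 * x ^ 2 + 18 * x ^ 3) * V
      = 10 + 44 * x ^ 1 - 18 * x ^ 2 + 8 * (0 - 1 - 6 * x ^ 1 - 5 * x ^ 2 - 15 * x ^ 3 - 21 * x ^ 4
          - 3 * x ^ 5 - 12 * x ^ 6 - 12 * x ^ 7 - 9 * x ^ 8 + 34 * x ^ 9 + 2 * x ^ 11 + 4 * x ^ 12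
          + 2 * x ^ 13 + 2 * x ^ 14 + 2 * x ^ 15 + 2 * x ^ 16)"
    unfolding V' unfolding V by algebra
  have "x ^ 2 * (x ^ 2 - x) * (9 * fps_deriv (U - V) + (U - V) * (U + V)) + (1 + x * (18 * x ^ 2 - 24 * x - 4)) * (U - V)
      = ((x ^ 4 - x ^ 3) * (9 * fps_deriv U + U ^ 2) + (1 - 4 * x ^ 1 - 24 * x ^ 2 + 18 * x ^ 3) * U)
      - ((x ^ 4 - x ^ 3) * (9 * fps_deriv V + V ^ 2) + (1 - 4 * x ^ 1 - 24 * x ^ 2 + 18 * x ^ 3) * V)"
    unfolding fps_deriv_sub by algebra
  also have "\<dots> = of_int 8 * (- (0 - 1 - 6 * x ^ 1 - 5 * x ^ 2 - 15 * x ^ 3 - 21 * x ^ 4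
      - 3 * x ^ 5 - 12 * x ^ 6 - 12 * x ^ 7 - 9 * x ^ 8 + 34 * x ^ 9 + 2 * x ^ 11 + 4 * x ^ 12
      + 2 * x ^ 13 + 2 * x ^ 14 + 2 * x ^ 15 + 2 * x ^ 16))"
    unfolding sol using free_riccati by (simp add: x_def U_def)
  finally have "of_int 8 dvd U - V"
    unfolding x_def by (metis riccati_difference_dvd dvd_triv_left)
  then show ?thesis by (simp add: fps_int_dvd_iff cong_iff_dvd_diff U_def V_def del: of_int_numeral)
qed

subsection \<open>Binary digit sums\<close>

fun digit_sum :: "nat \<Rightarrow> nat" where
  "digit_sum n = (if n = 0 then 0 else n mod 2 + digit_sum (n div 2))"

declare digit_sum.simps [simp del]

lemma digit_sum_simps [simp]: "digit_sum 0 = 0" "digit_sum (2 * n) = digit_sum n"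
  "digit_sum (Suc (2 * n)) = Suc (digit_sum n)"
  using digit_sum.simps[of 0] digit_sum.simps[of "2 * n"] digit_sum.simps[of "Suc (2 * n)"] by auto

lemma digit_sum_eq_0_iff [simp]: "digit_sum n = 0 \<longleftrightarrow> n = 0"
proof (induction n rule: digit_sum.induct)
  case (1 n)
  have "n = 0 \<or> n mod 2 \<noteq> 0 \<or> n div 2 \<noteq> 0" by presburger
  with 1 show ?case using digit_sum.simps[of n] by (cases "n = 0") auto
qed

section \<open>Substituting powers of X\<close>

definition dilate :: "nat \<Rightarrow> 'a :: comm_ring_1 fps \<Rightarrow> 'a fps" where
  "dilate k f = f oo fps_X ^ k"

lemma dilate_nth:
  assumes "k > 0" shows "dilate k f $ n = (if k dvd n then f $ (n div k) else 0)"
proof -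
  have "dilate k f $ n = (\<Sum>i = 0..n. if n = k * i then f $ i else 0)"
    unfolding dilate_def fps_compose_nth by (intro sum.cong) (auto simp flip: power_mult)
  also have "\<dots> = (if k dvd n then f $ (n div k) else 0)"
  proof (cases "k dvd n")
    case True
    then obtain q where n: "n = k * q" by blast
    have "(\<Sum>i = 0..n. if n = k * i then f $ i else 0) = (\<Sum>i\<in>{q}. f $ i)"
      using assms n by (intro sum.mono_neutral_cong_right) auto
    then show ?thesis using assms n by simp
  next
    case False
    then show ?thesis by (intro trans[OF sum.neutral]) auto
  qed
  finally show ?thesis .
qed

lemma dilate_hom:
  fixes f g :: "'a :: idom fps"
  assumes "k > 0"
  shows "dilate k (f + g) = dilate k f + dilate k g" "dilate k (f - g) = dilate k f - dilate k g"
    "dilate k (f * g) = dilate k f * dilate k g" "dilate k (f ^ j) = dilate k f ^ j"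
    "dilate k (numeral m) = (numeral m :: 'a fps)" "dilate k (1 :: 'a fps) = 1"
    "dilate k (fps_X :: 'a fps) = fps_X ^ k"
proof -
  have 0: "(fps_X ^ k :: 'a fps) $ 0 = 0" using assms by simp
  show "dilate k (f + g) = dilate k f + dilate k g" "dilate k (f - g) = dilate k f - dilate k g"
    "dilate k (f * g) = dilate k f * dilate k g" "dilate k (f ^ j) = dilate k f ^ j"
    "dilate k (numeral m) = (numeral m :: 'a fps)" "dilate k (1 :: 'a fps) = 1"
    "dilate k (fps_X :: 'a fps) = fps_X ^ k"
    using fps_compose_mult_distrib[OF 0] fps_compose_power[OF 0] 0
    by (simp_all add: dilate_def fps_compose_add_distrib fps_compose_sub_distrib)
qed

text \<open>Modulo \<open>m\<close> the hypothesis makes odd coefficients vanish and even ones equal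
  to the coefficient at half the exponent; halving ends at an odd exponent or at 0. The case
  \<open>m = 0\<close> is used to prove equations.\<close>

lemma dvd_of_dilate_difference:
  fixes f :: "int fps"
  assumes "of_int m dvd f - dilate 2 f" "m dvd f $ 0"
  shows "of_int m dvd f"
  unfolding fps_int_dvd_iff
proof
  fix n
  show "m dvd f $ n"
  proof (induction n rule: less_induct)
    case (less n)
    have "m dvd (f - dilate 2 f) $ n" using assms(1) unfolding fps_int_dvd_iff by blast
    then have d: "m dvd f $ n - (if 2 dvd n then f $ (n div 2) else 0)"
      unfolding fps_sub_nth dilate_nth[OF zero_less_numeral] .
    show ?case
    proof (cases "n = 0")
      case False
      then have "m dvd (if 2 dvd n then f $ (n div 2) else 0)" using less by simp
      with d show ?thesis by (metis diff_add_cancel dvd_add)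
    qed (use assms(2) in simp)
  qed
qed

text \<open>The sum of \<open>X^(2^i)\<close>; its square is the sum of \<open>X^(2^(i+1))\<close>
  plus twice the sum of \<open>X^(2^i + 2^j)\<close> over \<open>j < i\<close>, which is
  \<open>\<beta>\<close>.\<close>

definition \<alpha> :: "int fps" where
  "\<alpha> = Abs_fps (\<lambda>n. of_bool (digit_sum n = 1))"

definition \<beta> :: "int fps" where
  "\<beta> = Abs_fps (\<lambda>n. of_bool (digit_sum n = 2))"

text \<open>
  Modulo 2 only the sum of the two series below lies in the ring generated by \<open>X\<close>, \<open>\<alpha>\<close>
  and \<open>\<beta>\<close>.
\<close>

definition \<gamma> :: "int fps" where
  "\<gamma> = Abs_fps (\<lambda>n. of_bool (digit_sum n = 3) + of_bool (\<exists>i. n = 3 * 2 ^ i))"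

lemma fps_even_odd:
  fixes f g h :: "'a :: idom fps"
  assumes "\<And>n. f $ (2 * n) = g $ n" "\<And>n. f $ Suc (2 * n) = h $ n"
  shows "f = dilate 2 g + fps_X * dilate 2 h"
proof (rule fps_ext)
  fix n
  show "f $ n = (dilate 2 g + fps_X * dilate 2 h) $ n"
  proof (cases "even n")
    case True
    then obtain m where "n = 2 * m" by blast
    moreover have "(fps_X * dilate 2 h) $ (2 * m) = 0" by (cases m) (simp_all add: dilate_nth)
    ultimately show ?thesis by (simp add: assms(1) dilate_nth)
  next
    case False
    then obtain m where "n = Suc (2 * m)" by (metis oddE Suc_eq_plus1)
    then show ?thesis by (simp add: assms dilate_nth)
  qed
qed

lemma three_times_power_even_odd:
  "(\<exists>i. 2 * n = 3 * 2 ^ i) \<longleftrightarrow> (\<exists>i. n = 3 * 2 ^ i)" "(\<exists>i. Suc (2 * n) = 3 * 2 ^ i) \<longleftrightarrow> n = 1"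
  for n :: nat
proof -
  show "(\<exists>i. 2 * n = 3 * 2 ^ i) \<longleftrightarrow> (\<exists>i. n = 3 * 2 ^ i)"
  proof
    assume "\<exists>i. 2 * n = 3 * 2 ^ i"
    then obtain i where i: "2 * n = 3 * 2 ^ i" by blast
    have "i \<noteq> 0" using i by (intro notI) (simp, presburger)
    then obtain j where "i = Suc j" by (cases i) auto
    with i show "\<exists>i. n = 3 * 2 ^ i" by auto
  next
    assume "\<exists>i. n = 3 * 2 ^ i"
    then obtain i where "n = 3 * 2 ^ i" by blast
    then have "2 * n = 3 * 2 ^ Suc i" by simp
    then show "\<exists>i. 2 * n = 3 * 2 ^ i" by blast
  qed
  show "(\<exists>i. Suc (2 * n) = 3 * 2 ^ i) \<longleftrightarrow> n = 1"
  proof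
    assume "\<exists>i. Suc (2 * n) = 3 * 2 ^ i"
    then obtain i where i: "Suc (2 * n) = 3 * 2 ^ i" by blast
    show "n = 1"
    proof (cases i)
      case (Suc j)
      then have "Suc (2 * n) = 2 * (3 * 2 ^ j)" using i by simp
      then show ?thesis by presburger
    qed (use i in simp)
  next
    assume "n = 1"
    then have "Suc (2 * n) = 3 * 2 ^ 0" by simp
    then show "\<exists>i. Suc (2 * n) = 3 * 2 ^ i" by blast
  qed
qed

lemma \<alpha>_dilate: "\<alpha> = dilate 2 \<alpha> + fps_X"
proof -
  have "\<alpha> = dilate 2 \<alpha> + fps_X * dilate 2 1"
    by (rule fps_even_odd) (simp_all add: \<alpha>_def)
  then show ?thesis by (simp add: dilate_hom)
qed

lemma \<beta>_dilate: "\<beta> = dilate 2 \<beta> + fps_X * dilate 2 \<alpha>"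
  by (rule fps_even_odd) (simp_all add: \<alpha>_def \<beta>_def)

text \<open>Removing the last binary digit lowers the digit sum by that digit. The term
  \<open>X^3\<close> stems from the only odd number of the form \<open>3 * 2^i\<close>.\<close>

lemma \<gamma>_dilate: "\<gamma> = dilate 2 \<gamma> + fps_X * dilate 2 \<beta> + fps_X ^ 3"
proof -
  have "\<gamma> = dilate 2 \<gamma> + fps_X * dilate 2 (\<beta> + fps_X)"
    by (rule fps_even_odd) (simp_all only: \<gamma>_def \<beta>_def three_times_power_even_odd fps_nth_Abs_fps fps_add_nth
        digit_sum_simps, simp_all add: fps_X_def)
  also have "\<dots> = dilate 2 \<gamma> + fps_X * dilate 2 \<beta> + fps_X ^ 3"
    unfolding dilate_hom[OF zero_less_numeral] by algebra
  finally show ?thesis .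
qed

text \<open>
  Each relation below says that some series \<open>F\<close> vanishes, possibly modulo 2. As \<open>F(0) = 0\<close>,
  it suffices that \<open>F(X) - F(X^2)\<close> vanishes.
\<close>

lemma \<alpha>_square: "\<alpha> ^ 2 = \<alpha> - fps_X + 2 * \<beta>"
proof -
  define F where "F = \<alpha> ^ 2 - \<alpha> + fps_X - 2 * \<beta>"
  have "F - dilate 2 F = 0"
    unfolding F_def dilate_hom[OF zero_less_numeral]
    by (subst (1 2) \<alpha>_dilate, subst \<beta>_dilate) algebra
  moreover have "F $ 0 = 0" by (simp add: F_def \<alpha>_def \<beta>_def power2_eq_square)
  \<comment> \<open>Divisibility by 0 is equality with 0.\<close>
  ultimately have "of_int 0 dvd F" by - (rule dvd_of_dilate_difference, simp_all)
  then show ?thesis by (simp add: F_def algebra_simps)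
qed

lemma \<alpha>_square_dilate: "(dilate 2 \<alpha>) ^ 2 = dilate 2 \<alpha> - fps_X ^ 2 + 2 * dilate 2 \<beta>"
  using arg_cong[OF \<alpha>_square, of "dilate 2"] unfolding dilate_hom[OF zero_less_numeral] .

text \<open>Precision modulo 2 is enough here and in \<open>\<alpha>_times_\<beta>\<close>: in the
  square of \<open>numer\<close> both products occur with a factor 4.\<close>

lemma \<beta>_square: "\<exists>R. \<beta> ^ 2 = \<beta> + fps_X * \<alpha> + fps_X ^ 2 + 2 * R"
proof -
  define F where "F = \<beta> ^ 2 - \<beta> - fps_X * \<alpha> - fps_X ^ 2"
  define a b where "a = dilate 2 \<alpha>" and "b = dilate 2 \<beta>"
  have "F - dilate 2 F = 2 * (fps_X ^ 2 * a + fps_X ^ 2 * b + fps_X * a * b - fps_X * a - fps_X ^ 2)"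
    unfolding F_def dilate_hom[OF zero_less_numeral]
    apply (subst \<alpha>_dilate, subst (1 2) \<beta>_dilate)
    unfolding a_def[symmetric] b_def[symmetric]
    using \<alpha>_square_dilate[folded a_def b_def] by algebra
  then have "of_int 2 dvd F - dilate 2 F" by simp
  moreover have "F $ 0 = 0" by (simp add: F_def \<alpha>_def \<beta>_def power2_eq_square)
  ultimately have "of_int 2 dvd F" by - (rule dvd_of_dilate_difference, simp_all)
  then obtain R where "F = 2 * R" by (auto elim: dvdE)
  then have "\<beta> ^ 2 = \<beta> + fps_X * \<alpha> + fps_X ^ 2 + 2 * R" by (simp add: F_def algebra_simps)
  then show ?thesis ..
qed

lemma \<alpha>_times_\<beta>: "\<exists>R. \<alpha> * \<beta> = \<gamma> + (1 + fps_X) * \<alpha> + fps_X + 2 * R"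
proof -
  define F where "F = \<alpha> * \<beta> - \<gamma> - (1 + fps_X) * \<alpha> - fps_X"
  define a b c where "a = dilate 2 \<alpha>" and "b = dilate 2 \<beta>" and "c = dilate 2 \<gamma>"
  have "F - dilate 2 F = 2 * (fps_X * b + fps_X ^ 2 * a - fps_X ^ 3 - fps_X)"
    unfolding F_def dilate_hom[OF zero_less_numeral]
    apply (subst (1 2) \<alpha>_dilate, subst \<beta>_dilate, subst \<gamma>_dilate)
    unfolding a_def[symmetric] b_def[symmetric] c_def[symmetric]
    using \<alpha>_square_dilate[folded a_def b_def] by algebra
  then have "of_int 2 dvd F - dilate 2 F" by simp
  moreover have "F $ 0 = 0" by (simp add: F_def \<alpha>_def \<beta>_def \<gamma>_def)
  ultimately have "of_int 2 dvd F" by - (rule dvd_of_dilate_difference, simp_all)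
  then obtain R where "F = 2 * R" by (auto elim: dvdE)
  then have "\<alpha> * \<beta> = \<gamma> + (1 + fps_X) * \<alpha> + fps_X + 2 * R" by (simp add: F_def algebra_simps)
  then show ?thesis ..
qed

subsection \<open>The solution for trivial central element\<close>

text \<open>The exponent \<open>n + 6\<close> belongs to index \<open>n\<close>. The last three
  terms adjust indices 27, 42 and 45: index 42 is an exception to the family
  \<open>2^\<sigma> + 10\<close>, and at 27 and 45 the contribution of the subgroups without the
  central element has to be compensated.\<close>

definition coeff_1 :: "int fps \<Rightarrow> int fps" where
  "coeff_1 x = x ^ 7 + x ^ 8 + 4 * x ^ 9 + 5 * x ^ 11 + 6 * x ^ 12 + 2 * x ^ 13 + x ^ 16
      + 6 * x ^ 17 + 4 * x ^ 18 + x ^ 19 + 6 * x ^ 20 + 2 * x ^ 23 + 6 * x ^ 24 + 6 * x ^ 25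
      + 6 * x ^ 27 + 4 * x ^ 28 + 4 * x ^ 29 + 4 * x ^ 33 + 4 * x ^ 48 + 4 * x ^ 51"

definition coeff_\<alpha> :: "int fps \<Rightarrow> int fps" where
  "coeff_\<alpha> x = 5 + x ^ 3 + 6 * x ^ 4 + 6 * x ^ 7 + 6 * x ^ 8 + 6 * x ^ 9 + 6 * x ^ 11
      + 4 * x ^ 12 + 4 * x ^ 13 + 6 * x ^ 16 + 4 * x ^ 17 + 6 * x ^ 19 + 4 * x ^ 20 + 4 * x ^ 23
      + 4 * x ^ 24 + 4 * x ^ 25 + 4 * x ^ 27"

text \<open>The coefficient of \<open>\<beta>\<close> is even. Splitting off the 2 makes visible
  that its square carries a factor 4.\<close>

definition half_coeff_\<beta> :: "int fps \<Rightarrow> int fps" where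
  "half_coeff_\<beta> x = 3 + 3 * x ^ 3 + 2 * x ^ 4 + 2 * x ^ 7 + 2 * x ^ 8 + 2 * x ^ 9 + 2 * x ^ 11
      + 2 * x ^ 16 + 2 * x ^ 19"

text \<open>
  Modulo 8 the solution of the Riccati equation is \<open>X^(-7)\<close> times the following series. Its
  coefficients are read off from the claimed classification: the families of indices give those of
  \<open>\<alpha>\<close>, \<open>\<beta>\<close> and \<open>\<gamma>\<close> after \<open>X^32\<close> is substituted for \<open>X\<close>, the exceptional indices (without the
  contribution of the subgroups that do not contain \<open>x^2\<close>) the remaining one.
\<close>

definition numer :: "int fps" where
  "numer = coeff_1 fps_X + coeff_\<alpha> fps_X * dilate 32 \<alpha> + 2 * half_coeff_\<beta> fps_X * dilate 32 \<beta>
    + 4 * (1 + fps_X ^ 3) * dilate 32 \<gamma>"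

text \<open>A series in \<open>X^32\<close> times \<open>X^i\<close> lives on one residue class
  modulo 32, so different terms of \<open>numer\<close> do not overlap.\<close>

lemma fps_X_power_mult_dilate_nth:
  assumes "i < 32" "r < 32"
  shows "(fps_X ^ i * dilate 32 f) $ (32 * q + r) = (if i = r then f $ q else 0)"
proof -
  have "32 dvd 32 * q + r - i \<longleftrightarrow> i = r" if "i \<le> 32 * q + r"
  proof
    assume "32 dvd 32 * q + r - i"
    then obtain k where "32 * q + r - i = 32 * k" by (elim dvdE)
    then have "32 * q + r = 32 * k + i" using that by linarith
    then have "(32 * q + r) mod 32 = (32 * k + i) mod 32" by (rule arg_cong)
    then show "i = r" using assms by simp
  qed simp
  then show ?thesis using assms by (auto simp: fps_X_power_mult_nth dilate_nth)
qed

text \<open>The lists hold pairs of exponent and coefficient: those of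
  \<open>coeff_\<alpha>\<close>, of twice \<open>half_coeff_\<beta>\<close> and of
  \<open>4 * (1 + X^3)\<close>.\<close>

lemma numer_nth:
  assumes "r < 32"
  shows "numer $ (32 * q + r) = coeff_1 fps_X $ (32 * q + r)
    + (\<Sum>(i, c) \<leftarrow> [(0, 5), (3, 1), (4, 6), (7, 6), (8, 6), (9, 6), (11, 6), (12, 4), (13, 4), (16, 6), (17, 4), (19, 6), (20, 4), (23, 4), (24, 4), (25, 4), (27, 4)]. if i = r then c * \<alpha> $ q else 0)
    + (\<Sum>(i, c) \<leftarrow> [(0, 6), (3, 6), (4, 4), (7, 4), (8, 4), (9, 4), (11, 4), (16, 4), (19, 4)]. if i = r then c * \<beta> $ q else 0)
    + (\<Sum>(i, c) \<leftarrow> [(0, 4), (3, 4)]. if i = r then c * \<gamma> $ q else 0)"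
proof -
  have e: "(coeff_\<alpha> fps_X * dilate 32 \<alpha>) $ (32 * q + r) = (\<Sum>(i, c) \<leftarrow> [(0, 5), (3, 1), (4, 6), (7, 6), (8, 6), (9, 6), (11, 6), (12, 4), (13, 4), (16, 6), (17, 4), (19, 6), (20, 4), (23, 4), (24, 4), (25, 4), (27, 4)]. c * (fps_X ^ i * dilate 32 \<alpha>) $ (32 * q + r))"
    "(2 * half_coeff_\<beta> fps_X * dilate 32 \<beta>) $ (32 * q + r) = (\<Sum>(i, c) \<leftarrow> [(0, 6), (3, 6), (4, 4), (7, 4), (8, 4), (9, 4), (11, 4), (16, 4), (19, 4)]. c * (fps_X ^ i * dilate 32 \<beta>) $ (32 * q + r))"
    "(4 * (1 + fps_X ^ 3) * dilate 32 \<gamma>) $ (32 * q + r) = (\<Sum>(i, c) \<leftarrow> [(0, 4), (3, 4)]. c * (fps_X ^ i * dilate 32 \<gamma>) $ (32 * q + r))"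
    unfolding coeff_\<alpha>_def half_coeff_\<beta>_def
    by (simp_all add: numeral_fps_const distrib_right distrib_left mult.assoc)
  show ?thesis
    unfolding numer_def fps_add_nth e
    using fps_X_power_mult_dilate_nth[OF _ assms, of 0 \<alpha> q] fps_X_power_mult_dilate_nth[OF _ assms, of 0 \<beta> q]
      fps_X_power_mult_dilate_nth[OF _ assms, of 0 \<gamma> q] fps_X_power_mult_dilate_nth[OF _ assms, of _ \<alpha> q] fps_X_power_mult_dilate_nth[OF _ assms, of _ \<beta> q]
      fps_X_power_mult_dilate_nth[OF _ assms, of _ \<gamma> q]
    by simp
qed

text \<open>The coefficients of 1, \<open>A\<close>, \<open>B\<close> and \<open>C\<close> that
  arise when \<open>numer\<close> is inserted into the Riccati equation and \<open>A^2\<close>,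
  \<open>B^2\<close>, \<open>A * B\<close> are replaced by linear terms; \<open>x^32\<close> and
  \<open>x^64\<close> come from these replacements. The derivatives \<open>p'\<close>,
  \<open>a'\<close>, \<open>h'\<close> are written out, so that only identities of polynomials in
  \<open>x\<close> remain.\<close>

lemma coeff_identities:
  fixes x :: "int fps"
  defines "p \<equiv> coeff_1 x" and "p' \<equiv> 7 * x ^ 6 + 8 * x ^ 7 + 36 * x ^ 8 + 55 * x ^ 10
      + 72 * x ^ 11 + 26 * x ^ 12 + 16 * x ^ 15 + 102 * x ^ 16 + 72 * x ^ 17 + 19 * x ^ 18
      + 120 * x ^ 19 + 46 * x ^ 22 + 144 * x ^ 23 + 150 * x ^ 24 + 162 * x ^ 26 + 112 * x ^ 27
      + 116 * x ^ 28 + 132 * x ^ 32 + 192 * x ^ 47 + 204 * x ^ 50"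
    and "a \<equiv> coeff_\<alpha> x" and "a' \<equiv> 3 * x ^ 2 + 24 * x ^ 3 + 42 * x ^ 6
        + 48 * x ^ 7 + 54 * x ^ 8 + 66 * x ^ 10 + 48 * x ^ 11 + 52 * x ^ 12 + 96 * x ^ 15
        + 68 * x ^ 16 + 114 * x ^ 18 + 80 * x ^ 19 + 92 * x ^ 22 + 96 * x ^ 23 + 100 * x ^ 24
        + 108 * x ^ 26"
    and "h \<equiv> half_coeff_\<beta> x" and "h' \<equiv> 9 * x ^ 2 + 8 * x ^ 3 + 14 * x ^ 6
        + 16 * x ^ 7 + 18 * x ^ 8 + 22 * x ^ 10 + 32 * x ^ 15 + 38 * x ^ 18"
    and "l \<equiv> 1 - 4 * x ^ 3 - 2 * x ^ 4 - 4 * x ^ 6 + 2 * x ^ 7 + 4 * x ^ 9"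
  shows "8 dvd (x ^ 3 - 1) * (x ^ 7 * p' - 7 * x ^ 6 * p + (p ^ 2 - a ^ 2 * x ^ 32 + 4 * h ^ 2 * x ^ 64 + 4 * a * h * x ^ 32)) + l * p
      - x ^ 7 * (1 + x ^ 1 + 4 * x ^ 2 + 4 * x ^ 3 - x ^ 4 + 4 * x ^ 5 - 2 * x ^ 6 - 2 * x ^ 8)"
    and "8 dvd (x ^ 3 - 1) * (x ^ 7 * a' - 7 * x ^ 6 * a + (2 * p * a + a ^ 2 + 4 * h ^ 2 * x ^ 32 + 4 * a * h * (1 + x ^ 32))) + l * a"
    and "8 dvd (x ^ 3 - 1) * (x ^ 7 * (2 * h') - 7 * x ^ 6 * (2 * h) + (4 * p * h + 2 * a ^ 2 + 4 * h ^ 2)) + l * (2 * h)"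
    and "8 dvd (x ^ 3 - 1) * (x ^ 7 * (12 * x ^ 2) - 7 * x ^ 6 * (4 * (1 + x ^ 3)) + 4 * a * h) + l * (4 * (1 + x ^ 3))"
proof -
  have "(x ^ 3 - 1) * (x ^ 7 * p' - 7 * x ^ 6 * p + (p ^ 2 - a ^ 2 * x ^ 32 + 4 * h ^ 2 * x ^ 64 + 4 * a * h * x ^ 32)) + l * p
      - x ^ 7 * (1 + x ^ 1 + 4 * x ^ 2 + 4 * x ^ 3 - x ^ 4 + 4 * x ^ 5 - 2 * x ^ 6
          - 2 * x ^ 8) = 8 * (0 - x ^ 10 - 2 * x ^ 12 - x ^ 13 - 3 * x ^ 14 - 7 * x ^ 15
          - 2 * x ^ 16 - 5 * x ^ 17 - 5 * x ^ 18 - 3 * x ^ 19 - 3 * x ^ 20 - 3 * x ^ 22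
          - 14 * x ^ 23 - 9 * x ^ 24 - 3 * x ^ 26 + 8 * x ^ 27 - 7 * x ^ 28 - 6 * x ^ 29
          - 22 * x ^ 30 - 20 * x ^ 31 + 5 * x ^ 32 - 4 * x ^ 33 + 3 * x ^ 34 - 20 * x ^ 35
          - 8 * x ^ 36 + 18 * x ^ 38 - 9 * x ^ 39 - 4 * x ^ 40 - 6 * x ^ 41 + 16 * x ^ 42
          + 2 * x ^ 43 - 10 * x ^ 44 - 2 * x ^ 45 + 6 * x ^ 46 + 10 * x ^ 47 + 4 * x ^ 48
          + 6 * x ^ 49 + 10 * x ^ 50 - 4 * x ^ 51 - 9 * x ^ 52 + 6 * x ^ 53 - 12 * x ^ 54
          + 9 * x ^ 55 + 5 * x ^ 56 + 5 * x ^ 57 + 5 * x ^ 58 - 7 * x ^ 59 + 20 * x ^ 60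
          + 17 * x ^ 61 + 3 * x ^ 62 + 20 * x ^ 63 - x ^ 64 + 15 * x ^ 65 - 2 * x ^ 66 - 9 * x ^ 67
          - 6 * x ^ 68 + 6 * x ^ 69 + 5 * x ^ 70 - 10 * x ^ 71 - 10 * x ^ 72 - 5 * x ^ 73
          + 10 * x ^ 74 - 18 * x ^ 75 - 4 * x ^ 76 - 2 * x ^ 77 + 10 * x ^ 78 + 6 * x ^ 79
          - 6 * x ^ 80 + 6 * x ^ 81 + 4 * x ^ 82 - 2 * x ^ 83 - 4 * x ^ 84 + 6 * x ^ 86 - 4 * x ^ 88
          + 2 * x ^ 89 + 4 * x ^ 90 - 4 * x ^ 91 + 4 * x ^ 93 + 4 * x ^ 94 + 4 * x ^ 95 - 4 * x ^ 96
          + 4 * x ^ 97 - 4 * x ^ 99 + 4 * x ^ 102 + 4 * x ^ 105)"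
    unfolding p_def p'_def a_def h_def l_def coeff_1_def coeff_\<alpha>_def half_coeff_\<beta>_def by algebra
  then show "8 dvd (x ^ 3 - 1) * (x ^ 7 * p' - 7 * x ^ 6 * p + (p ^ 2 - a ^ 2 * x ^ 32 + 4 * h ^ 2 * x ^ 64 + 4 * a * h * x ^ 32)) + l * p
      - x ^ 7 * (1 + x ^ 1 + 4 * x ^ 2 + 4 * x ^ 3 - x ^ 4 + 4 * x ^ 5 - 2 * x ^ 6 - 2 * x ^ 8)" by (rule dvdI)
  have "(x ^ 3 - 1) * (x ^ 7 * a' - 7 * x ^ 6 * a + (2 * p * a + a ^ 2 + 4 * h ^ 2 * x ^ 32
      + 4 * a * h * (1 + x ^ 32))) + l * a = 8 * (0 - 10 - 2 * x ^ 3 - 22 * x ^ 4 + 10 * x ^ 6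
      - 14 * x ^ 7 - 34 * x ^ 8 - 26 * x ^ 9 + 19 * x ^ 10 - 31 * x ^ 11 - 31 * x ^ 12 - 32 * x ^ 13
      + 32 * x ^ 14 - 14 * x ^ 15 - 47 * x ^ 16 - 38 * x ^ 17 + 11 * x ^ 18 - x ^ 19 - 54 * x ^ 20
      - 2 * x ^ 21 + 24 * x ^ 22 + 17 * x ^ 23 - 50 * x ^ 24 - 34 * x ^ 25 + 26 * x ^ 26
      - 14 * x ^ 27 - 31 * x ^ 28 - 21 * x ^ 29 + 40 * x ^ 30 + 12 * x ^ 31 - 24 * x ^ 32
      - 19 * x ^ 33 + 39 * x ^ 34 + 10 * x ^ 35 - 46 * x ^ 36 + 7 * x ^ 37 + 44 * x ^ 38
      + 52 * x ^ 39 - 28 * x ^ 40 - 10 * x ^ 41 + 32 * x ^ 42 - 12 * x ^ 43 - 28 * x ^ 44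
      + 4 * x ^ 45 + 52 * x ^ 46 + 30 * x ^ 47 - 33 * x ^ 48 + 4 * x ^ 49 + 24 * x ^ 50 + 7 * x ^ 51
      - 36 * x ^ 52 + 24 * x ^ 53 + 41 * x ^ 54 + 24 * x ^ 55 - 24 * x ^ 56 + 5 * x ^ 57
      + 28 * x ^ 58 - 16 * x ^ 59 - 16 * x ^ 60 + 20 * x ^ 61 + 32 * x ^ 62 + 28 * x ^ 63
      - 18 * x ^ 64 + 16 * x ^ 65 + 12 * x ^ 66 - 2 * x ^ 67 - 8 * x ^ 68 + 12 * x ^ 69
      + 18 * x ^ 70 + 8 * x ^ 71 - 8 * x ^ 72 + 10 * x ^ 73 + 8 * x ^ 74 - 8 * x ^ 75 + 8 * x ^ 77
      + 8 * x ^ 78 + 8 * x ^ 79 + 8 * x ^ 81)"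
    unfolding p_def a'_def a_def h_def l_def coeff_1_def coeff_\<alpha>_def half_coeff_\<beta>_def by algebra
  then show "8 dvd (x ^ 3 - 1) * (x ^ 7 * a' - 7 * x ^ 6 * a + (2 * p * a + a ^ 2 + 4 * h ^ 2 * x ^ 32 + 4 * a * h * (1 + x ^ 32))) + l * a"
    by (rule dvdI)
  have "(x ^ 3 - 1) * (x ^ 7 * (2 * h') - 7 * x ^ 6 * (2 * h) + (4 * p * h + 2 * a ^ 2
      + 4 * h ^ 2)) + l * (2 * h) = 8 * (0 - 10 - 3 * x ^ 3 - 22 * x ^ 4 + 6 * x ^ 6 - 12 * x ^ 7
      - 34 * x ^ 8 - 24 * x ^ 9 + 20 * x ^ 10 - 30 * x ^ 11 - 33 * x ^ 12 - 31 * x ^ 13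
      + 30 * x ^ 14 - 8 * x ^ 15 - 42 * x ^ 16 - 33 * x ^ 17 + 17 * x ^ 18 + 4 * x ^ 19
      - 53 * x ^ 20 - 7 * x ^ 21 + 26 * x ^ 22 + 27 * x ^ 23 - 41 * x ^ 24 - 33 * x ^ 25
      + 35 * x ^ 26 - 21 * x ^ 27 - 32 * x ^ 28 - 13 * x ^ 29 + 57 * x ^ 30 + 24 * x ^ 31
      - 26 * x ^ 32 - 11 * x ^ 33 + 34 * x ^ 34 + 22 * x ^ 35 - 30 * x ^ 36 + 18 * x ^ 37
      + 30 * x ^ 38 + 58 * x ^ 39 - 6 * x ^ 40 + 12 * x ^ 41 + 18 * x ^ 42 + 2 * x ^ 43
      - 12 * x ^ 44 + 14 * x ^ 45 + 22 * x ^ 46 + 22 * x ^ 47 - 10 * x ^ 48 + 10 * x ^ 49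
      + 8 * x ^ 50 + 2 * x ^ 51 - 4 * x ^ 52 + 12 * x ^ 53 + 10 * x ^ 54 + 8 * x ^ 55 - 4 * x ^ 56
      + 6 * x ^ 57 + 4 * x ^ 58 - 4 * x ^ 59 + 4 * x ^ 61 + 4 * x ^ 62 + 4 * x ^ 63 - 4 * x ^ 64
      + 4 * x ^ 65 - 4 * x ^ 67 + 4 * x ^ 70 + 4 * x ^ 73)"
    unfolding p_def h'_def a_def h_def l_def coeff_1_def coeff_\<alpha>_def half_coeff_\<beta>_def by algebra
  then show "8 dvd (x ^ 3 - 1) * (x ^ 7 * (2 * h') - 7 * x ^ 6 * (2 * h) + (4 * p * h + 2 * a ^ 2 + 4 * h ^ 2)) + l * (2 * h)"
    by (rule dvdI)
  have "(x ^ 3 - 1) * (x ^ 7 * (12 * x ^ 2) - 7 * x ^ 6 * (4 * (1 + x ^ 3))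
      + 4 * a * h) + l * (4 * (1 + x ^ 3)) = 8 * (0 - 7 - 3 * x ^ 3 - 15 * x ^ 4 + 7 * x ^ 6
      - 10 * x ^ 7 - 20 * x ^ 8 - 14 * x ^ 9 + 15 * x ^ 10 - 16 * x ^ 11 - 14 * x ^ 12 - 8 * x ^ 13
      + 20 * x ^ 14 - 2 * x ^ 15 - 24 * x ^ 16 - 6 * x ^ 17 + 12 * x ^ 18 + 2 * x ^ 19 - 22 * x ^ 20
      + 6 * x ^ 21 + 20 * x ^ 22 + 4 * x ^ 23 - 18 * x ^ 24 - 2 * x ^ 25 + 18 * x ^ 26 - 14 * x ^ 27
      - 12 * x ^ 28 + 10 * x ^ 29 + 22 * x ^ 30 + 14 * x ^ 31 - 10 * x ^ 32 + 10 * x ^ 33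
      + 8 * x ^ 34 + 2 * x ^ 35 - 4 * x ^ 36 + 12 * x ^ 37 + 10 * x ^ 38 + 8 * x ^ 39 - 4 * x ^ 40
      + 6 * x ^ 41 + 4 * x ^ 42 - 4 * x ^ 43 + 4 * x ^ 45 + 4 * x ^ 46 + 4 * x ^ 47 + 4 * x ^ 49)"
    unfolding a_def h_def l_def coeff_\<alpha>_def half_coeff_\<beta>_def by algebra
  then show "8 dvd (x ^ 3 - 1) * (x ^ 7 * (12 * x ^ 2) - 7 * x ^ 6 * (4 * (1 + x ^ 3)) + 4 * a * h) + l * (4 * (1 + x ^ 3))"
    by (rule dvdI)
qed

lemma fps_deriv_dilate_32: "\<exists>M. fps_deriv (dilate 32 f) = 8 * (M :: int fps)"
proof -
  have "of_int 8 dvd fps_deriv (dilate 32 f)"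
    unfolding fps_int_dvd_iff
  proof
    fix n
    show "8 dvd fps_deriv (dilate 32 f) $ n"
    proof (cases "32 dvd n + 1")
      case True
      then have "(8 :: nat) dvd n + 1" by (rule dvd_trans[rotated]) simp
      then have "(8 :: int) dvd int (n + 1)" by (metis int_dvd_int_iff of_nat_numeral)
      then show ?thesis by simp
    qed (simp add: dilate_nth)
  qed
  then show ?thesis by (auto elim: dvdE)
qed

text \<open>For \<open>numer = X^7 * V\<close> the first bracket with its factor is
  \<open>X^7 * (X^10 - X^7) * (V' + V^2)\<close>. The statement is the Riccati equation for
  \<open>V\<close>, multiplied by \<open>X^7\<close>.\<close>

lemma numer_riccati:
  defines "x \<equiv> (fps_X :: int fps)"
  shows "8 dvd (x ^ 3 - 1) * (x ^ 7 * fps_deriv numer - 7 * x ^ 6 * numer + numer ^ 2)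
    + (1 - 4 * x ^ 3 - 2 * x ^ 4 - 4 * x ^ 6 + 2 * x ^ 7 + 4 * x ^ 9) * numer
    - x ^ 7 * (1 + x ^ 1 + 4 * x ^ 2 + 4 * x ^ 3 - x ^ 4 + 4 * x ^ 5 - 2 * x ^ 6 - 2 * x ^ 8)"
proof -
  define A B C where "A = dilate 32 \<alpha>" and "B = dilate 32 \<beta>" and "C = dilate 32 \<gamma>"
  define p a h where "p = coeff_1 x" and "a = coeff_\<alpha> x" and "h = half_coeff_\<beta> x"
  define p' where "p' = 7 * x ^ 6 + 8 * x ^ 7 + 36 * x ^ 8 + 55 * x ^ 10 + 72 * x ^ 11 + 26 * x ^ 12
      + 16 * x ^ 15 + 102 * x ^ 16 + 72 * x ^ 17 + 19 * x ^ 18 + 120 * x ^ 19 + 46 * x ^ 22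
      + 144 * x ^ 23 + 150 * x ^ 24 + 162 * x ^ 26 + 112 * x ^ 27 + 116 * x ^ 28 + 132 * x ^ 32
      + 192 * x ^ 47 + 204 * x ^ 50"
  define a' where "a' = 3 * x ^ 2 + 24 * x ^ 3 + 42 * x ^ 6 + 48 * x ^ 7 + 54 * x ^ 8 + 66 * x ^ 10
      + 48 * x ^ 11 + 52 * x ^ 12 + 96 * x ^ 15 + 68 * x ^ 16 + 114 * x ^ 18 + 80 * x ^ 19
      + 92 * x ^ 22 + 96 * x ^ 23 + 100 * x ^ 24 + 108 * x ^ 26"
  define h' where "h' = 9 * x ^ 2 + 8 * x ^ 3 + 14 * x ^ 6 + 16 * x ^ 7 + 18 * x ^ 8 + 22 * x ^ 10
      + 32 * x ^ 15 + 38 * x ^ 18"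
  define l where "l = 1 - 4 * x ^ 3 - 2 * x ^ 4 - 4 * x ^ 6 + 2 * x ^ 7 + 4 * x ^ 9"
  define q where "q = 1 + x ^ 1 + 4 * x ^ 2 + 4 * x ^ 3 - x ^ 4 + 4 * x ^ 5 - 2 * x ^ 6 - 2 * x ^ 8"
  obtain R0 K0 where R0: "\<beta> ^ 2 = \<beta> + fps_X * \<alpha> + fps_X ^ 2 + 2 * R0"
    and K0: "\<alpha> * \<beta> = \<gamma> + (1 + fps_X) * \<alpha> + fps_X + 2 * K0"
    using \<beta>_square \<alpha>_times_\<beta> by blast
  define R K where "R = dilate 32 R0" and "K = dilate 32 K0"
  note hom = dilate_hom[OF zero_less_numeral]
  have AA: "A ^ 2 = A - x ^ 32 + 2 * B"
    using arg_cong[OF \<alpha>_square, of "dilate 32"] unfolding hom A_def B_def x_def .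
  have BB: "B ^ 2 = B + x ^ 32 * A + x ^ 64 + 2 * R"
    using arg_cong[OF R0, of "dilate 32"] unfolding hom A_def B_def R_def x_def by (simp flip: power_mult)
  have AB: "A * B = C + (1 + x ^ 32) * A + x ^ 32 + 2 * K"
    using arg_cong[OF K0, of "dilate 32"] unfolding hom A_def B_def C_def K_def x_def .
  obtain A1 B1 C1 where A1: "fps_deriv A = 8 * A1" and B1: "fps_deriv B = 8 * B1" and C1: "fps_deriv C = 8 * C1"
    using fps_deriv_dilate_32 unfolding A_def B_def C_def by metis
  define w where "w = 4 * (1 + x ^ 3)"
  have numer: "numer = p + a * A + 2 * h * B + w * C"
    by (simp add: w_def numer_def p_def a_def h_def A_def B_def C_def x_def)
  have deriv: "fps_deriv p = p'" "fps_deriv a = a'" "fps_deriv h = h'"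
    unfolding p_def a_def h_def p'_def a'_def h'_def x_def coeff_1_def coeff_\<alpha>_def half_coeff_\<beta>_def
    by (simp_all add: fps_deriv_power flip: numeral_fps_const)
  have w': "fps_deriv w = 12 * x ^ 2"
    by (simp add: w_def x_def fps_deriv_power flip: numeral_fps_const)
  have "fps_deriv numer = p' + a' * A + a * (8 * A1) + 2 * h' * B + 2 * h * (8 * B1) + 12 * x ^ 2 * C + w * (8 * C1)"
    unfolding numer fps_deriv_add fps_deriv_mult w' deriv A1 B1 C1 by (simp add: algebra_simps)
  then have numer': "fps_deriv numer = p' + a' * A + 2 * h' * B + 12 * x ^ 2 * C + 8 * (a * A1 + 2 * h * B1 + w * C1)"
    by algebra
  \<comment> \<open>The coefficient \<open>w\<close> of \<open>C\<close> is a multiple of 4, so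
    \<open>C^2\<close> and all cross terms with \<open>C\<close> vanish modulo 8.\<close>
  have "numer ^ 2 = p ^ 2 + a ^ 2 * A ^ 2 + 4 * h ^ 2 * B ^ 2 + 2 * p * a * A + 4 * p * h * B + 4 * a * h * (A * B)
    + 8 * ((1 + x ^ 3) * (p * C + a * A * C + 2 * h * B * C + 2 * (1 + x ^ 3) * C ^ 2))"
    unfolding numer w_def by algebra
  also have "\<dots> = (p ^ 2 - a ^ 2 * x ^ 32 + 4 * h ^ 2 * x ^ 64 + 4 * a * h * x ^ 32)
    + (2 * p * a + a ^ 2 + 4 * h ^ 2 * x ^ 32 + 4 * a * h * (1 + x ^ 32)) * A
    + (4 * p * h + 2 * a ^ 2 + 4 * h ^ 2) * B + 4 * a * h * C
    + 8 * ((1 + x ^ 3) * (p * C + a * A * C + 2 * h * B * C + 2 * (1 + x ^ 3) * C ^ 2) + h ^ 2 * R + a * h * K)"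
    unfolding AA BB AB by algebra
  finally have sq: "numer ^ 2 = (p ^ 2 - a ^ 2 * x ^ 32 + 4 * h ^ 2 * x ^ 64 + 4 * a * h * x ^ 32)
    + (2 * p * a + a ^ 2 + 4 * h ^ 2 * x ^ 32 + 4 * a * h * (1 + x ^ 32)) * A
    + (4 * p * h + 2 * a ^ 2 + 4 * h ^ 2) * B + 4 * a * h * C
    + 8 * ((1 + x ^ 3) * (p * C + a * A * C + 2 * h * B * C + 2 * (1 + x ^ 3) * C ^ 2) + h ^ 2 * R + a * h * K)"
    (is "_ = ?q0 + ?qA * A + ?qB * B + ?qC * C + 8 * ?M") .
  have "(x ^ 3 - 1) * (x ^ 7 * fps_deriv numer - 7 * x ^ 6 * numer + numer ^ 2) + l * numer - x ^ 7 * q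
    = ((x ^ 3 - 1) * (x ^ 7 * p' - 7 * x ^ 6 * p + ?q0) + l * p - x ^ 7 * q)
    + ((x ^ 3 - 1) * (x ^ 7 * a' - 7 * x ^ 6 * a + ?qA) + l * a) * A
    + ((x ^ 3 - 1) * (x ^ 7 * (2 * h') - 7 * x ^ 6 * (2 * h) + ?qB) + l * (2 * h)) * B
    + ((x ^ 3 - 1) * (x ^ 7 * (12 * x ^ 2) - 7 * x ^ 6 * (4 * (1 + x ^ 3)) + 4 * a * h) + l * (4 * (1 + x ^ 3))) * C
    + 8 * ((x ^ 3 - 1) * (?M + x ^ 7 * (a * A1 + 2 * h * B1 + 4 * (1 + x ^ 3) * C1)))"
    unfolding sq numer' unfolding numer w_def by algebra
  note decomposition = this
  note c = coeff_identities[of x, folded p_def a_def h_def, folded p'_def a'_def h'_def l_def q_def]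
  show ?thesis
    unfolding l_def[symmetric] q_def[symmetric] decomposition
    by (rule dvd_add[OF dvd_add[OF dvd_add[OF dvd_add[OF c(1) dvd_mult2[OF c(2)]] dvd_mult2[OF c(3)]]
          dvd_mult2[OF c(4)]] dvd_triv_left])
qed

text \<open>Index \<open>n\<close> is the coefficient at \<open>n - 1\<close> of
  \<open>H'/H\<close>, and the factor \<open>X^7\<close> moves it to \<open>n + 6\<close>. Because
  \<open>numer\<close> starts at \<open>X^7\<close>, its quotient \<open>V\<close> is a power
  series, and it must agree with \<open>H'/H\<close> modulo 8.\<close>

theorem trivial_subgroups_mod_8:
  assumes "n \<ge> 1"
  shows "[int (kind_subgroups True n) = numer $ (n + 6)] (mod 8)"
proof -
  define x where "x = (fps_X :: int fps)"
  define S where "S = trivial_fps"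
  define V where "V = fps_shift 7 numer"
  define L where "L = 1 - 4 * x ^ 3 - 2 * x ^ 4 - 4 * x ^ 6 + 2 * x ^ 7 + 4 * x ^ 9"
  define q where "q = 1 + x ^ 1 + 4 * x ^ 2 + 4 * x ^ 3 - x ^ 4 + 4 * x ^ 5 - 2 * x ^ 6 - 2 * x ^ 8"
  have "numer $ i = 0" if "i < 7" for i
  proof -
    have "coeff_1 fps_X $ i = 0" using that by (simp add: coeff_1_def numeral_fps_const)
    then show ?thesis using that numer_nth[of i 0] by (simp add: \<alpha>_def \<beta>_def \<gamma>_def)
  qed
  then have V: "numer = x ^ 7 * V"
    by (intro fps_ext) (simp add: V_def x_def fps_X_power_mult_nth)
  have V': "fps_deriv numer = 7 * x ^ 6 * V + x ^ 7 * fps_deriv V"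
    unfolding V by (simp add: x_def fps_deriv_power algebra_simps flip: numeral_fps_const)
  have "(x ^ 3 - 1) * (x ^ 7 * fps_deriv numer - 7 * x ^ 6 * numer + numer ^ 2) + L * numer - x ^ 7 * q
    = x ^ 7 * ((x ^ 10 - x ^ 7) * (fps_deriv V + V ^ 2) + L * V - q)"
    unfolding V' unfolding V by algebra
  then have "of_int 8 dvd x ^ 7 * ((x ^ 10 - x ^ 7) * (fps_deriv V + V ^ 2) + L * V - q)" (is "_ dvd _ * ?E")
    using numer_riccati unfolding x_def L_def q_def by simp
  then have E: "of_int 8 dvd ?E"
    unfolding fps_int_dvd_iff by (metis add_diff_cancel_left' fps_X_power_mult_nth not_add_less1 x_def)
  have "x ^ 2 * (x ^ 8 - x ^ 5) * (1 * fps_deriv (S - V) + (S - V) * (S + V))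
      + (1 + x * (4 * x ^ 8 + 2 * x ^ 6 - 4 * x ^ 5 - 2 * x ^ 3 - 4 * x ^ 2)) * (S - V)
      = ((x ^ 10 - x ^ 7) * (fps_deriv S + S ^ 2) + L * S) - q - ?E"
    unfolding fps_deriv_sub L_def by algebra
  also have "\<dots> = - ?E"
    using trivial_riccati by (simp add: x_def S_def L_def q_def)
  finally have "of_int 8 dvd S - V"
    using E unfolding x_def by (metis riccati_difference_dvd dvd_minus_iff)
  then have "8 dvd S $ (n - 1) - V $ (n - 1)" unfolding fps_int_dvd_iff by (metis fps_sub_nth)
  moreover have "V $ (n - 1) = numer $ (n + 6)" using assms by (simp add: V_def add.commute)
  moreover have "S $ (n - 1) = int (kind_subgroups True n)" using assms by (simp add: S_def trivial_fps_def)
  ultimately show ?thesis by (simp add: cong_iff_dvd_diff)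
qed

subsection \<open>Classification of the indices\<close>

lemma digit_sum_add_power: "m < 2 ^ i \<Longrightarrow> digit_sum (2 ^ i + m) = Suc (digit_sum m)"
proof (induction i arbitrary: m)
  case 0
  then show ?case using digit_sum.simps[of 1] by simp
next
  case (Suc i)
  have "m div 2 < 2 ^ i" using Suc.prems by simp
  moreover have "(2 ^ Suc i + m) div 2 = 2 ^ i + m div 2" "(2 ^ Suc i + m) mod 2 = m mod 2" by auto
  ultimately show ?case
    using Suc.IH[of "m div 2"] digit_sum.simps[of "2 ^ Suc i + m"] digit_sum.simps[of m]
    by (cases "m = 0") auto
qed

lemma digit_sum_eq_Suc_iff: "digit_sum n = Suc k \<longleftrightarrow> (\<exists>i m. n = 2 ^ i + m \<and> m < 2 ^ i \<and> digit_sum m = k)"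
proof
  assume k: "digit_sum n = Suc k"
  then have "n > 0" by (cases n) auto
  then obtain i where i: "2 ^ i \<le> n" "n < 2 ^ (i + 1)" using ex_power_ivl1[of 2 n] by auto
  then have "n = 2 ^ i + (n - 2 ^ i)" "n - 2 ^ i < 2 ^ i" by auto
  with k digit_sum_add_power show "\<exists>i m. n = 2 ^ i + m \<and> m < 2 ^ i \<and> digit_sum m = k" by (metis Suc_inject)
qed (auto simp: digit_sum_add_power)

lemma digit_sum_1_iff: "digit_sum n = 1 \<longleftrightarrow> (\<exists>i. n = 2 ^ i)"
  unfolding One_nat_def digit_sum_eq_Suc_iff by auto

lemma digit_sum_2_iff: "digit_sum n = 2 \<longleftrightarrow> (\<exists>i j. j < i \<and> n = 2 ^ i + 2 ^ j)"
proof -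
  have "digit_sum n = 2 \<longleftrightarrow> (\<exists>i m. n = 2 ^ i + m \<and> m < 2 ^ i \<and> (\<exists>j. m = 2 ^ j))"
    unfolding digit_sum_1_iff[symmetric] using digit_sum_eq_Suc_iff[of n 1] by (simp add: numeral_2_eq_2)
  also have "\<dots> \<longleftrightarrow> (\<exists>i j. n = 2 ^ i + 2 ^ j \<and> (2 :: nat) ^ j < 2 ^ i)" by blast
  finally show ?thesis by (simp add: conj_commute)
qed

lemma digit_sum_3_iff: "digit_sum n = 3 \<longleftrightarrow> (\<exists>i j k. k < j \<and> j < i \<and> n = 2 ^ i + 2 ^ j + 2 ^ k)"
proof -
  have lt: "2 ^ j + 2 ^ k < (2 ^ i :: nat) \<longleftrightarrow> j < i" if "k < j" for i j k
  proof
    assume "2 ^ j + 2 ^ k < (2 ^ i :: nat)"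
    then have "2 ^ j < (2 ^ i :: nat)" by linarith
    then show "j < i" by simp
  next
    assume "j < i"
    then have "(2 :: nat) ^ Suc j \<le> 2 ^ i" by (intro power_increasing) auto
    then have "2 * 2 ^ j \<le> (2 :: nat) ^ i" by simp
    moreover have "(2 :: nat) ^ k < 2 ^ j" using that by simp
    ultimately show "2 ^ j + 2 ^ k < (2 ^ i :: nat)" by linarith
  qed
  have "digit_sum n = 3 \<longleftrightarrow> (\<exists>i m. n = 2 ^ i + m \<and> m < 2 ^ i \<and> (\<exists>j k. k < j \<and> m = 2 ^ j + 2 ^ k))"
    unfolding digit_sum_2_iff[symmetric] using digit_sum_eq_Suc_iff[of n 2] by (simp add: numeral_3_eq_3 numeral_2_eq_2)
  also have "\<dots> \<longleftrightarrow> (\<exists>i j k. k < j \<and> n = 2 ^ i + (2 ^ j + 2 ^ k) \<and> 2 ^ j + 2 ^ k < (2 ^ i :: nat))"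
    by blast
  also have "\<dots> \<longleftrightarrow> (\<exists>i j k. k < j \<and> j < i \<and> n = 2 ^ i + 2 ^ j + 2 ^ k)"
    using lt by (simp only: add.assoc cong: conj_cong) blast
  finally show ?thesis .
qed

text \<open>\<open>3 * 2^k\<close> has exactly two digits 1, and they are adjacent. This separates
  the pairs with \<open>\<tau> \<le> \<sigma> - 2\<close> in class 6 from the families with
  \<open>3 * 2^\<sigma>\<close> in class 2.\<close>

lemma three_times_power_digits:
  fixes i j k :: nat
  assumes "j < i"
  shows "(\<exists>k. 2 ^ i + 2 ^ j = 3 * (2 :: nat) ^ k) \<longleftrightarrow> i = j + 1"
proof
  assume "\<exists>k. 2 ^ i + 2 ^ j = 3 * (2 :: nat) ^ k"
  then obtain k where "2 ^ i + 2 ^ j = 3 * (2 :: nat) ^ k" by blast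
  with assms show "i = j + 1"
  proof (induction k arbitrary: i j)
    case 0
    then have "2 ^ i + 2 ^ j = (3 :: nat)" by simp
    moreover have "(1 :: nat) \<le> 2 ^ j" by simp
    ultimately have "(2 :: nat) ^ i \<le> 2" by linarith
    then have "(2 :: nat) ^ i \<le> 2 ^ 1" by simp
    then have "i \<le> 1" by (rule power_le_imp_le_exp[rotated]) simp
    with 0 show ?case by simp
  next
    case (Suc k)
    obtain i' where i: "i = Suc i'" using Suc.prems(1) by (cases i) auto
    have "j \<noteq> 0"
    proof
      assume "j = 0"
      with Suc.prems(2) i have "2 * 2 ^ i' + 1 = 2 * (3 * (2 :: nat) ^ k)" by simp
      then show False by presburger
    qed
    then obtain j' where j: "j = Suc j'" by (cases j) auto
    have "2 ^ i' + 2 ^ j' = 3 * (2 :: nat) ^ k" using Suc.prems(2) by (simp add: i j)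
    with Suc.IH[of j' i'] Suc.prems(1) show ?case by (simp add: i j)
  qed
next
  assume "i = j + 1"
  then have "2 ^ i + 2 ^ j = 3 * (2 :: nat) ^ j" by simp
  then show "\<exists>k. 2 ^ i + 2 ^ j = 3 * (2 :: nat) ^ k" by blast
qed

lemma three_times_power_digit_sum: "digit_sum (3 * 2 ^ k) = 2"
  unfolding digit_sum_2_iff by (intro exI[of _ "Suc k"] exI[of _ k]) simp

text \<open>
  The shift by 6 turns all offsets of the index families into remainders modulo 32, so that
  membership in a family is a condition on \<open>r\<close> and on the binary digits of \<open>q\<close>.
\<close>

context
  fixes n q r :: nat
  assumes n: "n + 6 = 32 * q + r" and r: "r < 32"
begin

lemma shifted_multiple_iff:
  assumes "0 \<le> d + 6" "d + 6 < 32"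
  shows "int n = 32 * int m + d \<longleftrightarrow> q = m \<and> int r = d + 6"
proof
  assume "int n = 32 * int m + d"
  then have eq: "32 * int q + int r = 32 * int m + (d + 6)" using n by linarith
  then have "(32 * int q + int r) div 32 = (32 * int m + (d + 6)) div 32" by (rule arg_cong)
  then have "q = m" using assms r by simp
  with eq show "q = m \<and> int r = d + 6" by simp
next
  assume "q = m \<and> int r = d + 6"
  with n show "int n = 32 * int m + d" by linarith
qed

lemma ex_shift: "(\<exists>\<sigma>\<ge>5. P \<sigma>) \<longleftrightarrow> (\<exists>i. P (i + 5))" for P :: "nat \<Rightarrow> bool"
  by (metis add.commute le_Suc_ex le_add2)

lemma single_iff:
  assumes "0 \<le> d + 6" "d + 6 < 32"
  shows "(\<exists>\<sigma>\<ge>5. int n = 2 ^ \<sigma> + d) \<longleftrightarrow> digit_sum q = 1 \<and> int r = d + 6"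
  unfolding ex_shift digit_sum_1_iff
  using shifted_multiple_iff[OF assms, of "2 ^ _"] by (simp add: power_add mult.commute)

lemma triple_power_iff:
  assumes "0 \<le> d + 6" "d + 6 < 32"
  shows "(\<exists>\<sigma>\<ge>5. int n = 3 * 2 ^ \<sigma> + d) \<longleftrightarrow> (\<exists>i. q = 3 * 2 ^ i) \<and> int r = d + 6"
  unfolding ex_shift
  using shifted_multiple_iff[OF assms, of "3 * 2 ^ _"] by (simp add: power_add algebra_simps)

lemma ex_shift_pair:
  "(\<exists>\<sigma> \<tau>. 5 \<le> \<tau> \<and> \<tau> + c \<le> \<sigma> \<and> P \<sigma> \<tau>) \<longleftrightarrow> (\<exists>i j. j + c \<le> i \<and> P (i + 5) (j + 5))"
  for P :: "nat \<Rightarrow> nat \<Rightarrow> bool"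
proof
  assume "\<exists>\<sigma> \<tau>. 5 \<le> \<tau> \<and> \<tau> + c \<le> \<sigma> \<and> P \<sigma> \<tau>"
  then obtain \<sigma> \<tau> where "5 \<le> \<tau>" "\<tau> + c \<le> \<sigma>" "P \<sigma> \<tau>" by blast
  then have "\<tau> - 5 + c \<le> \<sigma> - 5 \<and> P (\<sigma> - 5 + 5) (\<tau> - 5 + 5)" by auto
  then show "\<exists>i j. j + c \<le> i \<and> P (i + 5) (j + 5)" by blast
next
  assume "\<exists>i j. j + c \<le> i \<and> P (i + 5) (j + 5)"
  then obtain i j where "j + c \<le> i" "P (i + 5) (j + 5)" by blast
  then have "5 \<le> j + 5 \<and> j + 5 + c \<le> i + 5 \<and> P (i + 5) (j + 5)" by simp
  then show "\<exists>\<sigma> \<tau>. 5 \<le> \<tau> \<and> \<tau> + c \<le> \<sigma> \<and> P \<sigma> \<tau>" by blast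
qed

lemma pair_iff:
  assumes "0 \<le> d + 6" "d + 6 < 32"
  shows "(\<exists>\<sigma> \<tau>. 5 \<le> \<tau> \<and> \<tau> < \<sigma> \<and> int n = 2 ^ \<sigma> + 2 ^ \<tau> + d) \<longleftrightarrow> digit_sum q = 2 \<and> int r = d + 6"
proof -
  have "(\<exists>\<sigma> \<tau>. 5 \<le> \<tau> \<and> \<tau> < \<sigma> \<and> int n = 2 ^ \<sigma> + 2 ^ \<tau> + d) \<longleftrightarrow>
      (\<exists>i j. j < i \<and> int n = 2 ^ (i + 5) + 2 ^ (j + 5) + d)"
    using ex_shift_pair[of 1 "\<lambda>\<sigma> \<tau>. int n = 2 ^ \<sigma> + 2 ^ \<tau> + d"] by (simp only: Suc_eq_plus1[symmetric] Suc_le_eq)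
  also have "\<dots> \<longleftrightarrow> (\<exists>i j. j < i \<and> q = 2 ^ i + 2 ^ j \<and> int r = d + 6)"
    using shifted_multiple_iff[OF assms, of "2 ^ _ + 2 ^ _"] by (simp add: power_add algebra_simps)
  finally show ?thesis unfolding digit_sum_2_iff by blast
qed

lemma distant_pair_iff:
  assumes "0 \<le> d + 6" "d + 6 < 32"
  shows "(\<exists>\<sigma> \<tau>. 5 \<le> \<tau> \<and> \<tau> + 2 \<le> \<sigma> \<and> int n = 2 ^ \<sigma> + 2 ^ \<tau> + d) \<longleftrightarrow>
    digit_sum q = 2 \<and> \<not> (\<exists>i. q = 3 * 2 ^ i) \<and> int r = d + 6"
proof -
  have "(\<exists>\<sigma> \<tau>. 5 \<le> \<tau> \<and> \<tau> + 2 \<le> \<sigma> \<and> int n = 2 ^ \<sigma> + 2 ^ \<tau> + d) \<longleftrightarrow>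
      (\<exists>i j. j + 2 \<le> i \<and> int n = 2 ^ (i + 5) + 2 ^ (j + 5) + d)"
    by (rule ex_shift_pair)
  also have "\<dots> \<longleftrightarrow> (\<exists>i j. j + 2 \<le> i \<and> q = 2 ^ i + 2 ^ j \<and> int r = d + 6)"
    using shifted_multiple_iff[OF assms, of "2 ^ _ + 2 ^ _"] by (simp add: power_add algebra_simps)
  also have "\<dots> \<longleftrightarrow> (\<exists>i j. j < i \<and> i \<noteq> j + 1 \<and> q = 2 ^ i + 2 ^ j \<and> int r = d + 6)"
  proof -
    have "j + 2 \<le> i \<longleftrightarrow> j < i \<and> i \<noteq> j + 1" for i j :: nat by auto
    then show ?thesis by simp
  qed
  also have "\<dots> \<longleftrightarrow> digit_sum q = 2 \<and> \<not> (\<exists>i. q = 3 * 2 ^ i) \<and> int r = d + 6"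
  proof
    assume "\<exists>i j. j < i \<and> i \<noteq> j + 1 \<and> q = 2 ^ i + 2 ^ j \<and> int r = d + 6"
    then obtain i j where ij: "j < i" "i \<noteq> j + 1" "q = 2 ^ i + 2 ^ j" "int r = d + 6" by blast
    then have "\<not> (\<exists>i. q = 3 * 2 ^ i)" using three_times_power_digits[OF ij(1)] by simp
    with ij show "digit_sum q = 2 \<and> \<not> (\<exists>i. q = 3 * 2 ^ i) \<and> int r = d + 6"
      unfolding digit_sum_2_iff by blast
  next
    assume *: "digit_sum q = 2 \<and> \<not> (\<exists>i. q = 3 * 2 ^ i) \<and> int r = d + 6"
    then obtain i j where ij: "j < i" "q = 2 ^ i + 2 ^ j" unfolding digit_sum_2_iff by blast
    then have "i \<noteq> j + 1" using * three_times_power_digits[OF ij(1)] by simp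
    with ij * show "\<exists>i j. j < i \<and> i \<noteq> j + 1 \<and> q = 2 ^ i + 2 ^ j \<and> int r = d + 6" by blast
  qed
  finally show ?thesis .
qed

lemma triple_iff:
  assumes "0 \<le> d + 6" "d + 6 < 32"
  shows "(\<exists>\<sigma> \<tau> \<nu>. 5 \<le> \<tau> \<and> \<tau> < \<nu> \<and> \<nu> < \<sigma> \<and> int n = 2 ^ \<sigma> + 2 ^ \<tau> + 2 ^ \<nu> + d)
    \<longleftrightarrow> digit_sum q = 3 \<and> int r = d + 6"
proof -
  have "(\<exists>\<sigma> \<tau> \<nu>. 5 \<le> \<tau> \<and> \<tau> < \<nu> \<and> \<nu> < \<sigma> \<and> int n = 2 ^ \<sigma> + 2 ^ \<tau> + 2 ^ \<nu> + d) \<longleftrightarrow>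
      (\<exists>i j k. k < j \<and> j < i \<and> int n = 2 ^ (i + 5) + 2 ^ (k + 5) + 2 ^ (j + 5) + d)" (is "?L \<longleftrightarrow> ?R")
  proof
    assume ?L
    then obtain \<sigma> \<tau> \<nu> where *: "5 \<le> \<tau>" "\<tau> < \<nu>" "\<nu> < \<sigma>" "int n = 2 ^ \<sigma> + 2 ^ \<tau> + 2 ^ \<nu> + d" by blast
    then have "\<tau> - 5 < \<nu> - 5 \<and> \<nu> - 5 < \<sigma> - 5 \<and> int n = 2 ^ (\<sigma> - 5 + 5) + 2 ^ (\<tau> - 5 + 5) + 2 ^ (\<nu> - 5 + 5) + d"
      by auto
    then show ?R by blast
  next
    assume ?R
    then obtain i j k where "k < j" "j < i" "int n = 2 ^ (i + 5) + 2 ^ (k + 5) + 2 ^ (j + 5) + d" by blast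
    then have "5 \<le> k + 5 \<and> k + 5 < j + 5 \<and> j + 5 < i + 5 \<and> int n = 2 ^ (i + 5) + 2 ^ (k + 5) + 2 ^ (j + 5) + d" by auto
    then show ?L by blast
  qed
  also have "\<dots> \<longleftrightarrow> (\<exists>i j k. k < j \<and> j < i \<and> q = 2 ^ i + 2 ^ j + 2 ^ k \<and> int r = d + 6)"
    using shifted_multiple_iff[OF assms, of "2 ^ _ + 2 ^ _ + 2 ^ _"] by (simp add: power_add algebra_simps)
  finally show ?thesis unfolding digit_sum_3_iff by blast
qed

lemma ex_ge_4: "(\<exists>\<sigma>\<ge>4. P \<sigma>) \<longleftrightarrow> P 4 \<or> (\<exists>\<sigma>\<ge>5. P \<sigma>)" for P :: "nat \<Rightarrow> bool"
proof -
  have "\<sigma> \<ge> 4 \<longleftrightarrow> \<sigma> = 4 \<or> \<sigma> \<ge> 5" for \<sigma> :: nat by auto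
  then show ?thesis by metis
qed

lemma ex_ge_5: "(\<exists>\<sigma>\<ge>5. P \<sigma>) \<longleftrightarrow> P 5 \<or> (\<exists>\<sigma>\<ge>6. P \<sigma>)" for P :: "nat \<Rightarrow> bool"
proof -
  have "\<sigma> \<ge> 5 \<longleftrightarrow> \<sigma> = 5 \<or> \<sigma> \<ge> 6" for \<sigma> :: nat by auto
  then show ?thesis by metis
qed

text \<open>The additional index 13 is \<open>2^4 - 3\<close>, too small for the digits of
  \<open>q\<close>.\<close>

lemma index_class1_iff: "index_class1 n \<longleftrightarrow> n \<in> {1, 2, 10, 13} \<or> digit_sum q = 1 \<and> r = 3"
  unfolding index_class1_def ex_ge_4 using single_iff[of "- 3"] by auto

lemma index_class2_iff:
  "index_class2 n \<longleftrightarrow> n \<in> {7, 9, 17, 18, 27, 42} \<or> (\<exists>i. q = 3 * 2 ^ i) \<and> r \<in> {0, 3}"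
proof -
  have t: "(\<exists>\<sigma>\<ge>5. int n = 3 * 2 ^ \<sigma> - 3) \<longleftrightarrow> (\<exists>i. q = 3 * 2 ^ i) \<and> r = 3"
    "(\<exists>\<sigma>\<ge>5. int n = 3 * 2 ^ \<sigma> - 6) \<longleftrightarrow> (\<exists>i. q = 3 * 2 ^ i) \<and> r = 0"
    using triple_power_iff[of "- 3"] triple_power_iff[of "- 6"] by simp_all
  have "index_class2 n \<longleftrightarrow> n \<in> {7, 9, 17, 18, 27, 42}
    \<or> (\<exists>\<sigma>\<ge>5. int n = 3 * 2 ^ \<sigma> - 3) \<or> (\<exists>\<sigma>\<ge>5. int n = 3 * 2 ^ \<sigma> - 6)"
    unfolding index_class2_def by blast
  then show ?thesis unfolding t by auto
qed

lemma index_class5_iff: "index_class5 n \<longleftrightarrow> n = 5 \<or> digit_sum q = 1 \<and> r = 0"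
  unfolding index_class5_def using single_iff[of "- 6"] by auto

text \<open>The indices 14, 19 and 21 are the members with exponent 4. The family
  \<open>2^\<sigma> + 10\<close> starts only at 6, so 42, its would-be member at exponent 5, is cut
  out.\<close>

lemma index_class6_iff:
  "index_class6 n \<longleftrightarrow> n \<in> {6, 11, 14, 19, 21} \<or> digit_sum q = 1 \<and> r \<in> {4, 7, 8, 9, 11, 19}
    \<or> digit_sum q = 1 \<and> r = 16 \<and> n \<noteq> 42
    \<or> digit_sum q = 2 \<and> \<not> (\<exists>i. q = 3 * 2 ^ i) \<and> r \<in> {0, 3}"
proof -
  have 1: "(\<exists>\<sigma>\<ge>4. \<exists>d\<in>{- 2, 3, 5}. int n = 2 ^ \<sigma> + d) \<longleftrightarrow>
      n \<in> {14, 19, 21} \<or> (\<exists>\<sigma>\<ge>5. int n = 2 ^ \<sigma> + (- 2)) \<or> (\<exists>\<sigma>\<ge>5. int n = 2 ^ \<sigma> + 3) \<or> (\<exists>\<sigma>\<ge>5. int n = 2 ^ \<sigma> + 5)"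
    unfolding ex_ge_4 by auto
  have 2: "(\<exists>\<sigma>\<ge>5. \<exists>d\<in>{1, 2, 13}. int n = 2 ^ \<sigma> + d) \<longleftrightarrow>
      (\<exists>\<sigma>\<ge>5. int n = 2 ^ \<sigma> + 1) \<or> (\<exists>\<sigma>\<ge>5. int n = 2 ^ \<sigma> + 2) \<or> (\<exists>\<sigma>\<ge>5. int n = 2 ^ \<sigma> + 13)"
    by auto
  have 3: "(\<exists>\<sigma>\<ge>6. int n = 2 ^ \<sigma> + 10) \<longleftrightarrow> (\<exists>\<sigma>\<ge>5. int n = 2 ^ \<sigma> + 10) \<and> n \<noteq> 42"
  proof -
    have "n \<noteq> 42" if "\<sigma> \<ge> 6" "int n = 2 ^ \<sigma> + 10" for \<sigma>
    proof -
      have "(2 :: int) ^ 6 \<le> 2 ^ \<sigma>" using that by (intro power_increasing) auto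
      with that show ?thesis by auto
    qed
    then show ?thesis unfolding ex_ge_5[of "\<lambda>\<sigma>. int n = 2 ^ \<sigma> + 10"] by auto
  qed
  have c: "7 \<le> \<sigma> \<and> 5 \<le> \<tau> \<and> \<tau> \<le> \<sigma> - 2 \<and> Z \<longleftrightarrow> 5 \<le> \<tau> \<and> \<tau> + 2 \<le> \<sigma> \<and> Z" for \<sigma> \<tau> :: nat and Z by auto
  have 4: "(\<exists>\<sigma> \<tau>. \<sigma> \<ge> 7 \<and> 5 \<le> \<tau> \<and> \<tau> \<le> \<sigma> - 2 \<and> (\<exists>d\<in>{- 6, - 3}. int n = 2 ^ \<sigma> + 2 ^ \<tau> + d)) \<longleftrightarrow>
      (\<exists>\<sigma> \<tau>. 5 \<le> \<tau> \<and> \<tau> + 2 \<le> \<sigma> \<and> int n = 2 ^ \<sigma> + 2 ^ \<tau> + (- 6)) \<or>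
      (\<exists>\<sigma> \<tau>. 5 \<le> \<tau> \<and> \<tau> + 2 \<le> \<sigma> \<and> int n = 2 ^ \<sigma> + 2 ^ \<tau> + (- 3))"
    unfolding c by blast
  have single: "(\<exists>\<sigma>\<ge>5. int n = 2 ^ \<sigma> + (- 2)) \<longleftrightarrow> digit_sum q = 1 \<and> r = 4"
    "(\<exists>\<sigma>\<ge>5. int n = 2 ^ \<sigma> + 3) \<longleftrightarrow> digit_sum q = 1 \<and> r = 9"
    "(\<exists>\<sigma>\<ge>5. int n = 2 ^ \<sigma> + 5) \<longleftrightarrow> digit_sum q = 1 \<and> r = 11"
    "(\<exists>\<sigma>\<ge>5. int n = 2 ^ \<sigma> + 1) \<longleftrightarrow> digit_sum q = 1 \<and> r = 7"
    "(\<exists>\<sigma>\<ge>5. int n = 2 ^ \<sigma> + 2) \<longleftrightarrow> digit_sum q = 1 \<and> r = 8"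
    "(\<exists>\<sigma>\<ge>5. int n = 2 ^ \<sigma> + 13) \<longleftrightarrow> digit_sum q = 1 \<and> r = 19"
    "(\<exists>\<sigma>\<ge>5. int n = 2 ^ \<sigma> + 10) \<longleftrightarrow> digit_sum q = 1 \<and> r = 16"
    using single_iff[of "- 2"] single_iff[of 3] single_iff[of 5] single_iff[of 1] single_iff[of 2]
      single_iff[of 13] single_iff[of 10] by simp_all
  have pair: "(\<exists>\<sigma> \<tau>. 5 \<le> \<tau> \<and> \<tau> + 2 \<le> \<sigma> \<and> int n = 2 ^ \<sigma> + 2 ^ \<tau> + (- 6))
      \<longleftrightarrow> digit_sum q = 2 \<and> \<not> (\<exists>i. q = 3 * 2 ^ i) \<and> r = 0"
    "(\<exists>\<sigma> \<tau>. 5 \<le> \<tau> \<and> \<tau> + 2 \<le> \<sigma> \<and> int n = 2 ^ \<sigma> + 2 ^ \<tau> + (- 3))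
      \<longleftrightarrow> digit_sum q = 2 \<and> \<not> (\<exists>i. q = 3 * 2 ^ i) \<and> r = 3"
    using distant_pair_iff[of "- 6"] distant_pair_iff[of "- 3"] by simp_all
  show ?thesis
    unfolding index_class6_def 1 2 3 4 single pair by (cases "digit_sum q = 1") auto
qed

text \<open>Eight of the listed exceptions, from 38 to 53, are \<open>2^5\<close> plus an offset of
  the first family; they are absorbed by letting it start at 5.\<close>

lemma index_class4_iff:
  "index_class4 n \<longleftrightarrow> n \<in> {3, 12, 22, 23, 36, 54, 63}
    \<or> digit_sum q = 1 \<and> r \<in> {12, 13, 17, 20, 23, 24, 25, 27}
    \<or> digit_sum q = 2 \<and> r \<in> {4, 7, 8, 9, 11, 16, 19}
    \<or> digit_sum q = 3 \<and> r \<in> {0, 3}"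
proof -
  have 1: "n \<in> {3, 12, 22, 23, 36, 38, 39, 43, 46, 49, 50, 51, 53, 54, 63} \<or> (\<exists>\<sigma>\<ge>6. \<exists>d\<in>{6, 7, 11, 14, 17, 18, 19, 21}. int n = 2 ^ \<sigma> + d) \<longleftrightarrow>
      n \<in> {3, 12, 22, 23, 36, 54, 63} \<or> (\<exists>\<sigma>\<ge>5. int n = 2 ^ \<sigma> + 6) \<or> (\<exists>\<sigma>\<ge>5. int n = 2 ^ \<sigma> + 7)
      \<or> (\<exists>\<sigma>\<ge>5. int n = 2 ^ \<sigma> + 11) \<or> (\<exists>\<sigma>\<ge>5. int n = 2 ^ \<sigma> + 14) \<or> (\<exists>\<sigma>\<ge>5. int n = 2 ^ \<sigma> + 17)
      \<or> (\<exists>\<sigma>\<ge>5. int n = 2 ^ \<sigma> + 18) \<or> (\<exists>\<sigma>\<ge>5. int n = 2 ^ \<sigma> + 19) \<or> (\<exists>\<sigma>\<ge>5. int n = 2 ^ \<sigma> + 21)"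
    unfolding ex_ge_5 by auto
  have c2: "6 \<le> \<sigma> \<and> 5 \<le> \<tau> \<and> \<tau> \<le> \<sigma> - 1 \<and> Z \<longleftrightarrow> 5 \<le> \<tau> \<and> \<tau> < \<sigma> \<and> Z" for \<sigma> \<tau> :: nat and Z by auto
  have 2: "(\<exists>\<sigma> \<tau>. \<sigma> \<ge> 6 \<and> 5 \<le> \<tau> \<and> \<tau> \<le> \<sigma> - 1 \<and> (\<exists>d\<in>{- 2, 1, 2, 3, 5, 10, 13}. int n = 2 ^ \<sigma> + 2 ^ \<tau> + d)) \<longleftrightarrow>
      (\<exists>d\<in>{- 2, 1, 2, 3, 5, 10, 13}. \<exists>\<sigma> \<tau>. 5 \<le> \<tau> \<and> \<tau> < \<sigma> \<and> int n = 2 ^ \<sigma> + 2 ^ \<tau> + d)"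
    unfolding c2 by blast
  have c3: "7 \<le> \<sigma> \<and> 6 \<le> \<nu> \<and> \<nu> \<le> \<sigma> - 1 \<and> 5 \<le> \<tau> \<and> \<tau> \<le> \<nu> - 1 \<and> Z
      \<longleftrightarrow> 5 \<le> \<tau> \<and> \<tau> < \<nu> \<and> \<nu> < \<sigma> \<and> Z" for \<sigma> \<tau> \<nu> :: nat and Z by auto
  have 3: "(\<exists>\<sigma> \<tau> \<nu>. \<sigma> \<ge> 7 \<and> 6 \<le> \<nu> \<and> \<nu> \<le> \<sigma> - 1 \<and> 5 \<le> \<tau> \<and> \<tau> \<le> \<nu> - 1 \<and>
        (\<exists>d\<in>{- 6, - 3}. int n = 2 ^ \<sigma> + 2 ^ \<tau> + 2 ^ \<nu> + d)) \<longleftrightarrow>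
      (\<exists>d\<in>{- 6, - 3}. \<exists>\<sigma> \<tau> \<nu>. 5 \<le> \<tau> \<and> \<tau> < \<nu> \<and> \<nu> < \<sigma> \<and> int n = 2 ^ \<sigma> + 2 ^ \<tau> + 2 ^ \<nu> + d)"
    unfolding c3 by blast
  have r2: "(\<exists>d\<in>{- 2, 1, 2, 3, 5, 10, 13}. \<exists>\<sigma> \<tau>. 5 \<le> \<tau> \<and> \<tau> < \<sigma> \<and> int n = 2 ^ \<sigma> + 2 ^ \<tau> + d)
      \<longleftrightarrow> digit_sum q = 2 \<and> r \<in> {4, 7, 8, 9, 11, 16, 19}"
  proof -
    have "(\<exists>d\<in>{- 2, 1, 2, 3, 5, 10, 13}. \<exists>\<sigma> \<tau>. 5 \<le> \<tau> \<and> \<tau> < \<sigma> \<and> int n = 2 ^ \<sigma> + 2 ^ \<tau> + d)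
      \<longleftrightarrow> (\<exists>d\<in>{- 2, 1, 2, 3, 5, 10, 13}. digit_sum q = 2 \<and> int r = d + 6)"
      by (intro bex_cong refl pair_iff) auto
    then show ?thesis by auto
  qed
  have r3: "(\<exists>d\<in>{- 6, - 3}. \<exists>\<sigma> \<tau> \<nu>. 5 \<le> \<tau> \<and> \<tau> < \<nu> \<and> \<nu> < \<sigma> \<and> int n = 2 ^ \<sigma> + 2 ^ \<tau> + 2 ^ \<nu> + d)
      \<longleftrightarrow> digit_sum q = 3 \<and> r \<in> {0, 3}"
  proof -
    have "(\<exists>d\<in>{- 6, - 3}. \<exists>\<sigma> \<tau> \<nu>. 5 \<le> \<tau> \<and> \<tau> < \<nu> \<and> \<nu> < \<sigma> \<and> int n = 2 ^ \<sigma> + 2 ^ \<tau> + 2 ^ \<nu> + d)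
      \<longleftrightarrow> (\<exists>d\<in>{- 6, - 3}. digit_sum q = 3 \<and> int r = d + 6)"
      by (intro bex_cong refl triple_iff) auto
    then show ?thesis by auto
  qed
  have r1: "(\<exists>\<sigma>\<ge>5. int n = 2 ^ \<sigma> + 6) \<or> (\<exists>\<sigma>\<ge>5. int n = 2 ^ \<sigma> + 7)
      \<or> (\<exists>\<sigma>\<ge>5. int n = 2 ^ \<sigma> + 11) \<or> (\<exists>\<sigma>\<ge>5. int n = 2 ^ \<sigma> + 14) \<or> (\<exists>\<sigma>\<ge>5. int n = 2 ^ \<sigma> + 17)
      \<or> (\<exists>\<sigma>\<ge>5. int n = 2 ^ \<sigma> + 18) \<or> (\<exists>\<sigma>\<ge>5. int n = 2 ^ \<sigma> + 19) \<or> (\<exists>\<sigma>\<ge>5. int n = 2 ^ \<sigma> + 21)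
      \<longleftrightarrow> digit_sum q = 1 \<and> r \<in> {12, 13, 17, 20, 23, 24, 25, 27}"
  proof -
    have "(\<exists>\<sigma>\<ge>5. int n = 2 ^ \<sigma> + int d) \<longleftrightarrow> digit_sum q = 1 \<and> r = d + 6" if "d + 6 < 32" for d
      using single_iff[of "int d"] that by auto
    from this[of 6] this[of 7] this[of 11] this[of 14] this[of 17] this[of 18] this[of 19] this[of 21]
    show ?thesis by simp blast
  qed
  show ?thesis
    unfolding index_class4_def disj_assoc[symmetric] unfolding 1 2 3 r2 r3 unfolding disj_assoc r1[symmetric] by simp
qed

end

section \<open>Combining both kinds of subgroups\<close>

definition subgroups_residue :: "nat \<Rightarrow> int" where
  "subgroups_residue n = numer $ (n + 6) + (if 9 dvd n then free_solution $ (n div 9 - 1) else 0)"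

lemma num_subgroups_cong:
  assumes "n \<ge> 1" shows "[int (num_subgroups Gamma33 n) = subgroups_residue n] (mod 8)"
proof -
  have "[int (kind_subgroups False n) = (if 9 dvd n then free_solution $ (n div 9 - 1) else 0)] (mod 8)"
  proof (cases "9 dvd n")
    case True
    then obtain j where "n = 9 * j" by blast
    with assms obtain k where k: "n = 9 * (k + 1)" by (cases j) auto
    then have "int (kind_subgroups False n) = free_fps $ k" by (simp add: free_fps_def)
    moreover have "n div 9 - 1 = k" using k by simp
    ultimately show ?thesis using free_fps_mod_8[of k] True by simp
  qed (simp add: acts_coeff_free_zero)
  then show ?thesis
    using cong_add[OF trivial_subgroups_mod_8[OF assms]] num_subgroups_Gamma33[OF assms]
    by (simp add: subgroups_residue_def)
qed

definition classified :: "nat \<Rightarrow> int \<Rightarrow> bool" where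
  "classified n v \<longleftrightarrow> (v mod 8 = 1 \<longleftrightarrow> index_class1 n) \<and> (v mod 8 = 2 \<longleftrightarrow> index_class2 n)
    \<and> (v mod 8 = 4 \<longleftrightarrow> index_class4 n) \<and> (v mod 8 = 5 \<longleftrightarrow> index_class5 n)
    \<and> (v mod 8 = 6 \<longleftrightarrow> index_class6 n) \<and> v mod 8 \<noteq> 3 \<and> v mod 8 \<noteq> 7"

lemma less_32_cases:
  fixes r :: nat
  assumes "r < 32"
  shows "r = 0 \<or> r = 1 \<or> r = 2 \<or> r = 3 \<or> r = 4 \<or> r = 5 \<or> r = 6 \<or> r = 7
      \<or> r = 8 \<or> r = 9 \<or> r = 10 \<or> r = 11 \<or> r = 12 \<or> r = 13 \<or> r = 14
      \<or> r = 15 \<or> r = 16 \<or> r = 17 \<or> r = 18 \<or> r = 19 \<or> r = 20 \<or> r = 21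
      \<or> r = 22 \<or> r = 23 \<or> r = 24 \<or> r = 25 \<or> r = 26 \<or> r = 27 \<or> r = 28
      \<or> r = 29 \<or> r = 30 \<or> r = 31"
  using assms by presburger

text \<open>From \<open>q = 3\<close> on, that is \<open>n \<ge> 90\<close>, both
  \<open>coeff_1\<close> and \<open>free_solution\<close> are exhausted. The residue depends only on
  \<open>r\<close>, on whether the digit sum of \<open>q\<close> is 1, 2, 3 or another number, and
  on whether \<open>q\<close> is of the form \<open>3 * 2^i\<close>.\<close>

lemma classified_large:
  assumes n: "n + 6 = 32 * q + r" and r: "r < 32" and q: "q \<ge> 3"
  shows "classified n (subgroups_residue n)"
proof -
  define \<psi> where "\<psi> \<longleftrightarrow> (\<exists>i. q = 3 * 2 ^ i)"
  have \<psi>: "\<psi> \<Longrightarrow> digit_sum q = 2" using three_times_power_digit_sum by (auto simp: \<psi>_def)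
  have n90: "n \<ge> 90" using n q by linarith
  have "coeff_1 fps_X $ (32 * q + r) = 0"
    using q by (simp add: coeff_1_def numeral_fps_const)
  moreover have "free_solution $ (n div 9 - 1) = 0"
  proof -
    have "n div 9 - 1 \<ge> 9" using div_le_mono[OF n90, of 9] by simp
    then show ?thesis by (simp add: free_solution_def numeral_fps_const)
  qed
  ultimately have v: "subgroups_residue n =
      (\<Sum>(i, c) \<leftarrow> [(0, 5), (3, 1), (4, 6), (7, 6), (8, 6), (9, 6), (11, 6), (12, 4), (13, 4), (16, 6), (17, 4), (19, 6), (20, 4), (23, 4), (24, 4), (25, 4), (27, 4)]. if i = r then c * of_bool (digit_sum q = 1) else 0)
    + (\<Sum>(i, c) \<leftarrow> [(0, 6), (3, 6), (4, 4), (7, 4), (8, 4), (9, 4), (11, 4), (16, 4), (19, 4)]. if i = r then c * of_bool (digit_sum q = 2) else 0)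
    + (\<Sum>(i, c) \<leftarrow> [(0, 4), (3, 4)]. if i = r then c * (of_bool (digit_sum q = 3) + of_bool \<psi>) else 0)"
    unfolding subgroups_residue_def n numer_nth[OF r] by (simp add: \<alpha>_def \<beta>_def \<gamma>_def \<psi>_def)
  have small: "n \<notin> {1, 2, 10, 13}" "n \<notin> {7, 9, 17, 18, 27, 42}" "n \<noteq> 5" "n \<notin> {6, 11, 14, 19, 21}" "n \<noteq> 42"
    "n \<notin> {3, 12, 22, 23, 36, 54, 63}" using n90 by auto
  have classes: "classified n v \<longleftrightarrow> (v mod 8 = 1 \<longleftrightarrow> digit_sum q = 1 \<and> r = 3) \<and> (v mod 8 = 2 \<longleftrightarrow> \<psi> \<and> r \<in> {0, 3})
    \<and> (v mod 8 = 4 \<longleftrightarrow> digit_sum q = 1 \<and> r \<in> {12, 13, 17, 20, 23, 24, 25, 27}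
      \<or> digit_sum q = 2 \<and> r \<in> {4, 7, 8, 9, 11, 16, 19} \<or> digit_sum q = 3 \<and> r \<in> {0, 3})
    \<and> (v mod 8 = 5 \<longleftrightarrow> digit_sum q = 1 \<and> r = 0)
    \<and> (v mod 8 = 6 \<longleftrightarrow> digit_sum q = 1 \<and> r \<in> {4, 7, 8, 9, 11, 19} \<or> digit_sum q = 1 \<and> r = 16
      \<or> digit_sum q = 2 \<and> \<not> \<psi> \<and> r \<in> {0, 3}) \<and> v mod 8 \<noteq> 3 \<and> v mod 8 \<noteq> 7" for v
    unfolding classified_def index_class1_iff[OF n r] index_class2_iff[OF n r] index_class4_iff[OF n r]
      index_class5_iff[OF n r] index_class6_iff[OF n r] \<psi>_def[symmetric]
    by (simp only: small simp_thms)
  consider "digit_sum q = 1" "\<not> \<psi>" | "digit_sum q = 2" "\<psi>" | "digit_sum q = 2" "\<not> \<psi>" | "digit_sum q = 3" "\<not> \<psi>"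
    | "digit_sum q \<noteq> 1" "digit_sum q \<noteq> 2" "digit_sum q \<noteq> 3" "\<not> \<psi>"
    using \<psi> by fastforce
  then show ?thesis
  proof cases
    case 1
    then show ?thesis unfolding classes v using less_32_cases[OF r] by (elim disjE) simp_all
  next
    case 2
    then show ?thesis unfolding classes v using less_32_cases[OF r] by (elim disjE) simp_all
  next
    case 3
    then show ?thesis unfolding classes v using less_32_cases[OF r] by (elim disjE) simp_all
  next
    case 4
    then show ?thesis unfolding classes v using less_32_cases[OF r] by (elim disjE) simp_all
  next
    case 5
    then show ?thesis unfolding classes v by simp
  qed
qed

text \<open>The indices up to 89, checked one by one; here \<open>q\<close> is too small for a
  triple power of two.\<close>

lemma classified_small:
  assumes n: "n + 6 = 32 * q + r" and r: "r < 32" and q: "q < 3" and pos: "n \<ge> 1"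
  shows "classified n (subgroups_residue n)"
proof -
  have \<psi>: "\<not> (\<exists>i. q = 3 * 2 ^ i)" "q \<noteq> 3 * 2 ^ i" for i
  proof -
    have "3 * 2 ^ i \<ge> (3 :: nat)" for i by simp
    then show "\<not> (\<exists>i. q = 3 * 2 ^ i)" "q \<noteq> 3 * 2 ^ i" using q by (metis not_le)+
  qed
  have ds: "digit_sum 0 = 0" "digit_sum 1 = 1" "digit_sum 2 = 1"
    using digit_sum.simps[of 1] digit_sum.simps[of 2] by simp_all
  have v: "subgroups_residue n = coeff_1 fps_X $ (32 * q + r)
    + (\<Sum>(i, c) \<leftarrow> [(0, 5), (3, 1), (4, 6), (7, 6), (8, 6), (9, 6), (11, 6), (12, 4), (13, 4), (16, 6), (17, 4), (19, 6), (20, 4), (23, 4), (24, 4), (25, 4), (27, 4)]. if i = r then c * of_bool (digit_sum q = 1) else 0)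
    + (\<Sum>(i, c) \<leftarrow> [(0, 6), (3, 6), (4, 4), (7, 4), (8, 4), (9, 4), (11, 4), (16, 4), (19, 4)]. if i = r then c * of_bool (digit_sum q = 2) else 0)
    + (\<Sum>(i, c) \<leftarrow> [(0, 4), (3, 4)]. if i = r then c * of_bool (digit_sum q = 3) else 0)
    + (if 9 dvd n then free_solution $ (n div 9 - 1) else 0)"
    unfolding subgroups_residue_def n numer_nth[OF r] using \<psi>(1) by (simp add: \<alpha>_def \<beta>_def \<gamma>_def)
  have n': "n = 32 * q + r - 6" using n by linarith
  have pos': "32 * q + r \<ge> 7" using n pos by linarith
  note defs = coeff_1_def free_solution_def numeral_fps_const
  have classes: "classified n v \<longleftrightarrow> (v mod 8 = 1 \<longleftrightarrow> n \<in> {1, 2, 10, 13} \<or> digit_sum q = 1 \<and> r = 3)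
    \<and> (v mod 8 = 2 \<longleftrightarrow> n \<in> {7, 9, 17, 18, 27, 42})
    \<and> (v mod 8 = 4 \<longleftrightarrow> n \<in> {3, 12, 22, 23, 36, 54, 63} \<or> digit_sum q = 1 \<and> r \<in> {12, 13, 17, 20, 23, 24, 25, 27}
      \<or> digit_sum q = 2 \<and> r \<in> {4, 7, 8, 9, 11, 16, 19} \<or> digit_sum q = 3 \<and> r \<in> {0, 3})
    \<and> (v mod 8 = 5 \<longleftrightarrow> n = 5 \<or> digit_sum q = 1 \<and> r = 0)
    \<and> (v mod 8 = 6 \<longleftrightarrow> n \<in> {6, 11, 14, 19, 21} \<or> digit_sum q = 1 \<and> r \<in> {4, 7, 8, 9, 11, 19}
      \<or> digit_sum q = 1 \<and> r = 16 \<and> n \<noteq> 42 \<or> digit_sum q = 2 \<and> r \<in> {0, 3}) \<and> v mod 8 \<noteq> 3 \<and> v mod 8 \<noteq> 7" for v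
    unfolding classified_def index_class1_iff[OF n r] index_class2_iff[OF n r] index_class4_iff[OF n r]
      index_class5_iff[OF n r] index_class6_iff[OF n r]
    by (simp only: \<psi>(1) simp_thms)
  consider "q = 0" | "q = 1" | "q = 2" using q by linarith
  then show ?thesis
  proof cases
    case 1
    have "r = 7 \<or> r = 8 \<or> r = 9 \<or> r = 10 \<or> r = 11 \<or> r = 12 \<or> r = 13
        \<or> r = 14 \<or> r = 15 \<or> r = 16 \<or> r = 17 \<or> r = 18 \<or> r = 19 \<or> r = 20
        \<or> r = 21 \<or> r = 22 \<or> r = 23 \<or> r = 24 \<or> r = 25 \<or> r = 26 \<or> r = 27
        \<or> r = 28 \<or> r = 29 \<or> r = 30 \<or> r = 31"
      using 1 r pos' by presburger
    with 1 show ?thesis unfolding classes v unfolding n'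
      by (elim disjE) (simp_all add: ds[unfolded One_nat_def] defs)
  next
    case 2
    then show ?thesis unfolding classes v unfolding n' using less_32_cases[OF r]
      by (elim disjE) (simp_all add: ds[unfolded One_nat_def] defs)
  next
    case 3
    then show ?thesis unfolding classes v unfolding n' using less_32_cases[OF r]
      by (elim disjE) (simp_all add: ds[unfolded One_nat_def] defs)
  qed
qed

theorem theorem31:
  fixes n :: nat
  assumes "n \<ge> 1"
  shows "([num_subgroups Gamma33 n = 1] (mod 8) \<longleftrightarrow> index_class1 n)
    \<and> ([num_subgroups Gamma33 n = 2] (mod 8) \<longleftrightarrow> index_class2 n)
    \<and> ([num_subgroups Gamma33 n = 4] (mod 8) \<longleftrightarrow> index_class4 n)
    \<and> ([num_subgroups Gamma33 n = 5] (mod 8) \<longleftrightarrow> index_class5 n)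
    \<and> ([num_subgroups Gamma33 n = 6] (mod 8) \<longleftrightarrow> index_class6 n)
    \<and> (\<not> index_class1 n \<and> \<not> index_class2 n \<and> \<not> index_class4 n \<and> \<not> index_class5 n
        \<and> \<not> index_class6 n \<longrightarrow> 8 dvd num_subgroups Gamma33 n)
    \<and> \<not> [num_subgroups Gamma33 n = 3] (mod 8)
    \<and> \<not> [num_subgroups Gamma33 n = 7] (mod 8)"
proof -
  define v where "v = subgroups_residue n mod 8"
  have "n + 6 = 32 * ((n + 6) div 32) + (n + 6) mod 32" "(n + 6) mod 32 < 32" by simp_all
  then have c: "classified n (subgroups_residue n)"
    using classified_large classified_small assms by (metis not_le)
  have v: "int (num_subgroups Gamma33 n mod 8) = v"
    using num_subgroups_cong[OF assms] by (simp add: v_def cong_def zmod_int)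
  have iff: "[num_subgroups Gamma33 n = k] (mod 8) \<longleftrightarrow> v = int k" if "k < 8" for k
    using that unfolding cong_def v[symmetric] by simp
  have "0 \<le> v" "v < 8" by (simp_all add: v_def)
  then have "v = 0 \<or> v = 1 \<or> v = 2 \<or> v = 3 \<or> v = 4 \<or> v = 5 \<or> v = 6 \<or> v = 7" by linarith
  moreover have "8 dvd num_subgroups Gamma33 n \<longleftrightarrow> v = 0"
    using v by presburger
  ultimately show ?thesis
    using c iff[of 1] iff[of 2] iff[of 3] iff[of 4] iff[of 5] iff[of 6] iff[of 7]
    unfolding classified_def v_def[symmetric] by simp blast
qed

end
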